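(* Fix $s\in[0,1]$ and $r\in[H^{-1}(1-s),\,1/2-H^{-1}(s)]$. For every $Y\in2^\omega$ with $\dim(Y)=1$ there is a sequence $X$ of dimension exactly $s$ such that $d(X,1)=r$ and $d(X,Y)=r$.
   Context: $K$ is prefix-free Kolmogorov complexity; $\dim(X)=\liminf_n K(X\restriction n)/n$, $\dim_P(X)=\limsup_n K(X\restriction n)/n$; dimension exactly $s$ means $\dim(X)=\dim_P(X)=s$. $d(X,Y)=\limsup_{n}|\{m<n:X(m)\ne Y(m)\}|/n$, and $d(X,1)=\inf\{d(X,Z):\dim(Z)=1\}$. $H$ is binary entropy and $H^{-1}:[0,1]\to[0,1/2]$ its inverse on $[0,1/2]$. *)

theory Defs
  imports Complex_Main "HOL-Library.Extended_Real" "HOL-Library.Liminf_Limsup"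
    "HOL-Library.Sublist"
begin

datatype recf = Zero | Succ | Proj nat | Comp recf "recf list" | Prim recf recf | Mu recf

inductive eval :: "recf \<Rightarrow> nat list \<Rightarrow> nat \<Rightarrow> bool" where
  eval_Zero: "eval Zero xs 0"
| eval_Succ: "eval Succ (x # xs) (Suc x)"
| eval_Proj: "i < length xs \<Longrightarrow> eval (Proj i) xs (xs ! i)"
| eval_Comp: "list_all2 (\<lambda>g z. eval g xs z) gs zs \<Longrightarrow> eval f zs y \<Longrightarrow> eval (Comp f gs) xs y"
| eval_Prim0: "eval f xs y \<Longrightarrow> eval (Prim f g) (0 # xs) y"
| eval_PrimS: "eval (Prim f g) (n # xs) r \<Longrightarrow> eval g (n # r # xs) y \<Longrightarrow> eval (Prim f g) (Suc n # xs) y"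
| eval_Mu: "eval f (n # xs) 0 \<Longrightarrow> (\<forall>m<n. \<exists>k. eval f (m # xs) (Suc k)) \<Longrightarrow> eval (Mu f) xs n"

text \<open>Bijective coding of binary strings by natural numbers.\<close>
fun enc :: "bool list \<Rightarrow> nat" where
  "enc [] = 0"
| "enc (b # xs) = 2 * enc xs + (if b then 2 else 1)"

definition partial_computable :: "(bool list \<Rightarrow> bool list option) \<Rightarrow> bool" where
  "partial_computable M \<longleftrightarrow> (\<exists>f. \<forall>p y. M p = Some y \<longleftrightarrow> eval f [enc p] (enc y))"

definition prefix_free_machine :: "(bool list \<Rightarrow> bool list option) \<Rightarrow> bool" where
  "prefix_free_machine M \<longleftrightarrow> partial_computable M \<and>
     (\<forall>p q. M p \<noteq> None \<and> M q \<noteq> None \<and> prefix p q \<longrightarrow> p = q)"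

definition optimal_machine :: "(bool list \<Rightarrow> bool list option) \<Rightarrow> bool" where
  "optimal_machine U \<longleftrightarrow> prefix_free_machine U \<and>
     (\<forall>M. prefix_free_machine M \<longrightarrow>
        (\<exists>c. \<forall>p \<sigma>. M p = Some \<sigma> \<longrightarrow> (\<exists>q. U q = Some \<sigma> \<and> length q \<le> length p + c)))"

definition UM :: "bool list \<Rightarrow> bool list option" where
  "UM = (SOME U. optimal_machine U)"

definition K :: "bool list \<Rightarrow> nat" where
  "K \<sigma> = (LEAST n. \<exists>q. UM q = Some \<sigma> \<and> length q = n)"

type_synonym seq = "nat \<Rightarrow> bool"

definition restr :: "seq \<Rightarrow> nat \<Rightarrow> bool list" where
  "restr X n = map X [0..<n]"

definition cdim :: "seq \<Rightarrow> ereal" where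
  "cdim X = liminf (\<lambda>n. ereal (real (K (restr X n)) / real n))"

definition pdim :: "seq \<Rightarrow> ereal" where
  "pdim X = limsup (\<lambda>n. ereal (real (K (restr X n)) / real n))"

definition dst :: "seq \<Rightarrow> seq \<Rightarrow> ereal" where
  "dst X Y = limsup (\<lambda>n. ereal (real (card {m. m < n \<and> X m \<noteq> Y m}) / real n))"

definition dst1 :: "seq \<Rightarrow> ereal" where
  "dst1 X = Inf {dst X Z | Z. cdim Z = 1}"

definition Hb :: "real \<Rightarrow> real" where
  "Hb p = - p * log 2 p - (1 - p) * log 2 (1 - p)"

definition Hinv :: "real \<Rightarrow> real" where
  "Hinv y = (THE x. 0 \<le> x \<and> x \<le> 1/2 \<and> Hb x = y)"

end

theory Submission
  imports Defs "HOL-Library.Nat_Bijection" "HOL-Real_Asymp.Real_Asymp"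
begin

text \<open>
  \<open>X\<close> is obtained from \<open>Y\<close> by applying, block by block, a map \<open>f\<close> whose image has about \<open>2^(s m)\<close>
  elements and whose fibres have about \<open>2^((1-s) m)\<close> elements, where \<open>m\<close> is the block length. The
  bound on the image gives \<open>K(X|n) \<le> s n + o(n)\<close>. The bound on the fibres gives
  \<open>K(Y|n) \<le> K(X|n) + (1-s) n + o(n)\<close>, so that \<open>X\<close> has dimension at least \<open>s\<close>.

  For \<open>r = Hinv (1-s)\<close>, \<open>f\<close> rounds to a covering code of radius \<open>r\<close>: sequences closer than \<open>r\<close> to
  \<open>X\<close> are compressible, because few words lie near code words. For \<open>r = 1/2 - Hinv s\<close>, \<open>f\<close> thins
  out the ones of \<open>y\<close> down to density \<open>Hinv s\<close>: sequences closer than \<open>r\<close> to \<open>X\<close> are compressible,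
  because they have too few ones. Intermediate values of \<open>r\<close> are reached by splitting each block
  between the two maps, as the bounds needed are affine in the Hamming distance and hence add up.

  The maps need not be computable. At level \<open>j\<close> there are only finitely many finite code tables,
  and they are built into a machine with an unknown constant \<open>k j\<close>; the level grows so slowly along
  the blocks that these constants are \<open>o(n)\<close>.
\<close>

section \<open>Computable functions and recursively enumerable predicates\<close>

text \<open>The saving in bits is not linear in the distance: \<open>Hb\<close> is flat at 1/2, so
  that a word of length m with (1/2 - \<epsilon>) m ones saves only an amount of order \<epsilon>^2
  m. Every block is therefore given a whole family of affine bounds, one for each slope \<beta> up
  to a fixed \<open>\<beta>0\<close>, with an error \<open>phi \<beta>\<close> of second order in
  \<beta>. Compared with the incompressibility of a sequence of dimension 1, the bound of slope
  \<beta> locates its distance from X up to \<open>phi \<beta>\<close> / \<beta>, and \<beta> is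
  sent to 0 only at the very end. The same code is applied twice: to Y, which then cannot be much
  farther than r from X, and to an arbitrary Z of dimension 1, which then cannot be much nearer. The
  end points for r come from counting. About 2^(s m) balls of radius \<eta> m are needed to cover
  all words of length m when Hb \<eta> = 1 - s. About 2^(s m) words have density of ones at most q
  when Hb q = s, q \<le> 1/2, while a typical y has density 1/2, so that a proportion 1/2 - q of the
  bits must be erased.\<close>

inductive_cases eval_ZeroE: "eval Zero xs y"
inductive_cases eval_SuccE: "eval Succ xs y"
inductive_cases eval_ProjE: "eval (Proj i) xs y"
inductive_cases eval_CompE: "eval (Comp f gs) xs y"
inductive_cases eval_MuE: "eval (Mu f) xs y"

lemma list_all2_functional:
  "list_all2 (\<lambda>g z. \<forall>z'. R g z' \<longrightarrow> z = z') gs zs \<Longrightarrow> list_all2 R gs zs' \<Longrightarrow> zs = zs'"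
proof (induction gs arbitrary: zs zs')
  case (Cons g gs)
  then show ?case by (auto simp: list_all2_Cons1)
qed auto

lemma eval_det: "eval f xs y \<Longrightarrow> eval f xs z \<Longrightarrow> y = z"
proof (induction arbitrary: z rule: eval.induct)
  case (eval_Zero xs)
  then show ?case by (auto elim: eval_ZeroE)
next
  case (eval_Succ x xs)
  then show ?case by (auto elim: eval_SuccE)
next
  case (eval_Proj i xs)
  then show ?case by (auto elim: eval_ProjE)
next
  case (eval_Comp xs gs zs f y)
  from eval_Comp.prems obtain zs' where z: "list_all2 (\<lambda>g z. eval g xs z) gs zs'" "eval f zs' z"
    by (auto elim: eval_CompE)
  have "zs = zs'"
    by (rule list_all2_functional[OF _ z(1)], rule list_all2_mono[OF eval_Comp.IH(1)]) auto
  then show ?case using eval_Comp.IH(2) z(2) by auto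
next
  case (eval_Prim0 f xs y g)
  from eval_Prim0.prems have "eval f xs z" by cases auto
  then show ?case by (rule eval_Prim0.IH)
next
  case (eval_PrimS f g n xs r y)
  from eval_PrimS.prems obtain r' where "eval (Prim f g) (n # xs) r'" "eval g (n # r' # xs) z"
    by cases auto
  then show ?case using eval_PrimS.IH by metis
next
  case (eval_Mu f n xs)
  from eval_Mu.prems have z: "eval f (z # xs) 0" "\<forall>m<z. \<exists>k. eval f (m # xs) (Suc k)"
    by (auto elim: eval_MuE)
  have "\<not> z < n" using eval_Mu.IH(2) z(1) by fastforce
  moreover have "\<not> n < z" using eval_Mu.IH(1) z(2) by fastforce
  ultimately show ?case by simp
qed

text \<open>Total functions of one argument suffice once pairs can be packed by \<open>pr\<close>.
  The binary form \<open>cmp2\<close> serves to build \<open>pr\<close> itself and to meet the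
  argument lists of \<open>Prim\<close> and \<open>Mu\<close>.\<close>

definition cmp :: "(nat \<Rightarrow> nat) \<Rightarrow> bool" where
  "cmp F \<longleftrightarrow> (\<exists>f. \<forall>x. eval f [x] (F x))"

definition cmp2 :: "(nat \<Rightarrow> nat \<Rightarrow> nat) \<Rightarrow> bool" where
  "cmp2 F \<longleftrightarrow> (\<exists>f. \<forall>x y. eval f [x, y] (F x y))"

lemma eval_Comp1: "eval g xs z \<Longrightarrow> eval f [z] y \<Longrightarrow> eval (Comp f [g]) xs y"
  by (rule eval_Comp[where zs = "[z]"]) auto

lemma eval_Comp2: "eval g xs z \<Longrightarrow> eval h xs v \<Longrightarrow> eval f [z, v] y \<Longrightarrow> eval (Comp f [g, h]) xs y"
  by (rule eval_Comp[where zs = "[z, v]"]) auto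

lemma cmp_id: "cmp (\<lambda>x. x)"
  unfolding cmp_def using eval_Proj[of 0 "[_]"] by (intro exI[of _ "Proj 0"]) simp

lemma cmp_comp: "cmp F \<Longrightarrow> cmp G \<Longrightarrow> cmp (\<lambda>x. F (G x))"
  unfolding cmp_def by (meson eval_Comp1)

lemma cmp_comp2: "cmp2 F \<Longrightarrow> cmp G \<Longrightarrow> cmp H \<Longrightarrow> cmp (\<lambda>x. F (G x) (H x))"
  unfolding cmp_def cmp2_def by (meson eval_Comp2)

lemma cmp2_fst: "cmp2 (\<lambda>x y. x)"
  unfolding cmp2_def using eval_Proj[of 0 "[_,_]"] by (intro exI[of _ "Proj 0"]) simp

lemma cmp2_snd: "cmp2 (\<lambda>x y. y)"
  unfolding cmp2_def using eval_Proj[of 1 "[_,_]"] by (intro exI[of _ "Proj 1"]) simp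

lemma cmp2_comp: "cmp F \<Longrightarrow> cmp2 G \<Longrightarrow> cmp2 (\<lambda>x y. F (G x y))"
  unfolding cmp_def cmp2_def by (meson eval_Comp1)

lemma cmp2_comp2: "cmp2 F \<Longrightarrow> cmp2 G \<Longrightarrow> cmp2 H \<Longrightarrow> cmp2 (\<lambda>x y. F (G x y) (H x y))"
  unfolding cmp2_def by (meson eval_Comp2)

lemma cmp_Suc0: "cmp Suc"
  unfolding cmp_def using eval_Succ by blast

lemmas cmp_Suc = cmp_comp[OF cmp_Suc0]

lemma cmp_const: "cmp (\<lambda>x. c)"
proof (induction c)
  case 0
  show ?case unfolding cmp_def using eval_Zero by blast
next
  case (Suc c)
  then show ?case by (rule cmp_Suc)
qed

lemma eval_Proj3:
  "eval (Proj 0) (x # xs) x" "eval (Proj 1) (x # y # xs) y" "eval (Proj 2) (x # y # z # xs) z"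
  using eval_Proj[of 0 "x # xs"] eval_Proj[of 1 "x # y # xs"] eval_Proj[of 2 "x # y # z # xs"] by auto

lemma cmp2_rec:
  assumes "cmp A" "cmp2 B"
  shows "cmp2 (\<lambda>n y. rec_nat (A y) (\<lambda>k r. B k r) n)"
proof -
  obtain a b where a: "\<And>x. eval a [x] (A x)" and b: "\<And>x y. eval b [x, y] (B x y)"
    using assms unfolding cmp_def cmp2_def by blast
  have "eval (Prim a (Comp b [Proj 0, Proj 1])) [n, y] (rec_nat (A y) (\<lambda>k r. B k r) n)" for n y
  proof (induction n)
    case 0
    show ?case by (simp add: eval_Prim0 a)
  next
    case (Suc n)
    show ?case by (simp del: One_nat_def, rule eval_PrimS[OF Suc.IH], rule eval_Comp2[OF eval_Proj3(1) eval_Proj3(2) b])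
  qed
  then show ?thesis unfolding cmp2_def by blast
qed

lemma cmp_diag: "cmp2 F \<Longrightarrow> cmp (\<lambda>x. F x x)"
  using cmp_comp2[of F "\<lambda>x. x" "\<lambda>x. x"] cmp_id by auto

lemma cmp2_add: "cmp2 (+)"
proof -
  have "rec_nat y (\<lambda>k r. Suc r) n = n + y" for n y :: nat by (induction n) auto
  then show ?thesis
    using cmp2_rec[OF cmp_id cmp2_comp[OF cmp_Suc0 cmp2_snd]] by simp
qed

lemma cmp_pred: "cmp (\<lambda>x. x - 1)"
proof -
  have "rec_nat 0 (\<lambda>k r. k) n = n - 1" for n :: nat by (cases n) auto
  then show ?thesis
    using cmp_diag[OF cmp2_rec[OF cmp_const[of 0] cmp2_fst]] by simp
qed

lemma cmp2_sub: "cmp2 (-)"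
proof -
  have *: "rec_nat y (\<lambda>k r. r - 1) n = y - n" for n y :: nat by (induction n) auto
  show ?thesis
    \<comment> \<open>The recursion counts along the subtrahend, which is the first argument of the
      recursor; hence the swap of the two projections.\<close>
    using cmp2_comp2[OF cmp2_rec[OF cmp_id cmp2_comp[OF cmp_pred cmp2_snd]] cmp2_snd cmp2_fst]
    unfolding * by simp
qed

lemma cmp_triangle: "cmp triangle"
proof -
  have *: "rec_nat 0 (\<lambda>k r. r + Suc k) n = triangle n" for n by (induction n) auto
  have "cmp2 (\<lambda>k r. r + Suc k)"
    by (intro cmp2_comp2[OF cmp2_add] cmp2_snd cmp2_comp[OF cmp_Suc0] cmp2_fst)
  from cmp_diag[OF cmp2_rec[OF cmp_const[of 0] this]] show ?thesis unfolding * by simp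
qed

section \<open>The Cantor pairing function and its inverse\<close>

abbreviation pr :: "nat \<Rightarrow> nat \<Rightarrow> nat" where "pr a b \<equiv> prod_encode (a, b)"

definition pfst :: "nat \<Rightarrow> nat" where "pfst z = fst (prod_decode z)"
definition psnd :: "nat \<Rightarrow> nat" where "psnd z = snd (prod_decode z)"

lemma pfst_pr [simp]: "pfst (pr a b) = a" and psnd_pr [simp]: "psnd (pr a b) = b"
  by (simp_all add: pfst_def psnd_def)

lemma pr_pfst_psnd [simp]: "pr (pfst z) (psnd z) = z"
  by (simp add: pfst_def psnd_def)

lemma cmp2_pr: "cmp2 pr"
proof -
  have "cmp2 (\<lambda>a b. triangle (a + b) + a)"
    by (intro cmp2_comp2[OF cmp2_add] cmp2_comp[OF cmp_triangle] cmp2_fst cmp2_snd)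
  then show ?thesis by (simp add: prod_encode_def)
qed

lemma cmp_mu:
  assumes "cmp2 F" and ex: "\<And>x. \<exists>n. F n x = 0"
  shows "cmp (\<lambda>x. LEAST n. F n x = 0)"
proof -
  obtain f where f: "\<And>x y. eval f [x, y] (F x y)" using assms(1) unfolding cmp2_def by blast
  have "eval (Mu f) [x] (LEAST n. F n x = 0)" for x
  proof (rule eval_Mu)
    show "eval f [LEAST n. F n x = 0, x] 0"
      using f[of "LEAST n. F n x = 0" x] LeastI_ex[OF ex[of x]] by simp
    show "\<forall>m<LEAST n. F n x = 0. \<exists>k. eval f [m, x] (Suc k)"
    proof (intro allI impI)
      fix m assume "m < (LEAST n. F n x = 0)"
      then have "F m x \<noteq> 0" by (auto dest: not_less_Least)
      then show "\<exists>k. eval f [m, x] (Suc k)" using f[of m x] by (metis not0_implies_Suc)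
    qed
  qed
  then show ?thesis unfolding cmp_def by blast
qed

lemma triangle_mono: "a \<le> b \<Longrightarrow> triangle a \<le> triangle b"
  by (induction b) (auto simp: le_Suc_eq)

text \<open>Since z = triangle (a + b) + a with a \<le> a + b, the sum a + b is the only s with
  triangle s \<le> z < triangle (s + 1). A single search thus inverts the pairing: the first
  component is then z - triangle (a + b).\<close>

lemma pfst_psnd_sum: "(LEAST s. Suc z - triangle (Suc s) = 0) = pfst z + psnd z"
proof (rule Least_equality)
  have z: "z = triangle (pfst z + psnd z) + pfst z"
    using pr_pfst_psnd[of z] by (simp add: prod_encode_def)
  show "Suc z - triangle (Suc (pfst z + psnd z)) = 0" by (subst (1) z) simp
  fix s assume "Suc z - triangle (Suc s) = 0"
  then have *: "Suc z \<le> triangle (Suc s)" by simp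
  show "pfst z + psnd z \<le> s"
  proof (rule ccontr)
    assume "\<not> pfst z + psnd z \<le> s"
    then have "triangle (Suc s) \<le> triangle (pfst z + psnd z)" by (intro triangle_mono) simp
    with * z show False by linarith
  qed
qed

lemma cmp_psum: "cmp (\<lambda>z. pfst z + psnd z)"
proof -
  have "cmp2 (\<lambda>s z. Suc z - triangle (Suc s))"
    by (intro cmp2_comp2[OF cmp2_sub] cmp2_comp[OF cmp_Suc0] cmp2_comp[OF cmp_triangle] cmp2_fst cmp2_snd)
  moreover have "\<exists>s. Suc z - triangle (Suc s) = 0" for z
    by (rule exI[of _ z]) simp
  ultimately show ?thesis
    using cmp_mu[of "\<lambda>s z. Suc z - triangle (Suc s)"] unfolding pfst_psnd_sum by simp
qed

lemmas cmp_add = cmp_comp2[OF cmp2_add] and cmp_sub = cmp_comp2[OF cmp2_sub]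
  and cmp_pr = cmp_comp2[OF cmp2_pr]

lemma cmp_pfst0: "cmp pfst"
proof -
  have "z = triangle (pfst z + psnd z) + pfst z" for z
    using pr_pfst_psnd[of z] by (simp add: prod_encode_def)
  then have "pfst z = z - triangle (pfst z + psnd z)" for z by (metis add_diff_cancel_left')
  then have *: "pfst = (\<lambda>z. z - triangle (pfst z + psnd z))" by auto
  show ?thesis
    by (subst *, intro cmp_sub cmp_comp[OF cmp_triangle] cmp_psum cmp_id)
qed

lemmas cmp_pfst = cmp_comp[OF cmp_pfst0]

lemma cmp_psnd0: "cmp psnd"
proof -
  have *: "psnd = (\<lambda>z. (pfst z + psnd z) - pfst z)" by auto
  show ?thesis
    by (subst *, intro cmp_sub cmp_pfst cmp_psum cmp_id)
qed

lemmas cmp_psnd = cmp_comp[OF cmp_psnd0]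

text \<open>The step function sees the counter, the previous value and the parameter, packed into
  one number. In this form the computability of a concrete step is again a goal about
  \<open>cmp\<close>, which introduction rules can solve by following the term.\<close>

lemma cmp_rec:
  assumes "cmp N" "cmp A" "cmp (\<lambda>z. B (pfst z) (pfst (psnd z)) (psnd (psnd z)))"
  shows "cmp (\<lambda>x. rec_nat (A x) (\<lambda>n r. B n r x) (N x))"
proof -
  obtain a b where a: "\<And>x. eval a [x] (A x)"
    and b: "\<And>z. eval b [z] (B (pfst z) (pfst (psnd z)) (psnd (psnd z)))"
    using assms unfolding cmp_def by blast
  obtain p where p: "\<And>x y. eval p [x, y] (pr x y)" using cmp2_pr unfolding cmp2_def by blast
  let ?b = "Comp b [Comp p [Proj 0, Comp p [Proj 1, Proj 2]]]"
  have bb: "eval ?b [n, r, y] (B n r y)" for n r y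
    using b[of "pr n (pr r y)"]
    by (intro eval_Comp1[OF eval_Comp2[OF eval_Proj3(1) eval_Comp2[OF eval_Proj3(2) eval_Proj3(3) p] p]]) simp
  have "eval (Prim a ?b) [n, x] (rec_nat (A x) (\<lambda>n r. B n r x) n)" for n x
  proof (induction n)
    case 0
    show ?case by (simp add: eval_Prim0 a)
  next
    case (Suc n)
    show ?case by (simp del: One_nat_def, rule eval_PrimS[OF Suc.IH], rule bb)
  qed
  then have "cmp2 (\<lambda>n x. rec_nat (A x) (\<lambda>n r. B n r x) n)" unfolding cmp2_def by blast
  from cmp_comp2[OF this assms(1) cmp_id] show ?thesis .
qed

lemma cmp_sum:
  assumes "cmp N" "cmp (\<lambda>z. G (pfst z) (psnd z))"
  shows "cmp (\<lambda>x. \<Sum>i<N x. G i x)"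
proof -
  have *: "(\<Sum>i<n. G i x) = rec_nat 0 (\<lambda>i r. r + G i x) n" for n x by (induction n) auto
  have "cmp (\<lambda>z. G (pfst z) (psnd (psnd z)))"
    using cmp_comp[OF assms(2) cmp_pr[OF cmp_pfst[OF cmp_id] cmp_psnd[OF cmp_psnd[OF cmp_id]]]] by simp
  then show ?thesis unfolding *
    by (intro cmp_rec assms cmp_const cmp_add cmp_pfst cmp_psnd cmp_id)
qed

lemma cmp_mult:
  assumes "cmp F" "cmp G" shows "cmp (\<lambda>x. F x * G x)"
proof -
  have "cmp (\<lambda>x. \<Sum>i<F x. G x)" by (intro cmp_sum assms cmp_comp[OF assms(2)] cmp_psnd cmp_id)
  then show ?thesis by simp
qed

lemma cmp_prod:
  assumes "cmp N" "cmp (\<lambda>z. G (pfst z) (psnd z))"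
  shows "cmp (\<lambda>x. \<Prod>i<N x. G i x)"
proof -
  have *: "(\<Prod>i<n. G i x) = rec_nat 1 (\<lambda>i r. r * G i x) n" for n x by (induction n) auto
  have "cmp (\<lambda>z. G (pfst z) (psnd (psnd z)))"
    using cmp_comp[OF assms(2) cmp_pr[OF cmp_pfst[OF cmp_id] cmp_psnd[OF cmp_psnd[OF cmp_id]]]] by simp
  then show ?thesis unfolding *
    by (intro cmp_rec assms cmp_const cmp_mult cmp_pfst cmp_psnd cmp_id)
qed

lemma cmp_pow:
  assumes "cmp G" shows "cmp (\<lambda>x. c ^ G x)"
proof -
  have "cmp (\<lambda>x. \<Prod>i<G x. c)" by (intro cmp_prod assms cmp_const)
  then show ?thesis by simp
qed

text \<open>Truth is coded by the value \<open>0\<close>, so that conjunction is addition and disjunction is multiplication.\<close>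

definition dec :: "(nat \<Rightarrow> bool) \<Rightarrow> bool" where
  "dec P \<longleftrightarrow> (\<exists>F. cmp F \<and> (\<forall>x. P x \<longleftrightarrow> F x = 0))"

definition re :: "(nat \<Rightarrow> bool) \<Rightarrow> bool" where
  "re P \<longleftrightarrow> (\<exists>D. dec D \<and> (\<forall>x. P x \<longleftrightarrow> (\<exists>w. D (pr w x))))"

lemma decI: "cmp F \<Longrightarrow> (\<And>x. P x \<longleftrightarrow> F x = 0) \<Longrightarrow> dec P"
  unfolding dec_def by blast

lemma decE: assumes "dec P" obtains F where "cmp F" "P = (\<lambda>x. F x = 0)"
  using assms unfolding dec_def by auto

lemma dec_subst:
  assumes "dec P" "cmp G" shows "dec (\<lambda>x. P (G x))"
proof -
  obtain F where F: "cmp F" "P = (\<lambda>x. F x = 0)" using assms(1) by (rule decE)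
  show ?thesis by (rule decI[OF cmp_comp[OF F(1) assms(2)]]) (simp add: F(2))
qed

lemma dec_not:
  assumes "dec P" shows "dec (\<lambda>x. \<not> P x)"
proof -
  obtain F where F: "cmp F" "P = (\<lambda>x. F x = 0)" using assms by (rule decE)
  show ?thesis by (rule decI[OF cmp_sub[OF cmp_const[of 1] F(1)]]) (auto simp add: F(2))
qed

lemma dec_conj:
  assumes "dec P" "dec Q" shows "dec (\<lambda>x. P x \<and> Q x)"
proof -
  obtain F where F: "cmp F" "P = (\<lambda>x. F x = 0)" using assms(1) by (rule decE)
  obtain G where G: "cmp G" "Q = (\<lambda>x. G x = 0)" using assms(2) by (rule decE)
  show ?thesis by (rule decI[OF cmp_add[OF F(1) G(1)]]) (simp add: F(2) G(2))
qed

lemma dec_disj: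
  assumes "dec P" "dec Q" shows "dec (\<lambda>x. P x \<or> Q x)"
proof -
  obtain F where F: "cmp F" "P = (\<lambda>x. F x = 0)" using assms(1) by (rule decE)
  obtain G where G: "cmp G" "Q = (\<lambda>x. G x = 0)" using assms(2) by (rule decE)
  show ?thesis by (rule decI[OF cmp_mult[OF F(1) G(1)]]) (simp add: F(2) G(2))
qed

lemma dec_imp: "dec P \<Longrightarrow> dec Q \<Longrightarrow> dec (\<lambda>x. P x \<longrightarrow> Q x)"
  unfolding imp_conv_disj by (intro dec_disj dec_not)

lemma dec_eq: "cmp F \<Longrightarrow> cmp G \<Longrightarrow> dec (\<lambda>x. F x = G x)"
  by (rule decI[of "\<lambda>x. (F x - G x) + (G x - F x)"], intro cmp_add cmp_sub) auto

lemma dec_le: "cmp F \<Longrightarrow> cmp G \<Longrightarrow> dec (\<lambda>x. F x \<le> G x)"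
  by (rule decI[OF cmp_sub]) auto

lemma dec_less: "cmp F \<Longrightarrow> cmp G \<Longrightarrow> dec (\<lambda>x. F x < G x)"
  using dec_le[OF cmp_Suc] by (simp add: Suc_le_eq)

lemma dec_all:
  assumes "cmp N" "dec (\<lambda>z. P (pfst z) (psnd z))" shows "dec (\<lambda>x. \<forall>i<N x. P i x)"
proof -
  obtain F where F: "cmp F" "(\<lambda>z. P (pfst z) (psnd z)) = (\<lambda>x. F x = 0)" using assms(2) by (rule decE)
  have P: "P i x \<longleftrightarrow> F (pr i x) = 0" for i x using fun_cong[OF F(2), of "pr i x"] by simp
  show ?thesis
    by (rule decI[OF cmp_sum[OF assms(1), of "\<lambda>i x. F (pr i x)"]]) (auto simp: P F(1))
qed

lemma dec_ex:
  assumes "cmp N" "dec (\<lambda>z. P (pfst z) (psnd z))" shows "dec (\<lambda>x. \<exists>i<N x. P i x)"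
proof -
  have "dec (\<lambda>x. \<not> (\<forall>i<N x. \<not> P i x))" by (intro dec_not dec_all assms)
  then show ?thesis by simp
qed

lemma reE:
  assumes "re P" obtains D where "dec D" "P = (\<lambda>x. \<exists>w. D (pr w x))"
  using assms unfolding re_def by (meson ext)

lemma reI: "dec D \<Longrightarrow> (\<And>x. P x \<longleftrightarrow> (\<exists>w. D (pr w x))) \<Longrightarrow> re P"
  unfolding re_def by auto

lemma re_subst:
  assumes "re P" "cmp F" shows "re (\<lambda>x. P (F x))"
proof -
  obtain D where D: "dec D" "P = (\<lambda>x. \<exists>w. D (pr w x))" using assms(1) by (rule reE)
  show ?thesis
    by (rule reI[OF dec_subst[OF D(1) cmp_pr[OF cmp_pfst[OF cmp_id] cmp_comp[OF assms(2) cmp_psnd0]]]])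
       (simp add: D(2))
qed

lemma dec_re: assumes "dec P" shows "re P"
  by (rule reI[OF dec_subst[OF assms cmp_psnd0]]) auto

lemma re_ex:
  assumes "re (\<lambda>z. P (pfst z) (psnd z))" shows "re (\<lambda>x. \<exists>i. P i x)"
proof -
  obtain D where D: "dec D" "(\<lambda>z. P (pfst z) (psnd z)) = (\<lambda>x. \<exists>w. D (pr w x))"
    using assms by (rule reE)
  have P: "P i x \<longleftrightarrow> (\<exists>w. D (pr w (pr i x)))" for i x using fun_cong[OF D(2), of "pr i x"] by simp
  show ?thesis
  proof (rule reI[OF dec_subst[OF D(1), of "\<lambda>z. pr (pfst (pfst z)) (pr (psnd (pfst z)) (psnd z))"]])
    fix x
    show "(\<exists>i. P i x) \<longleftrightarrow> (\<exists>w. D (pr (pfst (pfst (pr w x))) (pr (psnd (pfst (pr w x))) (psnd (pr w x)))))"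
      unfolding P by (auto, metis pfst_pr psnd_pr)
  qed (intro cmp_pr cmp_pfst cmp_psnd cmp_id)
qed

lemma re_conj:
  assumes "re P" "re Q" shows "re (\<lambda>x. P x \<and> Q x)"
proof -
  obtain D where D: "dec D" "P = (\<lambda>x. \<exists>w. D (pr w x))" using assms(1) by (rule reE)
  obtain E where E: "dec E" "Q = (\<lambda>x. \<exists>w. E (pr w x))" using assms(2) by (rule reE)
  have "re (\<lambda>x. \<exists>w v. D (pr w x) \<and> E (pr v x))"
    by (intro re_ex dec_re dec_conj dec_subst[OF D(1)] dec_subst[OF E(1)] cmp_pr cmp_pfst cmp_psnd cmp_id)
  then show ?thesis by (simp add: D(2) E(2))
qed

lemma re_disj:
  assumes "re P" "re Q" shows "re (\<lambda>x. P x \<or> Q x)"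
proof -
  obtain D where D: "dec D" "P = (\<lambda>x. \<exists>w. D (pr w x))" using assms(1) by (rule reE)
  obtain E where E: "dec E" "Q = (\<lambda>x. \<exists>w. E (pr w x))" using assms(2) by (rule reE)
  have "re (\<lambda>x. \<exists>w. D (pr w x) \<or> E (pr w x))"
    by (intro re_ex dec_re dec_disj dec_subst[OF D(1)] dec_subst[OF E(1)] cmp_pr cmp_pfst cmp_psnd cmp_id)
  moreover have "(\<lambda>x. \<exists>w. D (pr w x) \<or> E (pr w x)) = (\<lambda>x. P x \<or> Q x)" by (auto simp: D(2) E(2))
  ultimately show ?thesis by simp
qed

lemma re_imp: "dec P \<Longrightarrow> re Q \<Longrightarrow> re (\<lambda>x. P x \<longrightarrow> Q x)"
  unfolding imp_conv_disj by (intro re_disj dec_re[OF dec_not])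

text \<open>Finitely many witnesses have a common bound W, so the bounded universal quantifier moves
  inside one unbounded existential quantifier over W, and what remains is decidable.\<close>

lemma re_all:
  assumes "cmp N" "re (\<lambda>z. P (pfst z) (psnd z))" shows "re (\<lambda>x. \<forall>i<N x. P i x)"
proof -
  obtain D where D: "dec D" "(\<lambda>z. P (pfst z) (psnd z)) = (\<lambda>x. \<exists>w. D (pr w x))"
    using assms(2) by (rule reE)
  have P: "P i x \<longleftrightarrow> (\<exists>w. D (pr w (pr i x)))" for i x using fun_cong[OF D(2), of "pr i x"] by simp
  have *: "(\<forall>i<n. P i x) \<longleftrightarrow> (\<exists>W. \<forall>i<n. \<exists>w<W. D (pr w (pr i x)))" for n x
  proof
    assume "\<forall>i<n. P i x"
    then obtain w where w: "\<And>i. i < n \<Longrightarrow> D (pr (w i) (pr i x))" unfolding P by metis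
    have "\<forall>i<n. w i < Suc (\<Sum>i<n. w i)"
      using member_le_sum[of _ "{..<n}" w] by (auto simp: less_Suc_eq_le)
    then show "\<exists>W. \<forall>i<n. \<exists>w<W. D (pr w (pr i x))" using w by blast
  qed (auto simp: P)
  have "re (\<lambda>x. \<exists>W. \<forall>i<N x. \<exists>w<W. D (pr w (pr i x)))"
    by (intro re_ex dec_re dec_all dec_ex dec_subst[OF D(1)] cmp_comp[OF assms(1)] cmp_pr cmp_pfst cmp_psnd cmp_id)
  then show ?thesis by (simp add: *)
qed

text \<open>The finite set is arbitrary and not given effectively. This is the point at which an
  uncomputable table may enter a machine, at the price of a constant that is not controlled.\<close>

lemma re_finite_ex:
  assumes "finite D" "\<And>d. d \<in> D \<Longrightarrow> re (P d)" shows "re (\<lambda>x. \<exists>d\<in>D. P d x)"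
  using assms
proof (induction D rule: finite_induct)
  case empty
  show ?case using dec_re[OF dec_eq[OF cmp_const[of 0] cmp_const[of 1]]] by simp
next
  case (insert d D)
  then have "re (\<lambda>x. P d x \<or> (\<exists>d\<in>D. P d x))" by (intro re_disj) auto
  then show ?case by simp
qed

lemmas cmp_intros = cmp_id cmp_const cmp_Suc cmp_add cmp_sub cmp_mult cmp_pow cmp_pr cmp_pfst cmp_psnd
lemmas dec_intros = dec_not dec_conj dec_disj dec_imp dec_eq dec_le dec_less dec_all dec_ex
lemmas re_intros = re_ex re_conj re_disj

text \<open>The search runs over pairs v of a witness and a value, so one \<open>Mu\<close> over a
  total test finds both; the value is then read off by \<open>psnd\<close>. Single-valuedness makes
  it irrelevant which pair is found.\<close>

lemma re_graph_computable:
  assumes "re (\<lambda>z. P (pfst z) (psnd z))" and sv: "\<And>x y y'. P x y \<Longrightarrow> P x y' \<Longrightarrow> y = y'"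
  shows "\<exists>f. \<forall>x y. eval f [x] y \<longleftrightarrow> P x y"
proof -
  obtain D where D: "dec D" "(\<lambda>z. P (pfst z) (psnd z)) = (\<lambda>x. \<exists>w. D (pr w x))"
    using assms(1) by (rule reE)
  have P: "P i x \<longleftrightarrow> (\<exists>w. D (pr w (pr i x)))" for i x using fun_cong[OF D(2), of "pr i x"] by simp
  have "dec (\<lambda>z. D (pr (pfst (pfst z)) (pr (psnd z) (psnd (pfst z)))))"
    by (intro dec_subst[OF D(1)] cmp_intros)
  then obtain F where F: "cmp F" "\<And>z. D (pr (pfst (pfst z)) (pr (psnd z) (psnd (pfst z)))) \<longleftrightarrow> F z = 0"
    unfolding dec_def by blast
  have "cmp2 (\<lambda>v x. F (pr v x))" by (intro cmp2_comp[OF F(1)] cmp2_pr)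
  then obtain g where g: "\<And>v x. eval g [v, x] (F (pr v x))" unfolding cmp2_def by blast
  obtain h where h: "\<And>v. eval h [v] (psnd v)" using cmp_psnd0 unfolding cmp_def by blast
  have D': "P x (psnd v)" if "F (pr v x) = 0" for v x using that F(2)[of "pr v x"] P by auto
  have 1: "P x y" if e: "eval (Comp h [Mu g]) [x] y" for x y
  proof -
    obtain v where v: "eval (Mu g) [x] v" "eval h [v] y"
      using e by (auto elim!: eval_CompE simp: list_all2_Cons1)
    from v(1) have "eval g [v, x] 0" by (auto elim: eval_MuE)
    then have "F (pr v x) = 0" using g eval_det by metis
    then show ?thesis using D' eval_det[OF v(2) h] by auto
  qed
  have 2: "eval (Comp h [Mu g]) [x] y" if pxy: "P x y" for x y
  proof -
    obtain w where "D (pr w (pr x y))" using pxy unfolding P by blast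
    then have ex: "\<exists>v. F (pr v x) = 0" using F(2)[of "pr (pr w y) x"] by auto
    define v where "v = (LEAST v. F (pr v x) = 0)"
    have v: "F (pr v x) = 0" unfolding v_def by (rule LeastI_ex[OF ex])
    have "eval (Mu g) [x] v"
    proof (rule eval_Mu)
      show "eval g [v, x] 0" using g[of v x] v by simp
      show "\<forall>m<v. \<exists>k. eval g [m, x] (Suc k)"
      proof (intro allI impI)
        fix m assume "m < v"
        then have "F (pr m x) \<noteq> 0" unfolding v_def by (rule not_less_Least)
        then show "\<exists>k. eval g [m, x] (Suc k)" using g[of m x] by (metis not0_implies_Suc)
      qed
    qed
    then have "eval (Comp h [Mu g]) [x] (psnd v)" by (rule eval_Comp1[OF _ h])
    moreover have "psnd v = y" using D'[OF v] pxy sv by blast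
    ultimately show ?thesis by simp
  qed
  from 1 2 have "\<forall>x y. eval (Comp h [Mu g]) [x] y \<longleftrightarrow> P x y" by (intro allI iffI)
  then show ?thesis ..
qed

section \<open>The universal relation\<close>

text \<open>The code of a nonempty list is the successor of a pair of head and tail, which explains
  the \<open>r - 1\<close>. On the empty list, \<open>0 - 1 = 0\<close> decodes to the pair of
  zeros, so dropping too much stays at the empty list.\<close>

definition ldrop :: "nat \<Rightarrow> nat \<Rightarrow> nat" where
  "ldrop i L = rec_nat L (\<lambda>_ r. psnd (r - 1)) i"

definition lnth :: "nat \<Rightarrow> nat \<Rightarrow> nat" where
  "lnth L i = pfst (ldrop i L - 1)"

abbreviation llen :: "nat \<Rightarrow> nat" where "llen L \<equiv> length (list_decode L)"

lemma ldrop_list_encode: "ldrop i (list_encode xs) = list_encode (drop i xs)"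
proof (induction i)
  case 0
  show ?case by (simp add: ldrop_def)
next
  case (Suc i)
  have "ldrop (Suc i) (list_encode xs) = psnd (list_encode (drop i xs) - 1)"
    using Suc by (simp add: ldrop_def)
  also have "\<dots> = list_encode (drop (Suc i) xs)"
  proof (cases "drop i xs")
    case Nil
    then show ?thesis by (simp add: psnd_def prod_decode_def prod_decode_aux.simps)
  next
    case (Cons y ys)
    then have "drop (Suc i) xs = ys" by (metis drop_Suc list.sel(3) tl_drop)
    then show ?thesis by (simp add: Cons)
  qed
  finally show ?case .
qed

lemma ldrop_eq: "ldrop i L = list_encode (drop i (list_decode L))"
  using ldrop_list_encode[of i "list_decode L"] by simp

lemma ldrop_nonzero: "ldrop i L \<noteq> 0 \<longleftrightarrow> i < llen L"
proof -
  have "list_encode xs \<noteq> 0 \<longleftrightarrow> xs \<noteq> []" for xs by (cases xs) auto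
  then show ?thesis by (simp add: ldrop_eq not_le)
qed

lemma lnth_eq: "i < llen L \<Longrightarrow> lnth L i = list_decode L ! i"
  by (simp add: lnth_def ldrop_eq Cons_nth_drop_Suc[symmetric])

lemma length_le_list_encode: "length xs \<le> list_encode xs"
proof (induction xs)
  case (Cons x xs)
  then show ?case using le_prod_encode_2[of "list_encode xs" x] by simp
qed simp

lemma cmp_ldrop: "cmp F \<Longrightarrow> cmp G \<Longrightarrow> cmp (\<lambda>x. ldrop (F x) (G x))"
  unfolding ldrop_def by (intro cmp_rec cmp_intros)

lemma cmp_lnth: "cmp F \<Longrightarrow> cmp G \<Longrightarrow> cmp (\<lambda>x. lnth (F x) (G x))"
  unfolding lnth_def by (intro cmp_ldrop cmp_intros)

lemma cmp_llen: assumes "cmp F" shows "cmp (\<lambda>x. llen (F x))"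
proof -
  \<comment> \<open>The length is the number of i for which something is left after dropping i
    elements; \<open>1 - (1 - x)\<close> is the sign of x. The range \<open>i<L\<close> is long
    enough because a list is never longer than its code.\<close>
  have "(\<Sum>i<L. 1 - (1 - ldrop i L)) = llen L" for L
  proof -
    have "(\<Sum>i<L. 1 - (1 - ldrop i L)) = (\<Sum>i<L. if i < llen L then 1 else 0)"
    proof (rule sum.cong[OF refl])
      fix i
      show "1 - (1 - ldrop i L) = (if i < llen L then 1 else 0)"
        by (cases "ldrop i L") (use ldrop_nonzero[of i L] in auto)
    qed
    also have "\<dots> = card ({..<L} \<inter> {i. i < llen L})" by (simp add: sum.If_cases)
    also have "{..<L} \<inter> {i. i < llen L} = {..<llen L}"
      using length_le_list_encode[of "list_decode L"] by auto
    finally show ?thesis by simp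
  qed
  moreover have "cmp (\<lambda>L. \<Sum>i<L. 1 - (1 - ldrop i L))" by (intro cmp_sum cmp_ldrop cmp_intros)
  ultimately have "cmp llen" by simp
  then show ?thesis using assms by (rule cmp_comp)
qed

lemma dec_mem: "cmp F \<Longrightarrow> cmp G \<Longrightarrow> dec (\<lambda>x. F x \<in> set (list_decode (G x)))"
proof -
  assume F: "cmp F" "cmp G"
  have "dec (\<lambda>x. \<exists>i<llen (G x). lnth (G x) i = F x)"
    by (intro dec_ex dec_eq cmp_lnth cmp_llen cmp_comp[OF F(1)] cmp_comp[OF F(2)] cmp_intros)
  moreover have "F x \<in> set (list_decode (G x)) \<longleftrightarrow> (\<exists>i<llen (G x). lnth (G x) i = F x)" for x
    by (auto simp: in_set_conv_nth lnth_eq)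
  ultimately show ?thesis by simp
qed

text \<open>An evaluation is certified by a list of judgements, each of which
  follows by one evaluation rule from judgements later in the list.\<close>

fun recf_code :: "recf \<Rightarrow> nat" where
  "recf_code Zero = pr 0 0"
| "recf_code Succ = pr 1 0"
| "recf_code (Proj i) = pr 2 i"
| "recf_code (Comp f gs) = pr 3 (pr (recf_code f) (list_encode (map recf_code gs)))"
| "recf_code (Prim f g) = pr 4 (pr (recf_code f) (recf_code g))"
| "recf_code (Mu f) = pr 5 (recf_code f)"

abbreviation jud :: "nat \<Rightarrow> nat \<Rightarrow> nat \<Rightarrow> nat" where "jud e xs y \<equiv> pr e (pr xs y)"

text \<open>There is one disjunct for each rule of \<open>eval\<close>, with everything coded:
  \<open>Suc (pr x xs)\<close> is the list with head x and tail xs. The set \<open>S\<close> holds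
  the available premises and occurs only positively, which gives
  \<open>justified_mono\<close>.\<close>

definition justified :: "nat set \<Rightarrow> nat \<Rightarrow> nat \<Rightarrow> nat \<Rightarrow> bool" where
  "justified S e xs y \<longleftrightarrow>
    e = pr 0 0 \<and> y = 0 \<or>
    e = pr 1 0 \<and> xs \<noteq> 0 \<and> y = Suc (pfst (xs - 1)) \<or>
    (\<exists>i. e = pr 2 i \<and> i < llen xs \<and> y = lnth xs i) \<or>
    (\<exists>f gs zs. e = pr 3 (pr f gs) \<and> llen gs = llen zs \<and>
       (\<forall>i<llen gs. jud (lnth gs i) xs (lnth zs i) \<in> S) \<and> jud f zs y \<in> S) \<or>
    (\<exists>f g xs'. e = pr 4 (pr f g) \<and> xs = Suc (pr 0 xs') \<and> jud f xs' y \<in> S) \<or>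
    (\<exists>f g n xs' r. e = pr 4 (pr f g) \<and> xs = Suc (pr (Suc n) xs') \<and>
       jud e (Suc (pr n xs')) r \<in> S \<and> jud g (Suc (pr n (Suc (pr r xs')))) y \<in> S) \<or>
    (\<exists>f. e = pr 5 f \<and> jud f (Suc (pr y xs)) 0 \<in> S \<and>
       (\<forall>m<y. \<exists>k. jud f (Suc (pr m xs)) (Suc k) \<in> S))"

lemma justified_mono:
  assumes "justified S e xs y" "S \<subseteq> T" shows "justified T e xs y"
  using assms(1) unfolding justified_def
  by (elim disj_forward ex_forward conj_forward all_forward imp_forward) (use assms(2) in auto)

definition derivation :: "nat list \<Rightarrow> bool" where
  "derivation L \<longleftrightarrow> (\<forall>i<length L. justified (set (drop (Suc i) L))
     (pfst (L ! i)) (pfst (psnd (L ! i))) (psnd (psnd (L ! i))))"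

lemma derivation_Cons: "derivation (j # L) \<longleftrightarrow> justified (set L) (pfst j) (pfst (psnd j)) (psnd (psnd j)) \<and> derivation L"
  unfolding derivation_def by (simp add: All_less_Suc2)

lemma derivation_append: "derivation L \<Longrightarrow> derivation M \<Longrightarrow> derivation (L @ M)"
  by (induction L) (auto simp: derivation_Cons intro: justified_mono)

lemma derivation_list_exists:
  assumes "\<And>j. j \<in> set js \<Longrightarrow> \<exists>L. derivation L \<and> j \<in> set L"
  shows "\<exists>L. derivation L \<and> set js \<subseteq> set L"
  using assms
proof (induction js)
  case Nil
  show ?case by (intro exI[of _ "[]"]) (simp add: derivation_def)
next
  case (Cons j js)
  then obtain L M where "derivation L" "set js \<subseteq> set L" "derivation M" "j \<in> set M" by fastforce
  then show ?case by (intro exI[of _ "L @ M"]) (auto intro: derivation_append)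
qed

definition univ :: "nat \<Rightarrow> bool" where
  "univ j \<longleftrightarrow> (\<exists>L. derivation L \<and> j \<in> set L)"

lemma univ_step:
  assumes "finite S" "\<And>j. j \<in> S \<Longrightarrow> univ j" "justified S e xs y"
  shows "univ (jud e xs y)"
proof -
  obtain js where js: "set js = S" using assms(1) finite_list by blast
  obtain L where L: "derivation L" "S \<subseteq> set L"
    using derivation_list_exists[of js] assms(2) unfolding js univ_def by blast
  have "derivation (jud e xs y # L)" using justified_mono[OF assms(3) L(2)] L(1) by (simp add: derivation_Cons)
  then show ?thesis unfolding univ_def by (intro exI[of _ "jud e xs y # L"]) simp
qed

lemma eval_univ: "eval f xs y \<Longrightarrow> univ (jud (recf_code f) (list_encode xs) y)"
proof (induction rule: eval.induct)
  case (eval_Zero xs)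
  show ?case by (rule univ_step[of "{}"]) (auto simp: justified_def)
next
  case (eval_Succ x xs)
  show ?case by (rule univ_step[of "{}"]) (auto simp: justified_def)
next
  case (eval_Proj i xs)
  then show ?case by (intro univ_step[of "{}"]) (auto simp: justified_def lnth_eq)
next
  case (eval_Comp xs gs zs f y)
  let ?S = "insert (jud (recf_code f) (list_encode zs) y) ((\<lambda>i. jud (recf_code (gs ! i)) (list_encode xs) (zs ! i)) ` {..<length gs})"
  have len: "length gs = length zs" using eval_Comp.IH(1) by (rule list_all2_lengthD)
  show ?case
  proof (rule univ_step[of ?S])
    show "univ j" if "j \<in> ?S" for j
      using that eval_Comp.IH by (auto simp: list_all2_conv_all_nth)
    have "\<exists>f' gs' zs'. recf_code (Comp f gs) = pr 3 (pr f' gs') \<and> llen gs' = llen zs' \<and>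
       (\<forall>i<llen gs'. jud (lnth gs' i) (list_encode xs) (lnth zs' i) \<in> ?S) \<and> jud f' zs' y \<in> ?S"
      using len
      by (intro exI[of _ "recf_code f"] exI[of _ "list_encode (map recf_code gs)"] exI[of _ "list_encode zs"])
         (simp add: lnth_eq)
    then show "justified ?S (recf_code (Comp f gs)) (list_encode xs) y"
      unfolding justified_def by blast
  qed simp
next
  case (eval_Prim0 f xs y g)
  then show ?case
    by (intro univ_step[of "{jud (recf_code f) (list_encode xs) y}"]) (auto simp: justified_def)
next
  case (eval_PrimS f g n xs r y)
  then show ?case
    by (intro univ_step[of "{jud (recf_code (Prim f g)) (list_encode (n # xs)) r, jud (recf_code g) (list_encode (n # r # xs)) y}"])
       (auto simp: justified_def)
next
  case (eval_Mu f n xs)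
  then obtain k where k: "\<And>m. m < n \<Longrightarrow> univ (jud (recf_code f) (list_encode (m # xs)) (Suc (k m)))" by metis
  show ?case
    using k eval_Mu.IH(1)
    by (intro univ_step[of "insert (jud (recf_code f) (list_encode (n # xs)) 0)
          ((\<lambda>m. jud (recf_code f) (list_encode (m # xs)) (Suc (k m))) ` {..<n})"])
       (auto simp: justified_def)
qed

text \<open>Junk codes in a certificate do no harm. The premises of a judgement about the code of a
  term concern that term or its immediate subterms, and every number codes an argument list, so the
  induction may be confined to judgements of the form
  \<open>jud (recf_code f) (list_encode xs) y\<close>.\<close>

lemma univ_eval: "univ (jud (recf_code f) (list_encode xs) y) \<Longrightarrow> eval f xs y"
proof -
  have "\<forall>f xs y. jud (recf_code f) (list_encode xs) y \<in> set L \<longrightarrow> eval f xs y" if "derivation L" for L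
    using that
  proof (induction L)
    case (Cons j L)
    then have IH: "\<And>f xs y. jud (recf_code f) (list_encode xs) y \<in> set L \<Longrightarrow> eval f xs y"
      and j: "justified (set L) (pfst j) (pfst (psnd j)) (psnd (psnd j))"
      by (auto simp: derivation_Cons)
    have "eval f xs y" if jf: "justified (set L) (recf_code f) (list_encode xs) y" for f xs y
    proof (cases f)
      case Zero
      then show ?thesis using jf by (auto simp: justified_def intro: eval.intros)
    next
      case Succ
      then show ?thesis using jf by (cases xs) (auto simp: justified_def intro: eval.intros)
    next
      case (Proj i)
      then show ?thesis using jf by (auto simp: justified_def lnth_eq intro: eval.intros)
    next
      case (Comp f' gs)
      then obtain zs where zs: "length gs = llen zs"
        "\<forall>i<length gs. jud (recf_code (gs ! i)) (list_encode xs) (lnth zs i) \<in> set L"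
        "jud (recf_code f') zs y \<in> set L"
        using jf by (auto simp: justified_def lnth_eq)
      have "list_all2 (\<lambda>g z. eval g xs z) gs (list_decode zs)"
        using zs(1,2) IH by (auto simp: list_all2_conv_all_nth lnth_eq)
      moreover have "eval f' (list_decode zs) y" using IH[of f' "list_decode zs" y] zs(3) by simp
      ultimately show ?thesis unfolding Comp by (rule eval_Comp)
    next
      case (Prim f' g)
      then consider xs' where "list_encode xs = Suc (pr 0 xs')" "jud (recf_code f') xs' y \<in> set L"
        | n xs' r where "list_encode xs = Suc (pr (Suc n) xs')"
          "jud (recf_code (Prim f' g)) (Suc (pr n xs')) r \<in> set L" "jud (recf_code g) (Suc (pr n (Suc (pr r xs')))) y \<in> set L"
        using jf by (auto simp: justified_def)
      then show ?thesis
      proof cases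
        case 1
        from 1(1) have "xs = 0 # list_decode xs'"
          by (metis list_decode.simps(2) list_encode_inverse prod.case prod_encode_inverse)
        then show ?thesis using IH[of f' "list_decode xs'" y] 1(2) Prim by (auto intro: eval.intros)
      next
        case 2
        from 2(1) have "xs = Suc n # list_decode xs'"
          by (metis list_decode.simps(2) list_encode_inverse prod.case prod_encode_inverse)
        then show ?thesis
          using IH[of "Prim f' g" "n # list_decode xs'" r] IH[of g "n # r # list_decode xs'" y] 2(2,3) Prim
          by (auto intro: eval.intros)
      qed
    next
      case (Mu f')
      then have mu: "jud (recf_code f') (list_encode (y # xs)) 0 \<in> set L"
        "\<forall>m<y. \<exists>k. jud (recf_code f') (list_encode (m # xs)) (Suc k) \<in> set L"
        using jf by (auto simp: justified_def)
      have "\<forall>m<y. \<exists>k. eval f' (m # xs) (Suc k)" using mu(2) IH by blast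
      then show ?thesis unfolding Mu using IH[OF mu(1)] by (intro eval_Mu)
    qed
    then show ?case using j IH by auto
  qed simp
  then show "univ (jud (recf_code f) (list_encode xs) y) \<Longrightarrow> eval f xs y" unfolding univ_def by blast
qed

lemma re_univ: "re univ"
proof -
  have justified: "re (\<lambda>x. justified (set (list_decode (S x))) (E x) (X x) (Y x))"
    if c: "cmp S" "cmp E" "cmp X" "cmp Y" for S E X Y
    unfolding justified_def
    by (rule re_all re_intros | rule dec_re | rule dec_mem dec_intros
          | rule cmp_lnth cmp_llen cmp_intros cmp_comp[OF c(1)] cmp_comp[OF c(2)] cmp_comp[OF c(3)] cmp_comp[OF c(4)])+
  have "re (\<lambda>j. \<exists>L. (\<forall>i<llen L. justified (set (list_decode (ldrop (Suc i) L)))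
     (pfst (lnth L i)) (pfst (psnd (lnth L i))) (psnd (psnd (lnth L i)))) \<and> j \<in> set (list_decode L))"
    by (rule re_all re_intros justified | rule dec_re | rule dec_mem dec_intros
          | rule cmp_lnth cmp_llen cmp_ldrop cmp_intros)+
  also have "(\<lambda>j. \<exists>L. (\<forall>i<llen L. justified (set (list_decode (ldrop (Suc i) L)))
     (pfst (lnth L i)) (pfst (psnd (lnth L i))) (psnd (psnd (lnth L i)))) \<and> j \<in> set (list_decode L)) = univ"
    (is "?l = _")
  proof
    fix j
    have "?l j \<longleftrightarrow> (\<exists>L. derivation (list_decode L) \<and> j \<in> set (list_decode L))"
      unfolding derivation_def by (simp add: ldrop_eq lnth_eq)
    also have "\<dots> \<longleftrightarrow> univ j"
      unfolding univ_def by (metis list_encode_inverse)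
    finally show "?l j = univ j" .
  qed
  finally show ?thesis .
qed

section \<open>The optimal prefix-free machine\<close>

lemma enc_append: "enc (a @ b) = enc a + 2 ^ length a * enc b"
  by (induction a) (auto simp: algebra_simps)

lemma enc_length: "2 ^ length a \<le> enc a + 1" "enc a + 1 < 2 ^ Suc (length a)"
  by (induction a) auto

lemma enc_inj: "enc a = enc b \<Longrightarrow> a = b"
proof (induction a arbitrary: b)
  case Nil
  then show ?case by (cases b) (auto split: if_splits)
next
  case (Cons x a)
  then obtain y b' where b: "b = y # b'" by (cases b) (auto split: if_splits)
  have "2 * enc a + (if x then 2 else 1) = 2 * enc b' + (if y then 2 else 1)" using Cons.prems b by simp
  then have "x = y \<and> enc a = enc b'" by (auto split: if_splits) presburger+
  then show ?case using Cons.IH b by simp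
qed

lemma enc_surj: "\<exists>a. enc a = n"
proof (induction n rule: less_induct)
  case (less n)
  show ?case
  proof (cases n)
    case 0
    then show ?thesis by (intro exI[of _ "[]"]) simp
  next
    case (Suc k)
    then have "k div 2 < n" by (simp add: less_Suc_eq_le)
    then obtain a where a: "enc a = k div 2" using less by blast
    show ?thesis
    proof (cases "even k")
      case True
      then show ?thesis using a Suc by (intro exI[of _ "False # a"]) auto
    next
      case False
      then show ?thesis using a Suc by (intro exI[of _ "True # a"]) (auto elim!: oddE)
    qed
  qed
qed

section \<open>Concatenation and prefixes on the codes of strings\<close>

definition sdec :: "nat \<Rightarrow> bool list" where "sdec n = (THE a. enc a = n)"

lemma sdec_enc [simp]: "sdec (enc a) = a"
  unfolding sdec_def by (rule the_equality) (auto dest: enc_inj)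

lemma enc_sdec [simp]: "enc (sdec n) = n"
  using enc_surj[of n] by auto

lemma sdec_eq_iff: "sdec n = a \<longleftrightarrow> n = enc a" by auto

text \<open>The two inequalities say that l is the length of the string with code a, by
  \<open>enc_length\<close>; the equation is then \<open>enc_append\<close>.\<close>

definition app_at :: "nat \<Rightarrow> nat \<Rightarrow> nat \<Rightarrow> nat \<Rightarrow> bool" where
  "app_at l a b c \<longleftrightarrow> 2 ^ l \<le> a + 1 \<and> a + 1 < 2 ^ Suc l \<and> c = a + 2 ^ l * b"

lemma length_unique:
  assumes "2 ^ l \<le> n" "n < 2 ^ Suc l" "2 ^ k \<le> n" "n < (2::nat) ^ Suc k"
  shows "l = k"
proof -
  have "(2::nat) ^ l < 2 ^ Suc k" "(2::nat) ^ k < 2 ^ Suc l" using assms by linarith+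
  then have "l < Suc k" "k < Suc l" by (simp_all only: power_strict_increasing_iff one_less_numeral_iff semiring_norm)
  then show ?thesis by simp
qed

lemma app_at_enc: "app_at l (enc a) (enc b) c \<longleftrightarrow> l = length a \<and> c = enc (a @ b)"
  unfolding app_at_def enc_append using enc_length[of a] length_unique[of l "enc a + 1" "length a"] by auto

lemma append_iff: "sdec a @ sdec b = sdec c \<longleftrightarrow> (\<exists>l. app_at l a b c)"
proof -
  have "(\<exists>l. app_at l (enc (sdec a)) (enc (sdec b)) c) \<longleftrightarrow> c = enc (sdec a @ sdec b)"
    by (simp only: app_at_enc) simp
  then show ?thesis by (auto simp: sdec_eq_iff[symmetric])
qed

text \<open>The bounds on the witnesses make the prefix relation decidable, not merely r.e. The
  optimal machine needs this, since it tests for conflicts in the premise of an implication.\<close>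

lemma prefix_iff: "prefix (sdec a) (sdec c) \<longleftrightarrow> (\<exists>l<Suc a. \<exists>b<Suc c. app_at l a b c)"
proof
  assume "prefix (sdec a) (sdec c)"
  then obtain s where "sdec a @ sdec (enc s) = sdec c" by (auto elim: prefixE)
  then obtain l where l: "app_at l a (enc s) c" unfolding append_iff by blast
  have "l < Suc a"
    using l less_exp[of l] unfolding app_at_def by linarith
  moreover have "enc s \<le> 2 ^ l * enc s" by simp
  then have "enc s < Suc c" using l unfolding app_at_def by linarith
  ultimately show "\<exists>l<Suc a. \<exists>b<Suc c. app_at l a b c" using l by blast
next
  assume "\<exists>l<Suc a. \<exists>b<Suc c. app_at l a b c"
  then show "prefix (sdec a) (sdec c)" using append_iff by (metis prefixI)
qed

lemma dec_app_at:
  "cmp L \<Longrightarrow> cmp A \<Longrightarrow> cmp B \<Longrightarrow> cmp C \<Longrightarrow> dec (\<lambda>x. app_at (L x) (A x) (B x) (C x))"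
  unfolding app_at_def by (intro dec_intros cmp_intros)

lemma re_append:
  assumes c: "cmp A" "cmp B" "cmp C" shows "re (\<lambda>x. sdec (A x) @ sdec (B x) = sdec (C x))"
  unfolding append_iff
  by (rule re_ex dec_re dec_app_at cmp_intros cmp_comp[OF c(1)] cmp_comp[OF c(2)] cmp_comp[OF c(3)])+

lemma dec_prefix:
  assumes c: "cmp A" "cmp C" shows "dec (\<lambda>x. prefix (sdec (A x)) (sdec (C x)))"
  unfolding prefix_iff
  by (rule dec_ex dec_app_at cmp_intros cmp_comp[OF c(1)] cmp_comp[OF c(2)])+

lemma enc_unary: "enc (replicate e True @ False # q) + 2 = 3 * 2 ^ e + 2 ^ Suc e * enc q"
  by (induction e) auto

lemma prefix_unary:
  "prefix (replicate e True @ False # q) (replicate e' True @ False # q') \<Longrightarrow> e = e' \<and> prefix q q'"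
proof (induction e arbitrary: e')
  case 0
  then show ?case by (cases e') auto
next
  case (Suc e)
  then show ?case by (cases e') auto
qed

definition re_rel :: "(bool list \<Rightarrow> bool list \<Rightarrow> bool) \<Rightarrow> bool" where
  "re_rel R \<longleftrightarrow> re (\<lambda>z. R (sdec (pfst z)) (sdec (psnd z)))"

lemma re_relD: "re_rel R \<Longrightarrow> cmp F \<Longrightarrow> cmp G \<Longrightarrow> re (\<lambda>x. R (sdec (F x)) (sdec (G x)))"
  using re_subst[of _ "\<lambda>x. pr (F x) (G x)"] unfolding re_rel_def by (fastforce intro: cmp_pr)

lemma re_ex_string:
  assumes "re (\<lambda>z. P (sdec (pfst z)) (psnd z))" shows "re (\<lambda>x. \<exists>a. P a x)"
proof -
  have "re (\<lambda>x. \<exists>n. P (sdec n) x)" using assms by (rule re_ex)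
  moreover have "(\<exists>n. P (sdec n) x) \<longleftrightarrow> (\<exists>a. P a x)" for x by (metis sdec_enc)
  ultimately show ?thesis by simp
qed

text \<open>The case p = p' makes the relation single-valued, so that it is the graph of a partial
  function with prefix-free domain.\<close>

definition prefix_free_rel :: "(bool list \<Rightarrow> bool list \<Rightarrow> bool) \<Rightarrow> bool" where
  "prefix_free_rel R \<longleftrightarrow> (\<forall>p p' y y'. R p y \<longrightarrow> R p' y' \<longrightarrow> prefix p p' \<longrightarrow> p = p' \<and> y = y')"

lemma machine_of_rel:
  assumes "re_rel R" "prefix_free_rel R"
  shows "\<exists>M. prefix_free_machine M \<and> (\<forall>p y. M p = Some y \<longleftrightarrow> R p y)"
proof -
  define M where "M p = (if \<exists>y. R p y then Some (THE y. R p y) else None)" for p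
  have sv: "y = y'" if "R p y" "R p y'" for p y y'
    using assms(2) that unfolding prefix_free_rel_def by blast
  have M: "M p = Some y \<longleftrightarrow> R p y" for p y
    unfolding M_def using theI[of "R p"] sv the_equality[of "R p"] by auto
  obtain f where f: "\<And>x y. eval f [x] y \<longleftrightarrow> R (sdec x) (sdec y)"
    using re_graph_computable[of "\<lambda>x y. R (sdec x) (sdec y)"] assms(1) sv
    unfolding re_rel_def by (metis enc_sdec)
  have "partial_computable M" unfolding partial_computable_def by (intro exI[of _ f]) (simp add: M f)
  moreover have "p = q" if "M p \<noteq> None" "M q \<noteq> None" "prefix p q" for p q
    using that M assms(2) unfolding prefix_free_rel_def by (metis option.exhaust)
  ultimately have "prefix_free_machine M" unfolding prefix_free_machine_def by blast
  then show ?thesis using M by blast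
qed

lemma re_rel_of_machine:
  assumes "partial_computable M" shows "re_rel (\<lambda>p y. M p = Some y)"
proof -
  obtain f where f: "\<And>p y. M p = Some y \<longleftrightarrow> eval f [enc p] (enc y)"
    using assms unfolding partial_computable_def by blast
  have *: "M (sdec x) = Some (sdec y) \<longleftrightarrow> univ (jud (recf_code f) (Suc (pr x 0)) y)" for x y
    using f[of "sdec x" "sdec y"] eval_univ[of f "[x]" y] univ_eval[of f "[x]" y] by auto
  show ?thesis unfolding re_rel_def *
    by (rule re_subst[OF re_univ]) (intro cmp_intros)
qed

text \<open>Prefix-free restriction of an arbitrary r.e. relation: a pair is kept only if no pair with a
  smaller witness conflicts with it.\<close>

lemma optimal_machine_exists: "\<exists>U. optimal_machine U"
proof -
  obtain D where D: "dec D" "univ = (\<lambda>x. \<exists>w. D (pr w x))" using re_univ by (rule reE)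
  have univ_iff: "univ x \<longleftrightarrow> (\<exists>w. D (pr w x))" for x using D(2) by (rule fun_cong)
  \<comment> \<open>\<open>t\<close> packs a witness, an input and an output, and
    \<open>Suc (pr p 0)\<close> is the argument list with the single entry p. Thus
    \<open>E e t\<close> is the decidable statement that the witness certifies this output for the
    term with code e; an order on such \<open>t\<close> settles conflicts.\<close>
  define E where "E e t \<longleftrightarrow> D (pr (pfst t) (jud e (Suc (pr (pfst (psnd t)) 0)) (psnd (psnd t))))" for e t
  define G where "G e p y \<longleftrightarrow> (\<exists>w. E e (pr w (pr (enc p) (enc y))) \<and>
      (\<forall>t<pr w (pr (enc p) (enc y)). E e t \<and>
         (prefix (sdec (pfst (psnd t))) p \<or> prefix p (sdec (pfst (psnd t)))) \<longrightarrow>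
         pfst (psnd t) = enc p \<and> psnd (psnd t) = enc y))" for e p y
  have G_pf: "p = p' \<and> y = y'" if h: "G e p y" "G e p' y'" "prefix p p' \<or> prefix p' p" for e p p' y y'
  proof -
    obtain w where w: "E e (pr w (pr (enc p) (enc y)))"
      "\<And>t. t<pr w (pr (enc p) (enc y)) \<Longrightarrow> E e t \<Longrightarrow>
         (prefix (sdec (pfst (psnd t))) p \<or> prefix p (sdec (pfst (psnd t)))) \<Longrightarrow>
         pfst (psnd t) = enc p \<and> psnd (psnd t) = enc y"
      using h(1) unfolding G_def by blast
    obtain w' where w': "E e (pr w' (pr (enc p') (enc y')))"
      "\<And>t. t<pr w' (pr (enc p') (enc y')) \<Longrightarrow> E e t \<Longrightarrow>
         (prefix (sdec (pfst (psnd t))) p' \<or> prefix p' (sdec (pfst (psnd t)))) \<Longrightarrow>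
         pfst (psnd t) = enc p' \<and> psnd (psnd t) = enc y'"
      using h(2) unfolding G_def by blast
    consider "pr w (pr (enc p) (enc y)) < pr w' (pr (enc p') (enc y'))"
      | "pr w' (pr (enc p') (enc y')) < pr w (pr (enc p) (enc y))"
      | "pr w (pr (enc p) (enc y)) = pr w' (pr (enc p') (enc y'))" by linarith
    then show ?thesis
    proof cases
      case 1
      then show ?thesis using w'(2)[OF 1 w(1)] h(3) enc_inj by auto
    next
      case 2
      then show ?thesis using w(2)[OF 2 w'(1)] h(3) enc_inj by auto
    next
      case 3
      then show ?thesis using enc_inj by auto
    qed
  qed
  \<comment> \<open>The unary header selects the machine and is self-delimiting, so the machines may
    share one domain. Its length is the additive constant of optimality.\<close>
  define R where "R p y \<longleftrightarrow> (\<exists>e q. p = replicate e True @ False # q \<and> G e q y)" for p y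
  have R_iff: "R (sdec x) (sdec y) \<longleftrightarrow> (\<exists>e q. x + 2 = 3 * 2 ^ e + 2 ^ Suc e * q \<and> G e (sdec q) (sdec y))" for x y
  proof -
    have "sdec x = replicate e True @ False # q \<longleftrightarrow> x + 2 = 3 * 2 ^ e + 2 ^ Suc e * enc q" for e q
      unfolding sdec_eq_iff enc_unary[symmetric] by simp
    then show ?thesis unfolding R_def by (metis enc_sdec sdec_enc)
  qed
  have "re_rel R"
    unfolding re_rel_def R_iff G_def E_def enc_sdec
    by (rule re_all re_imp re_intros | rule dec_re | rule dec_prefix dec_intros dec_subst[OF D(1)]
          | rule cmp_intros)+
  moreover have "prefix_free_rel R"
    unfolding prefix_free_rel_def
  proof (intro allI impI)
    fix p p' y y' assume R: "R p y" "R p' y'" "prefix p p'"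
    obtain e q where p: "p = replicate e True @ False # q" "G e q y" using R(1) unfolding R_def by blast
    obtain e' q' where p': "p' = replicate e' True @ False # q'" "G e' q' y'" using R(2) unfolding R_def by blast
    have "e = e'" "prefix q q'" using prefix_unary[OF R(3)[unfolded p(1) p'(1)]] by auto
    then show "p = p' \<and> y = y'" using G_pf[of e q y q' y'] p p' by auto
  qed
  ultimately obtain U where U: "prefix_free_machine U" "\<And>p y. U p = Some y \<longleftrightarrow> R p y"
    using machine_of_rel by blast
  have "\<exists>c. \<forall>p \<sigma>. M p = Some \<sigma> \<longrightarrow> (\<exists>q. U q = Some \<sigma> \<and> length q \<le> length p + c)"
    if M: "prefix_free_machine M" for M
  proof -
    obtain f where f: "\<And>p y. M p = Some y \<longleftrightarrow> eval f [enc p] (enc y)"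
      using M unfolding prefix_free_machine_def partial_computable_def by blast
    have E: "M (sdec (pfst (psnd t))) = Some (sdec (psnd (psnd t)))" if "E (recf_code f) t" for t
    proof -
      have "univ (jud (recf_code f) (Suc (pr (pfst (psnd t)) 0)) (psnd (psnd t)))"
        using that unfolding E_def univ_iff by blast
      then show ?thesis using univ_eval[of f "[pfst (psnd t)]"] f by simp
    qed
    have "G (recf_code f) p y" if My: "M p = Some y" for p y
    proof -
      have "univ (jud (recf_code f) (Suc (pr (enc p) 0)) (enc y))"
        using eval_univ[of f "[enc p]" "enc y"] f My by simp
      then obtain w where w: "E (recf_code f) (pr w (pr (enc p) (enc y)))"
        unfolding E_def univ_iff by auto
      \<comment> \<open>A machine that is already prefix-free has no conflicts: comparable inputs in
        its domain coincide. Hence the restriction loses none of its pairs.\<close>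
      have "pfst (psnd t) = enc p \<and> psnd (psnd t) = enc y"
        if "E (recf_code f) t" "prefix (sdec (pfst (psnd t))) p \<or> prefix p (sdec (pfst (psnd t)))" for t
      proof -
        have "sdec (pfst (psnd t)) = p"
          using M E[OF that(1)] My that(2) unfolding prefix_free_machine_def by (metis option.distinct(1))
        then show ?thesis using E[OF that(1)] My by (auto simp: sdec_eq_iff)
      qed
      then show ?thesis using w unfolding G_def by blast
    qed
    then have "M p = Some \<sigma> \<Longrightarrow> U (replicate (recf_code f) True @ False # p) = Some \<sigma>" for p \<sigma>
      unfolding U(2) R_def by blast
    then show ?thesis
      by (intro exI[of _ "Suc (recf_code f)"] allI impI exI[of _ "replicate (recf_code f) True @ False # _"]) auto
  qed
  then show ?thesis using U(1) unfolding optimal_machine_def by blast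
qed

section \<open>Upper bounds for complexity from r.e. relations\<close>

lemma UM_optimal: "optimal_machine UM"
  unfolding UM_def using optimal_machine_exists by (rule someI_ex)

lemma UM_pf: "prefix_free_machine UM"
  using UM_optimal unfolding optimal_machine_def by blast

lemma K_le: "UM q = Some \<sigma> \<Longrightarrow> K \<sigma> \<le> length q"
  unfolding K_def by (rule Least_le) blast

lemma K_attained: assumes "UM q = Some \<sigma>" shows "\<exists>q. UM q = Some \<sigma> \<and> length q = K \<sigma>"
  unfolding K_def by (rule LeastI_ex) (use assms in blast)

text \<open>That \<open>UM\<close> has a program for y is asserted along with the bound, since
  \<open>K\<close> is a \<open>LEAST\<close> and says nothing about a string without programs. Later
  \<open>UM_surj\<close> provides programs for all strings.\<close>

lemma K_machine:
  assumes "re_rel R" "prefix_free_rel R"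
  shows "\<exists>c. \<forall>p y. R p y \<longrightarrow> (\<exists>q. UM q = Some y) \<and> K y \<le> length p + c"
proof -
  obtain M where M: "prefix_free_machine M" "\<And>p y. M p = Some y \<longleftrightarrow> R p y"
    using machine_of_rel[OF assms] by blast
  obtain c where c: "\<And>p y. M p = Some y \<Longrightarrow> \<exists>q. UM q = Some y \<and> length q \<le> length p + c"
    using UM_optimal M(1) unfolding optimal_machine_def by blast
  have "(\<exists>q. UM q = Some y) \<and> K y \<le> length p + c" if "R p y" for p y
    using c[of p y] M(2) that K_le by (metis le_trans)
  then show ?thesis by blast
qed

text \<open>The number n is written in bijective binary as b and made self-delimiting by a unary
  copy of the length of b, whence the factor 2. Strings of zeros later act as trivial side
  information that conveys only a length.\<close>

lemma K_zeros: "\<exists>c. \<forall>n. (\<exists>q. UM q = Some (replicate n False)) \<and>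
   real (K (replicate n False)) \<le> 2 * log 2 (real n + 1) + real c"
proof -
  define R where "R p y \<longleftrightarrow> (\<exists>b. p = replicate (length b) True @ False # b \<and> y = replicate (enc b) False)" for p y
  have code0: "enc (replicate n False) + 1 = 2 ^ n" for n
    by (induction n) auto
  have R_iff: "R (sdec x) (sdec y) \<longleftrightarrow> (\<exists>l b. x + 2 = 3 * 2 ^ l + 2 ^ Suc l * b \<and>
      2 ^ l \<le> b + 1 \<and> b + 1 < 2 ^ Suc l \<and> y + 1 = 2 ^ b)" for x y
  proof -
    have 1: "sdec x = replicate e True @ False # q \<longleftrightarrow> x + 2 = 3 * 2 ^ e + 2 ^ Suc e * enc q" for e q
      unfolding sdec_eq_iff enc_unary[symmetric] by simp
    have 2: "sdec y = replicate b False \<longleftrightarrow> y + 1 = 2 ^ b" for b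
      unfolding sdec_eq_iff code0[symmetric] by simp
    have 3: "2 ^ l \<le> enc b + 1 \<and> enc b + 1 < 2 ^ Suc l \<longleftrightarrow> l = length b" for l b
      using enc_length[of b] length_unique[of l "enc b + 1" "length b"] by auto
    have "(\<exists>l b. x + 2 = 3 * 2 ^ l + 2 ^ Suc l * b \<and>
      2 ^ l \<le> b + 1 \<and> b + 1 < 2 ^ Suc l \<and> y + 1 = 2 ^ b) \<longleftrightarrow>
      (\<exists>l b. x + 2 = 3 * 2 ^ l + 2 ^ Suc l * enc b \<and>
      2 ^ l \<le> enc b + 1 \<and> enc b + 1 < 2 ^ Suc l \<and> y + 1 = 2 ^ enc b)"
      by (metis enc_sdec)
    also have "\<dots> \<longleftrightarrow> R (sdec x) (sdec y)" unfolding R_def 1 2 by (metis 3)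
    finally show ?thesis ..
  qed
  have "re_rel R"
    unfolding re_rel_def R_iff
    by (rule re_intros | rule dec_re | rule dec_intros | rule cmp_intros)+
  moreover have "prefix_free_rel R"
    unfolding prefix_free_rel_def
  proof (intro allI impI)
    fix p p' y y' assume R: "R p y" "R p' y'" "prefix p p'"
    obtain b where p: "p = replicate (length b) True @ False # b" "y = replicate (enc b) False"
      using R(1) unfolding R_def by blast
    obtain b' where p': "p' = replicate (length b') True @ False # b'" "y' = replicate (enc b') False"
      using R(2) unfolding R_def by blast
    have "length b = length b'" "prefix b b'" using prefix_unary[OF R(3)[unfolded p(1) p'(1)]] by auto
    then have "b = b'" by (auto simp: prefix_def)
    then show "p = p' \<and> y = y'" using p p' by simp
  qed
  ultimately obtain c where c: "\<And>p y. R p y \<Longrightarrow> (\<exists>q. UM q = Some y) \<and> K y \<le> length p + c"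
    using K_machine by blast
  show ?thesis
  proof (intro exI[of _ "Suc c"] allI)
    fix n
    let ?b = "sdec n"
    have R: "R (replicate (length ?b) True @ False # ?b) (replicate n False)" unfolding R_def by force
    have "real (2 ^ length ?b) \<le> real (n + 1)" using enc_length(1)[of ?b] by (simp only: of_nat_le_iff) simp
    then have "log 2 (2 ^ length ?b) \<le> log 2 (real n + 1)" by (subst log_le_cancel_iff) (auto simp: add.commute)
    then have "real (length ?b) \<le> log 2 (real n + 1)" by (simp add: log_nat_power)
    then show "(\<exists>q. UM q = Some (replicate n False)) \<and>
        real (K (replicate n False)) \<le> 2 * log 2 (real n + 1) + real (Suc c)"
      using c[OF R] by auto
  qed
qed

section \<open>Dictionary machines\<close>

text \<open>A path is guessed as one coded list of states, and its consecutive members are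
  checked.\<close>

lemma re_rtranclp:
  assumes "re (\<lambda>z. S (pfst z) (psnd z))" "cmp A" "cmp B"
  shows "re (\<lambda>x. S\<^sup>*\<^sup>* (A x) (B x))"
proof -
  have *: "S\<^sup>*\<^sup>* a b \<longleftrightarrow> (\<exists>L n. lnth L 0 = a \<and> lnth L n = b \<and> (\<forall>i<n. S (lnth L i) (lnth L (Suc i))))" for a b
  proof
    assume "S\<^sup>*\<^sup>* a b"
    then obtain n where "(S ^^ n) a b" by (auto dest: rtranclp_imp_relpowp)
    then obtain f where f: "f 0 = a" "f n = b" "\<forall>i<n. S (f i) (f (Suc i))"
      unfolding relpowp_fun_conv by blast
    have "lnth (list_encode (map f [0..<Suc n])) i = f i" if "i \<le> n" for i
      using that by (subst lnth_eq) (auto simp: nth_append simp del: upt_Suc)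
    then have "lnth (list_encode (map f [0..<Suc n])) 0 = a \<and> lnth (list_encode (map f [0..<Suc n])) n = b \<and>
      (\<forall>i<n. S (lnth (list_encode (map f [0..<Suc n])) i) (lnth (list_encode (map f [0..<Suc n])) (Suc i)))"
      using f by simp
    then show "\<exists>L n. lnth L 0 = a \<and> lnth L n = b \<and> (\<forall>i<n. S (lnth L i) (lnth L (Suc i)))" by blast
  next
    assume "\<exists>L n. lnth L 0 = a \<and> lnth L n = b \<and> (\<forall>i<n. S (lnth L i) (lnth L (Suc i)))"
    then obtain n where "(S ^^ n) a b" unfolding relpowp_fun_conv by blast
    then show "S\<^sup>*\<^sup>* a b" by (rule relpowp_imp_rtranclp)
  qed
  have S: "re (\<lambda>x. S (F x) (G x))" if "cmp F" "cmp G" for F G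
    using re_subst[OF assms(1) cmp_pr[OF that]] by simp
  show ?thesis unfolding *
    by (rule re_all re_intros S | rule dec_re | rule dec_intros
        | rule cmp_lnth cmp_intros cmp_comp[OF assms(2)] cmp_comp[OF assms(3)])+
qed

type_synonym entry = "bool list \<times> bool list \<times> bool list"

text \<open>An entry \<open>(u, c, w)\<close> of a dictionary replaces, while reading side information \<open>u\<close>,
  the code word \<open>c\<close> by \<open>w\<close>.\<close>

inductive run :: "entry set \<Rightarrow> bool list \<Rightarrow> bool list \<Rightarrow> bool list \<Rightarrow> bool" for D where
  run_Nil: "run D [] [] []"
| run_Cons: "(u, c, w) \<in> D \<Longrightarrow> run D x p y \<Longrightarrow> run D (u @ x) (c @ p) (w @ y)"

text \<open>A decoder knows that it is finished when the side information is used up, so no entry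
  may consume nothing of it. Code words need to be prefix-free only among entries with comparable
  side information: the codes are conditional.\<close>

definition dict_ok :: "entry set \<Rightarrow> bool" where
  "dict_ok D \<longleftrightarrow> finite D \<and> (\<forall>(u, c, w)\<in>D. u \<noteq> [] \<and> (\<forall>(u', c', w')\<in>D.
     (prefix u u' \<or> prefix u' u) \<and> (prefix c c' \<or> prefix c' c) \<longrightarrow> u = u' \<and> c = c' \<and> w = w'))"

lemma dict_okD:
  assumes "dict_ok D" "(u, c, w) \<in> D" "(u', c', w') \<in> D"
    "prefix u u' \<or> prefix u' u" "prefix c c' \<or> prefix c' c"
  shows "u = u' \<and> c = c' \<and> w = w'"
proof -
  have "\<forall>(u', c', w')\<in>D. (prefix u u' \<or> prefix u' u) \<and> (prefix c c' \<or> prefix c' c) \<longrightarrow>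
      u = u' \<and> c = c' \<and> w = w'"
    using assms(1,2) unfolding dict_ok_def by auto
  from bspec[OF this assms(3)] show ?thesis using assms(4,5) by simp blast
qed

lemma run_append: "run D x p y \<Longrightarrow> run D x' p' y' \<Longrightarrow> run D (x @ x') (p @ p') (y @ y')"
  by (induction rule: run.induct) (auto intro: run_Cons)

lemma run_single: "(u, c, w) \<in> D \<Longrightarrow> run D u c w"
  using run_Cons[OF _ run_Nil, of u c w D] by simp

lemma run_functional:
  assumes "dict_ok D" "run D x p y" "run D x p' y'" "prefix p p'"
  shows "p = p' \<and> y = y'"
  using assms(2-)
proof (induction arbitrary: p' y' rule: run.induct)
  case run_Nil
  from run_Nil(1) show ?case
  proof cases
    case (run_Cons u c w x p y)
    then show ?thesis using assms(1) unfolding dict_ok_def by auto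
  qed auto
next
  case (run_Cons u c w x p y)
  from run_Cons.prems(1) show ?case
  proof cases
    case run_Nil
    then show ?thesis using assms(1) run_Cons.hyps(1) unfolding dict_ok_def by auto
  next
    case (run_Cons u' c' w' x' r' z')
    have "prefix u u' \<or> prefix u' u"
      using run_Cons(1) by (metis append_eq_append_conv2 prefixI)
    moreover have "prefix c c' \<or> prefix c' c"
      using \<open>prefix (c @ p) p'\<close> run_Cons(2) by (metis append_prefixD prefixI prefix_same_cases)
    ultimately have eq: "u = u'" "c = c'" "w = w'"
      using dict_okD[OF assms(1) \<open>(u, c, w) \<in> D\<close> run_Cons(4)] by simp_all
    then have "x = x'" "prefix p r'" using run_Cons \<open>prefix (c @ p) p'\<close> by auto
    then show ?thesis using run_Cons.IH run_Cons eq by metis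
  qed
qed

lemma re_run:
  assumes "finite D" "cmp X" "cmp P" "cmp Y"
  shows "re (\<lambda>z. run D (sdec (X z)) (sdec (P z)) (sdec (Y z)))"
proof -
  define S where "S s t \<longleftrightarrow> (\<exists>d\<in>D. sdec (enc (fst d)) @ sdec (pfst t) = sdec (pfst s) \<and>
      sdec (enc (fst (snd d))) @ sdec (pfst (psnd t)) = sdec (pfst (psnd s)) \<and>
      sdec (enc (snd (snd d))) @ sdec (psnd (psnd t)) = sdec (psnd (psnd s)))" for s t
  have *: "run D (sdec x) (sdec p) (sdec y) \<longleftrightarrow> S\<^sup>*\<^sup>* (pr x (pr p y)) (pr 0 (pr 0 0))" for x p y
  proof
    have "run D x p y \<Longrightarrow> S\<^sup>*\<^sup>* (pr (enc x) (pr (enc p) (enc y))) (pr 0 (pr 0 0))" for x p y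
    proof (induction rule: run.induct)
      case (run_Cons u c w x p y)
      have "S (pr (enc (u @ x)) (pr (enc (c @ p)) (enc (w @ y)))) (pr (enc x) (pr (enc p) (enc y)))"
        unfolding S_def by (rule bexI[OF _ run_Cons.hyps(1)]) simp
      then show ?case using run_Cons.IH by (rule converse_rtranclp_into_rtranclp)
    qed simp
    from this[of "sdec x" "sdec p" "sdec y"]
    show "run D (sdec x) (sdec p) (sdec y) \<Longrightarrow> S\<^sup>*\<^sup>* (pr x (pr p y)) (pr 0 (pr 0 0))" by simp
    have "run D (sdec (pfst s)) (sdec (pfst (psnd s))) (sdec (psnd (psnd s)))" if "S\<^sup>*\<^sup>* s (pr 0 (pr 0 0))" for s
      using that
    proof (induction rule: converse_rtranclp_induct)
      case base
      have "sdec 0 = []" by (simp add: sdec_eq_iff)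
      then show ?case by (simp add: run_Nil)
    next
      case (step s t)
      then obtain u c w where "(u, c, w) \<in> D" "u @ sdec (pfst t) = sdec (pfst s)"
        "c @ sdec (pfst (psnd t)) = sdec (pfst (psnd s))" "w @ sdec (psnd (psnd t)) = sdec (psnd (psnd s))"
        unfolding S_def by auto
      then show ?case using run_Cons[OF _ step.IH] by metis
    qed
    from this[of "pr x (pr p y)"]
    show "S\<^sup>*\<^sup>* (pr x (pr p y)) (pr 0 (pr 0 0)) \<Longrightarrow> run D (sdec x) (sdec p) (sdec y)" by simp
  qed
  have "re (\<lambda>z. S (pfst z) (psnd z))" unfolding S_def
    by (rule re_finite_ex[OF assms(1)]) (intro re_conj re_append cmp_intros)
  then show ?thesis unfolding *
    by (rule re_rtranclp) (intro cmp_intros assms(2-))+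
qed

lemma K_dict_aux:
  assumes "dict_ok D"
  shows "\<exists>k. \<forall>x p y. run D x p y \<longrightarrow> (\<exists>q. UM q = Some x) \<longrightarrow>
    (\<exists>q. UM q = Some y) \<and> K y \<le> K x + length p + k"
proof -
  define R where "R p y \<longleftrightarrow> (\<exists>x q c. q @ c = p \<and> UM q = Some x \<and> run D x c y)" for p y
  have UM: "re_rel (\<lambda>p y. UM p = Some y)"
    using UM_pf re_rel_of_machine unfolding prefix_free_machine_def by blast
  have fin: "finite D" using assms unfolding dict_ok_def by blast
  have "re_rel R" unfolding re_rel_def R_def
    by (rule re_ex_string re_conj re_append re_run fin re_relD[OF UM] cmp_intros)+
  moreover have "prefix_free_rel R"
    unfolding prefix_free_rel_def
  proof (intro allI impI)
    fix p p' y y' assume R: "R p y" "R p' y'" "prefix p p'"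
    obtain x q c where p: "q @ c = p" "UM q = Some x" "run D x c y" using R(1) unfolding R_def by blast
    obtain x' q' c' where p': "q' @ c' = p'" "UM q' = Some x'" "run D x' c' y'"
      using R(2) unfolding R_def by blast
    have "prefix q q' \<or> prefix q' q" using R(3) p(1) p'(1) by (metis append_prefixD prefixI prefix_same_cases)
    then have "q = q'" using UM_pf p(2) p'(2) unfolding prefix_free_machine_def by (metis option.distinct(1))
    moreover then have "x = x'" "prefix c c'" using p p' R(3) by auto
    ultimately show "p = p' \<and> y = y'" using run_functional[OF assms p(3), of c' y'] p p' by auto
  qed
  ultimately obtain k where k: "\<And>p y. R p y \<Longrightarrow> (\<exists>q. UM q = Some y) \<and> K y \<le> length p + k"
    using K_machine by blast
  show ?thesis
  proof (intro exI[of _ k] allI impI)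
    fix x p y assume r: "run D x p y" "\<exists>q. UM q = Some x"
    obtain q where "UM q = Some x" "length q = K x" using r(2) K_attained by blast
    then have "R (q @ p) y" "length (q @ p) = K x + length p" using r(1) unfolding R_def by auto
    then show "(\<exists>q. UM q = Some y) \<and> K y \<le> K x + length p + k" using k by fastforce
  qed
qed

text \<open>The dictionary that rewrites each zero into a bit spelled out in the code turns a string
  of zeros, which has a program, into any string of the same length.\<close>

lemma UM_surj: "\<exists>q. UM q = Some y"
proof -
  define D :: "entry set" where "D = (\<lambda>b. ([False], [b], [b])) ` UNIV"
  have "dict_ok D" unfolding dict_ok_def D_def by auto
  have "run D (replicate (length y) False) y y"
  proof (induction y)
    case Nil
    show ?case by (simp add: run_Nil)
  next
    case (Cons b y)
    have "([False], [b], [b]) \<in> D" by (simp add: D_def)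
    from run_Cons[OF this Cons] show ?case by simp
  qed
  then show ?thesis using K_dict_aux[OF \<open>dict_ok D\<close>] K_zeros by blast
qed

lemma K_dict:
  assumes "dict_ok D"
  shows "\<exists>k. \<forall>x p y. run D x p y \<longrightarrow> K y \<le> K x + length p + k"
  using K_dict_aux[OF assms] UM_surj by blast

section \<open>Dictionaries assembled from code tables of several levels\<close>

definition tab_ok :: "nat \<Rightarrow> entry set \<Rightarrow> bool" where
  "tab_ok m T \<longleftrightarrow> finite T \<and> (\<forall>(u, c, w)\<in>T. length u = m \<and> length w = m \<and>
     (\<forall>(u', c', w')\<in>T. u = u' \<and> prefix c c' \<longrightarrow> c = c' \<and> w = w'))"

lemma tab_ok_length: "tab_ok m T \<Longrightarrow> (u, c, w) \<in> T \<Longrightarrow> length u = m"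
  unfolding tab_ok_def by auto

lemma tab_okD:
  assumes "tab_ok m T" "(u, c, w) \<in> T" "(u, c', w') \<in> T" "prefix c c'"
  shows "c = c' \<and> w = w'"
proof -
  have "\<forall>(u', c', w')\<in>T. u = u' \<and> prefix c c' \<longrightarrow> c = c' \<and> w = w'"
    using assms(1,2) unfolding tab_ok_def by auto
  from bspec[OF this assms(3)] show ?thesis using assms(4) by simp
qed

text \<open>The flags \<open>0 1^i 0\<close> tell the levels apart; the flag \<open>1\<close> marks the raw bits that are used for
  the last incomplete block.\<close>

definition level_dict :: "(nat \<Rightarrow> entry set) \<Rightarrow> nat \<Rightarrow> entry set" where
  "level_dict T j = (\<lambda>(a, b). ([a], [True, b], [b])) ` UNIV \<union>
     (\<Union>i\<le>j. (\<lambda>(u, c, w). (u, False # replicate i True @ False # c, w)) ` T i)"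

lemma level_dict_block:
  "i \<le> j \<Longrightarrow> (u, c, w) \<in> T i \<Longrightarrow> (u, False # replicate i True @ False # c, w) \<in> level_dict T j"
  unfolding level_dict_def by (intro UnI2 UN_I[of i] image_eqI[of _ _ "(u, c, w)"]) auto

lemma level_dict_raw: "([a], [True, b], [b]) \<in> level_dict T j"
  unfolding level_dict_def by (intro UnI1 image_eqI[of _ _ "(a, b)"]) auto

lemma level_dict_ok:
  assumes T: "\<And>i. tab_ok (m i) (T i)" "\<And>i. m i > 0"
  shows "dict_ok (level_dict T j)"
  unfolding dict_ok_def
proof (intro conjI ballI, goal_cases)
  case 1
  show ?case using T(1) unfolding level_dict_def tab_ok_def by auto
next
  case (2 d)
  obtain u c w where d: "d = (u, c, w)" by (cases d)
  have block: "u = u' \<and> c = c' \<and> w = w'"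
    if h: "(u, c, w) \<in> T i" "(u', c', w') \<in> T i'" "prefix u u' \<or> prefix u' u"
      "prefix (replicate i True @ False # c) (replicate i' True @ False # c')" for u c w u' c' w' i i'
  proof -
    have i: "i = i'" "prefix c c'" using prefix_unary[OF h(4)] by auto
    have "length u = length u'" using tab_ok_length[OF T(1)] h(1,2) i(1) by metis
    then have "u = u'" using h(3) by (auto simp: prefix_def)
    then show ?thesis using tab_okD[OF T(1) h(1)] h(2) i by blast
  qed
  have "u = u' \<and> c = c' \<and> w = w'" if h: "(u, c, w) \<in> level_dict T j" "(u', c', w') \<in> level_dict T j"
    "prefix u u' \<or> prefix u' u" "prefix c c'" for u c w u' c' w'
  proof -
    consider a b a' b' where "u = [a]" "c = [True, b]" "w = [b]" "u' = [a']" "c' = [True, b']" "w' = [b']"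
      | i r i' r' where "c = False # replicate i True @ False # r" "c' = False # replicate i' True @ False # r'"
        "(u, r, w) \<in> T i" "(u', r', w') \<in> T i'"
      using h(1,2,4) unfolding level_dict_def by fastforce
    then show ?thesis
    proof cases
      case 1
      then show ?thesis using h by auto
    next
      case 2
      then show ?thesis using block[OF 2(3,4) h(3)] h(4) prefix_unary[of i r i' r'] by auto
    qed
  qed
  moreover have "u \<noteq> []"
  proof -
    consider a where "u = [a]" | i r where "(u, r, w) \<in> T i"
      using 2 unfolding d level_dict_def by auto
    then show ?thesis
    proof cases
      case (2 i r)
      then show ?thesis using tab_ok_length[OF T(1) 2] T(2)[of i] by auto
    qed simp
  qed
  ultimately show ?case using 2 unfolding d by (simp, blast)
qed

definition pos :: "(nat \<Rightarrow> nat) \<Rightarrow> nat \<Rightarrow> nat" where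
  "pos m i = (\<Sum>k<i. m k)"

definition seg :: "seq \<Rightarrow> nat \<Rightarrow> nat \<Rightarrow> bool list" where
  "seg X a n = map X [a..<a + n]"

lemma length_seg [simp]: "length (seg X a n) = n" by (simp add: seg_def)

lemma restr_add: "restr X (a + n) = restr X a @ seg X a n"
  unfolding restr_def seg_def by (subst upt_add_eq_append) auto

lemma pos_Suc [simp]: "pos m (Suc i) = pos m i + m i" by (simp add: pos_def)

text \<open>The order of the quantifiers is the point. The constant k belongs to one dictionary for
  all levels up to j; it precedes the schedule \<open>L\<close>, the number of blocks and the
  sequences. The schedule can thus be chosen in view of these constants. The term
  \<open>L i + 2\<close> is the length of the flag, and \<open>2 * t\<close> pays for raw
  bits.\<close>

lemma K_levels:
  assumes T: "\<And>i. tab_ok (m i) (T i)" "\<And>i. m i > 0"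
  shows "\<exists>k. \<forall>L B t X Y cs. (\<forall>i<B. L i \<le> j \<and>
       (seg X (pos (\<lambda>i. m (L i)) i) (m (L i)), cs i, seg Y (pos (\<lambda>i. m (L i)) i) (m (L i))) \<in> T (L i)) \<longrightarrow>
     K (restr Y (pos (\<lambda>i. m (L i)) B + t)) \<le> K (restr X (pos (\<lambda>i. m (L i)) B + t)) +
       (\<Sum>i<B. length (cs i) + L i + 2) + 2 * t + k"
proof -
  obtain k where k: "\<And>x p y. run (level_dict T j) x p y \<Longrightarrow> K y \<le> K x + length p + k"
    using K_dict[OF level_dict_ok[of m T j, OF T]] by blast
  show ?thesis
  proof (intro exI[of _ k] allI impI)
    fix L B t X Y cs
    let ?P = "pos (\<lambda>i. m (L i))" and ?D = "level_dict T j"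
    assume h: "\<forall>i<B. L i \<le> j \<and> (seg X (?P i) (m (L i)), cs i, seg Y (?P i) (m (L i))) \<in> T (L i)"
    have blocks: "\<exists>p. run ?D (restr X (?P b)) p (restr Y (?P b)) \<and> length p = (\<Sum>i<b. length (cs i) + L i + 2)"
      if "b \<le> B" for b
      using that
    proof (induction b)
      case 0
      show ?case by (simp add: pos_def restr_def run_Nil)
    next
      case (Suc b)
      then obtain p where p: "run ?D (restr X (?P b)) p (restr Y (?P b))"
        "length p = (\<Sum>i<b. length (cs i) + L i + 2)" by auto
      have "(seg X (?P b) (m (L b)), False # replicate (L b) True @ False # cs b, seg Y (?P b) (m (L b))) \<in> ?D"
        using h Suc.prems by (intro level_dict_block) auto
      from run_append[OF p(1) run_single[OF this]] show ?case
        using p(2) by (intro exI[of _ "p @ False # replicate (L b) True @ False # cs b"]) (simp add: restr_add)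
    qed
    then obtain p where p: "run ?D (restr X (?P B)) p (restr Y (?P B))"
        "length p = (\<Sum>i<B. length (cs i) + L i + 2)" by blast
    have "\<exists>r. run ?D (seg X a t) r (seg Y a t) \<and> length r = 2 * t" for a
    proof (induction t)
      case 0
      show ?case by (simp add: seg_def run_Nil)
    next
      case (Suc t)
      then obtain r where r: "run ?D (seg X a t) r (seg Y a t)" "length r = 2 * t" by blast
      have "([X (a + t)], [True, Y (a + t)], [Y (a + t)]) \<in> ?D"
        by (rule level_dict_raw)
      from run_append[OF r(1) run_single[OF this]] show ?case
        using r(2) by (intro exI[of _ "r @ [True, Y (a + t)]"]) (simp add: seg_def)
    qed
    then obtain r where r: "run ?D (seg X (?P B) t) r (seg Y (?P B) t)" "length r = 2 * t" by blast
    show "K (restr Y (?P B + t)) \<le> K (restr X (?P B + t)) + (\<Sum>i<B. length (cs i) + L i + 2) + 2 * t + k"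
      using k[OF run_append[OF p(1) r(1)]] p(2) r(2) by (simp add: restr_add)
  qed
qed

section \<open>Covering and assignment\<close>

abbreviation bs :: "nat \<Rightarrow> bool list set" where "bs m \<equiv> {xs. length xs = m}"

definition ham :: "bool list \<Rightarrow> bool list \<Rightarrow> nat" where
  "ham x y = card {i. i < length x \<and> x ! i \<noteq> y ! i}"

definition supp :: "bool list \<Rightarrow> nat set" where
  "supp x = {i. i < length x \<and> x ! i}"

lemma finite_bs [simp]: "finite (bs m)"
  using finite_lists_length_eq[of "UNIV :: bool set" m] by simp

lemma card_bs [simp]: "card (bs m) = 2 ^ m"
  using card_lists_length_eq[of "UNIV :: bool set" m] by simp

lemma bij_diff:
  assumes "length x = m"
  shows "bij_betw (\<lambda>z. {i. i < m \<and> x ! i \<noteq> z ! i}) (bs m) (Pow {..<m})"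
proof (rule bij_betw_byWitness[where f' = "\<lambda>S. map (\<lambda>i. x ! i \<noteq> (i \<in> S)) [0..<m]"])
  show "\<forall>z\<in>bs m. map (\<lambda>i. x ! i \<noteq> (i \<in> {i. i < m \<and> x ! i \<noteq> z ! i})) [0..<m] = z"
    by (auto intro!: nth_equalityI)
qed auto

lemma card_sphere:
  assumes "length x = m" shows "card {z \<in> bs m. ham x z = d} = m choose d"
proof -
  have "bij_betw (\<lambda>z. {i. i < m \<and> x ! i \<noteq> z ! i}) {z \<in> bs m. ham x z = d} {S \<in> Pow {..<m}. card S = d}"
    using bij_diff[OF assms] by (rule bij_betw_Collect) (simp add: ham_def assms)
  then have "card {z \<in> bs m. ham x z = d} = card {S. S \<subseteq> {..<m} \<and> card S = d}"
    by (simp add: bij_betw_same_card)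
  then show ?thesis using n_subsets[of "{..<m}" d] by simp
qed

lemma bij_supp: "bij_betw supp (bs m) (Pow {..<m})"
  by (rule bij_betw_byWitness[where f' = "\<lambda>S. map (\<lambda>i. i \<in> S) [0..<m]"])
     (auto simp: supp_def intro!: nth_equalityI)

lemma card_supp: "card {z \<in> bs m. card (supp z) = l} = m choose l"
proof -
  have "bij_betw supp {z \<in> bs m. card (supp z) = l} {S \<in> Pow {..<m}. card S = l}"
    using bij_supp by (rule bij_betw_Collect) simp
  then have "card {z \<in> bs m. card (supp z) = l} = card {S. S \<subseteq> {..<m} \<and> card S = l}"
    by (simp add: bij_betw_same_card)
  then show ?thesis using n_subsets[of "{..<m}" l] by simp
qed

lemma finite_supp [simp]: "finite (supp x)" by (simp add: supp_def)

lemma card_supp_le: "card (supp x) \<le> length x"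
  using card_mono[of "{..<length x}" "supp x"] by (auto simp: supp_def)

lemma ham_le: "ham x y \<le> length x"
  unfolding ham_def using card_mono[of "{..<length x}" "{i. i < length x \<and> x ! i \<noteq> y ! i}"] by auto

lemma ham_self [simp]: "ham x x = 0" by (simp add: ham_def)

lemma ham_append:
  assumes "length x = length y"
  shows "ham (x @ x') (y @ y') = ham x y + ham x' y'"
proof -
  let ?A = "{i. i < length x \<and> x ! i \<noteq> y ! i}" and ?B = "{i. i < length x' \<and> x' ! i \<noteq> y' ! i}"
  have "{i. i < length (x @ x') \<and> (x @ x') ! i \<noteq> (y @ y') ! i} = ?A \<union> (\<lambda>i. i + length x) ` ?B" (is "?L = ?R")
  proof
    show "?L \<subseteq> ?R"
    proof
      fix i assume i: "i \<in> ?L"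
      show "i \<in> ?R"
      proof (cases "i < length x")
        case True
        then show ?thesis using i assms by (auto simp: nth_append)
      next
        case False
        then have "i = (i - length x) + length x" "i - length x \<in> ?B"
          using i assms by (auto simp: nth_append)
        then show ?thesis by blast
      qed
    qed
    show "?R \<subseteq> ?L" using assms by (auto simp: nth_append)
  qed
  moreover have "card (?A \<union> (\<lambda>i. i + length x) ` ?B) = card ?A + card ((\<lambda>i. i + length x) ` ?B)"
    by (rule card_Un_disjoint) auto
  moreover have "card ((\<lambda>i. i + length x) ` ?B) = card ?B" by (rule card_image) (auto simp: inj_on_def)
  ultimately show ?thesis unfolding ham_def by simp
qed

lemma ham_supp_subset:
  assumes "length x = length y" "supp x \<subseteq> supp y"
  shows "ham x y = card (supp y) - card (supp x)"
proof -
  have "{i. i < length x \<and> x ! i \<noteq> y ! i} = supp y - supp x"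
    using assms by (auto simp: supp_def)
  then show ?thesis unfolding ham_def using assms(2) by (simp add: card_Diff_subset)
qed

lemma card_supp_ham_le:
  assumes "length x = length y"
  shows "card (supp y) \<le> card (supp x) + ham x y"
proof -
  have "supp y \<subseteq> supp x \<union> {i. i < length x \<and> x ! i \<noteq> y ! i}" using assms by (auto simp: supp_def)
  then have "card (supp y) \<le> card (supp x \<union> {i. i < length x \<and> x ! i \<noteq> y ! i})"
    by (intro card_mono) auto
  also have "\<dots> \<le> card (supp x) + ham x y" unfolding ham_def by (rule card_Un_le)
  finally show ?thesis .
qed

lemma nat_ceiling_le: "0 \<le> x \<Longrightarrow> real (nat \<lceil>x\<rceil>) \<le> x + 1"
  using of_int_ceiling_le_add_one[of x] by simp

lemma sum_card_swap:
  assumes "finite A" "finite B"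
  shows "(\<Sum>a\<in>A. card {b \<in> B. R a b}) = (\<Sum>b\<in>B. card {a \<in> A. R a b})"
proof -
  have "(\<Sum>a\<in>A. card {b \<in> B. R a b}) = (\<Sum>a\<in>A. \<Sum>b\<in>B. if R a b then 1 else 0)"
    using assms by (intro sum.cong) (simp_all add: sum.If_cases Int_def)
  also have "\<dots> = (\<Sum>b\<in>B. \<Sum>a\<in>A. if R a b then 1 else 0)" by (rule sum.swap)
  also have "\<dots> = (\<Sum>b\<in>B. card {a \<in> A. R a b})"
    using assms by (intro sum.cong) (simp_all add: sum.If_cases Int_def)
  finally show ?thesis .
qed

lemma sum_card_fibres:
  assumes "finite W"
  shows "(\<Sum>x\<in>S. card {u \<in> W. g u = x}) \<le> card W"
proof (cases "finite S")
  case True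
  have "(\<Sum>x\<in>S. card {u \<in> W. g u = x}) = card (\<Union>x\<in>S. {u \<in> W. g u = x})"
    using True assms by (subst card_UN_disjoint) auto
  also have "\<dots> \<le> card W" using assms by (intro card_mono) auto
  finally show ?thesis .
qed simp

text \<open>A maximal partial assignment of load \<open>F\<close> already serves half of \<open>U\<close>, since every
  neighbour of an unserved element is saturated; iterating serves everybody.\<close>

lemma assignment_half:
  assumes fin: "finite U" "\<And>u. u \<in> U \<Longrightarrow> finite (Nb u)"
    and N1: "\<And>u. u \<in> U \<Longrightarrow> N1 \<le> card (Nb u)" "N1 > 0"
    and N2: "\<And>x. card {u \<in> U. x \<in> Nb u} \<le> N2" "N2 \<le> F * N1"
  obtains W g where "W \<subseteq> U" "\<And>u. u \<in> W \<Longrightarrow> g u \<in> Nb u" "\<And>x. card {u \<in> W. g u = x} \<le> F"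
    "card (U - W) \<le> card W"
proof -
  define P where "P = (\<lambda>(W, g). W \<subseteq> U \<and> (\<forall>u\<in>W. g u \<in> Nb u) \<and> (\<forall>x. card {u \<in> W. g u = x} \<le> F))"
  have "P ({}, undefined)" by (simp add: P_def)
  moreover have "\<forall>Wg. P Wg \<longrightarrow> card (fst Wg) < Suc (card U)"
    using fin(1) by (auto simp: P_def less_Suc_eq_le intro: card_mono)
  ultimately have "\<exists>Wg. P Wg \<and> (\<forall>Wg'. P Wg' \<longrightarrow> card (fst Wg') \<le> card (fst Wg))"
    by (rule Lattices_Big.ex_has_greatest_nat)
  then obtain Wg where Wg: "P Wg" "\<And>Wg'. P Wg' \<Longrightarrow> card (fst Wg') \<le> card (fst Wg)" by blast
  obtain W g where Wgp: "Wg = (W, g)" by (cases Wg)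
  have W: "W \<subseteq> U" "\<And>u. u \<in> W \<Longrightarrow> g u \<in> Nb u" "\<And>x. card {u \<in> W. g u = x} \<le> F"
    using Wg(1) unfolding Wgp P_def by auto
  have finW: "finite W" using W(1) fin(1) finite_subset by blast
  \<comment> \<open>The saturated targets. By maximality an unserved element has all its neighbours
    here, as otherwise it could be served too.\<close>
  define S where "S = (\<Union>u\<in>U. Nb u) \<inter> {x. card {u \<in> W. g u = x} = F}"
  have finS: "finite S" unfolding S_def using fin by auto
  have sat: "x \<in> S" if u: "u \<in> U - W" "x \<in> Nb u" for u x
  proof (rule ccontr)
    assume "x \<notin> S"
    then have less: "card {u \<in> W. g u = x} < F" using u W(3)[of x] unfolding S_def by auto
    define g' where "g' = g(u := x)"
    have fib: "card {v \<in> insert u W. g' v = z} \<le> F" for z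
    proof (cases "z = x")
      case True
      have "{v \<in> insert u W. g' v = z} = insert u {v \<in> W. g v = x}" using u True unfolding g'_def by auto
      then show ?thesis using less finW by (simp add: card_insert_if)
    next
      case False
      have "{v \<in> insert u W. g' v = z} = {v \<in> W. g v = z}" using u False unfolding g'_def by auto
      then show ?thesis using W(3) by simp
    qed
    have "P (insert u W, g')"
      using W(1,2) u fib unfolding P_def g'_def by auto
    from Wg(2)[OF this] have "card (insert u W) \<le> card W" unfolding Wgp by simp
    then show False using u finW by simp
  qed
  \<comment> \<open>Edges between the unserved elements and \<open>S\<close> are counted from both
    sides: at least \<open>N1\<close> leave each unserved element, and at most
    \<open>N2 \<le> F * N1\<close> arrive at each target. Each target in \<open>S\<close> uses up F
    elements of \<open>W\<close>, and these are distinct for distinct targets.\<close>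
  have "card (U - W) * N1 = (\<Sum>u\<in>U - W. N1)" by simp
  also have "\<dots> \<le> (\<Sum>u\<in>U - W. card {x \<in> S. x \<in> Nb u})"
  proof (rule sum_mono)
    fix u assume u: "u \<in> U - W"
    then have "{x \<in> S. x \<in> Nb u} = Nb u" using sat by auto
    then show "N1 \<le> card {x \<in> S. x \<in> Nb u}" using N1(1) u by simp
  qed
  also have "\<dots> = (\<Sum>x\<in>S. card {u \<in> U - W. x \<in> Nb u})"
    by (rule sum_card_swap) (use fin finS in auto)
  also have "\<dots> \<le> (\<Sum>x\<in>S. N2)"
  proof (rule sum_mono)
    fix x
    have "card {u \<in> U - W. x \<in> Nb u} \<le> card {u \<in> U. x \<in> Nb u}" by (rule card_mono) (use fin in auto)
    then show "card {u \<in> U - W. x \<in> Nb u} \<le> N2" using N2(1)[of x] by simp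
  qed
  also have "\<dots> \<le> card S * (F * N1)" using N2(2) by simp
  also have "\<dots> = (\<Sum>x\<in>S. card {u \<in> W. g u = x}) * N1" by (simp add: S_def)
  also have "\<dots> \<le> card W * N1" using sum_card_fibres[OF finW] by (intro mult_right_mono) auto
  finally have "card (U - W) \<le> card W" using N1(2) by simp
  then show thesis using W that by blast
qed

text \<open>Every round halves the number of unserved elements and adds a load of at most
  \<open>F\<close>. The factor t lost against an ideal assignment is harmless: it will be about m,
  which costs log m bits in a fibre.\<close>

lemma assignment:
  assumes "finite U" "\<And>u. u \<in> U \<Longrightarrow> finite (Nb u)"
    "\<And>u. u \<in> U \<Longrightarrow> N1 \<le> card (Nb u)" "N1 > 0"
    "\<And>x. card {u \<in> U. x \<in> Nb u} \<le> N2" "N2 \<le> F * N1" "card U < 2 ^ t"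
  shows "\<exists>f. (\<forall>u\<in>U. f u \<in> Nb u) \<and> (\<forall>x. card {u \<in> U. f u = x} \<le> t * F)"
  using assms
proof (induction t arbitrary: U)
  case 0
  then show ?case by auto
next
  case (Suc t)
  obtain W g where W: "W \<subseteq> U" "\<And>u. u \<in> W \<Longrightarrow> g u \<in> Nb u" "\<And>x. card {u \<in> W. g u = x} \<le> F"
    "card (U - W) \<le> card W"
    using assignment_half[of U Nb N1 N2 F] Suc.prems by blast
  have finW: "finite W" using W(1) Suc.prems(1) finite_subset by blast
  have "card U = card (U - W) + card W"
    using W(1) finW Suc.prems(1) by (metis card_Diff_subset card_mono le_add_diff_inverse2)
  then have "card (U - W) < 2 ^ t" using Suc.prems(7) W(4) by simp
  moreover have "card {u \<in> U - W. x \<in> Nb u} \<le> N2" for x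
  proof (rule order.trans[OF _ Suc.prems(5)])
    show "card {u \<in> U - W. x \<in> Nb u} \<le> card {u \<in> U. x \<in> Nb u}"
      by (rule card_mono) (use Suc.prems(1) in auto)
  qed
  ultimately have "\<exists>f. (\<forall>u\<in>U - W. f u \<in> Nb u) \<and> (\<forall>x. card {u \<in> U - W. f u = x} \<le> t * F)"
    by (intro Suc.IH) (use Suc.prems in simp_all)
  then obtain f where f: "\<And>u. u \<in> U - W \<Longrightarrow> f u \<in> Nb u" "\<And>x. card {u \<in> U - W. f u = x} \<le> t * F"
    by blast
  let ?f = "\<lambda>u. if u \<in> W then g u else f u"
  have "card {u \<in> U. ?f u = x} \<le> Suc t * F" for x
  proof -
    have "{u \<in> U. ?f u = x} = {u \<in> U - W. f u = x} \<union> {u \<in> W. g u = x}" using W(1) by auto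
    then have "card {u \<in> U. ?f u = x} \<le> card {u \<in> U - W. f u = x} + card {u \<in> W. g u = x}"
      using card_Un_le by metis
    then show ?thesis using f(2)[of x] W(3)[of x] by simp
  qed
  then show ?case using f(1) W(2) by (intro exI[of _ ?f]) auto
qed

section \<open>Thinning maps with small fibres, and covering codes\<close>

lemma card_supersets:
  assumes "A \<subseteq> {..<m}" "card A = k" "k \<le> l"
  shows "card {B. B \<subseteq> {..<m} \<and> card B = l \<and> A \<subseteq> B} = (m - k) choose (l - k)"
proof -
  have finA: "finite A" using assms(1) finite_subset by blast
  have "bij_betw (\<lambda>B. B - A) {B. B \<subseteq> {..<m} \<and> card B = l \<and> A \<subseteq> B} {C. C \<subseteq> {..<m} - A \<and> card C = l - k}"
  proof (rule bij_betw_byWitness[where f' = "\<lambda>C. C \<union> A"])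
    show "(\<lambda>B. B - A) ` {B. B \<subseteq> {..<m} \<and> card B = l \<and> A \<subseteq> B} \<subseteq> {C. C \<subseteq> {..<m} - A \<and> card C = l - k}"
      using assms finA by (auto simp: card_Diff_subset)
    show "(\<lambda>C. C \<union> A) ` {C. C \<subseteq> {..<m} - A \<and> card C = l - k} \<subseteq> {B. B \<subseteq> {..<m} \<and> card B = l \<and> A \<subseteq> B}"
    proof -
      have "card (C \<union> A) = l" if "C \<subseteq> {..<m} - A" "card C = l - k" for C
      proof -
        have "finite C" using that(1) finite_subset by blast
        then have "card (C \<union> A) = card C + card A" using that(1) finA by (intro card_Un_disjoint) auto
        then show ?thesis using that(2) assms by simp
      qed
      then show ?thesis using assms(1) by auto
    qed
  qed auto
  then have "card {B. B \<subseteq> {..<m} \<and> card B = l \<and> A \<subseteq> B} = card {C. C \<subseteq> {..<m} - A \<and> card C = l - k}"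
    by (rule bij_betw_same_card)
  also have "\<dots> = (m - k) choose (l - k)"
    using n_subsets[of "{..<m} - A" "l - k"] assms finA by (simp add: card_Diff_subset)
  finally show ?thesis .
qed

lemma choose_le_pow: "m choose l \<le> 2 ^ m"
proof (cases "l \<le> m")
  case True
  then show ?thesis using member_le_sum[of l "{..m}" "\<lambda>k. m choose k"] by (simp add: choose_row_sum)
qed (simp add: binomial_eq_0)

lemma choose_le_pow_real: "real (m choose l) \<le> 2 ^ m"
  by (metis choose_le_pow of_nat_le_iff of_nat_numeral of_nat_power)

text \<open>The ideal fibre size is at most 2^m / (m choose k). The factor 2 rounds the load of one
  round up to an integer, and m + 1 is the number of rounds of \<open>assignment\<close>, since
  there are at most 2^m sets to serve.\<close>

abbreviation thin_load :: "nat \<Rightarrow> nat \<Rightarrow> real" where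
  "thin_load m k \<equiv> (real m + 1) * (2 * 2 ^ m / real (m choose k))"

text \<open>Inclusion between l-sets and k-sets is a biregular graph with degrees
  \<open>l choose k\<close> and \<open>(m - k) choose (l - k)\<close>. Counting its edges twice
  shows that the quotient of the degrees is (m choose l) / (m choose k), and
  \<open>assignment\<close> applies with this load.\<close>

lemma thin_level:
  assumes "k \<le> l" "l \<le> m"
  shows "\<exists>f. (\<forall>B. B \<subseteq> {..<m} \<and> card B = l \<longrightarrow> f B \<subseteq> B \<and> card (f B) = k) \<and>
    (\<forall>A. real (card {B. B \<subseteq> {..<m} \<and> card B = l \<and> f B = A}) \<le> thin_load m k)"
proof -
  define U where "U = {B. B \<subseteq> {..<m} \<and> card B = l}"
  define N1 N2 F where "N1 = l choose k" and "N2 = (m - k) choose (l - k)" and "F = nat \<lceil>real N2 / real N1\<rceil>"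
  have N1: "N1 > 0" using assms by (simp add: N1_def)
  have ck: "(m choose k) > 0" using assms by simp
  have finU: "finite U" unfolding U_def by simp
  have cU: "card U = m choose l" unfolding U_def using n_subsets[of "{..<m}" l] by simp
  have "card U < 2 ^ Suc m"
    using choose_le_pow unfolding cU by (rule le_less_trans) simp
  have F: "real N2 \<le> real F * real N1"
  proof -
    have "real N2 / real N1 \<le> real F" unfolding F_def by (rule real_nat_ceiling_ge)
    then show ?thesis using N1 by (simp add: field_simps)
  qed
  then have F': "N2 \<le> F * N1" by (metis of_nat_le_iff of_nat_mult)
  have "card {B \<in> U. x \<in> {A. A \<subseteq> B \<and> card A = k}} \<le> N2" for x
  proof (cases "x \<subseteq> {..<m} \<and> card x = k")
    case True
    then have "{B \<in> U. x \<in> {A. A \<subseteq> B \<and> card A = k}} = {B. B \<subseteq> {..<m} \<and> card B = l \<and> x \<subseteq> B}"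
      unfolding U_def by auto
    then show ?thesis using card_supersets[of x m k l] True assms by (simp add: N2_def)
  next
    case False
    then have "{B \<in> U. x \<in> {A. A \<subseteq> B \<and> card A = k}} = {}" unfolding U_def by auto
    then show ?thesis by (simp only: card.empty)
  qed
  moreover have "N1 \<le> card {A. A \<subseteq> B \<and> card A = k}" "finite {A. A \<subseteq> B \<and> card A = k}" if "B \<in> U" for B
  proof -
    have "finite B" using that finite_subset unfolding U_def by blast
    then show "N1 \<le> card {A. A \<subseteq> B \<and> card A = k}" "finite {A. A \<subseteq> B \<and> card A = k}"
      using n_subsets[of B k] that unfolding U_def N1_def by auto
  qed
  ultimately obtain f where f: "\<And>B. B \<in> U \<Longrightarrow> f B \<in> {A. A \<subseteq> B \<and> card A = k}"
    "\<And>A. card {B \<in> U. f B = A} \<le> Suc m * F"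
    using assignment[OF finU, of "\<lambda>B. {A. A \<subseteq> B \<and> card A = k}" N1 N2 F "Suc m"] N1 F' \<open>card U < 2 ^ Suc m\<close> by blast
  have "(m choose k) * N2 = (m choose l) * N1"
    unfolding N1_def N2_def using choose_mult[OF assms] by simp
  then have "real (m choose k) * real N2 = real (m choose l) * real N1"
    by (simp only: of_nat_mult [symmetric])
  then have "real N2 / real N1 = real (m choose l) / real (m choose k)"
    using N1 ck by (simp add: frac_eq_eq mult.commute)
  also have "\<dots> \<le> 2 ^ m / real (m choose k)"
    by (rule divide_right_mono[OF choose_le_pow_real]) simp
  finally have "real F \<le> 2 ^ m / real (m choose k) + 1"
    unfolding F_def by (intro order.trans[OF nat_ceiling_le]) simp_all
  moreover have "1 \<le> 2 ^ m / real (m choose k)"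
    using ck choose_le_pow_real[of m k] by (simp add: field_simps)
  ultimately have FF: "real F \<le> 2 * 2 ^ m / real (m choose k)" by simp
  have "real (card {B. B \<subseteq> {..<m} \<and> card B = l \<and> f B = A}) \<le> thin_load m k" for A
  proof -
    have "{B. B \<subseteq> {..<m} \<and> card B = l \<and> f B = A} = {B \<in> U. f B = A}" unfolding U_def by auto
    then have "real (card {B. B \<subseteq> {..<m} \<and> card B = l \<and> f B = A}) \<le> real (Suc m * F)"
      using f(2)[of A] by (simp only: of_nat_le_iff)
    also have "\<dots> = (real m + 1) * real F" by (simp add: algebra_simps)
    also have "\<dots> \<le> thin_load m k" using FF by (intro mult_left_mono) auto
    finally show ?thesis .
  qed
  moreover have "\<forall>B. B \<subseteq> {..<m} \<and> card B = l \<longrightarrow> f B \<subseteq> B \<and> card (f B) = k"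
    using f(1) unfolding U_def by auto
  ultimately show ?thesis by blast
qed

text \<open>By averaging, some x covers at least the fraction V / card S of the points still
  uncovered. Choosing such an x in each step shrinks the uncovered set geometrically.\<close>

lemma greedy_cover:
  assumes "finite S" "S \<noteq> {}" and V: "\<And>y. y \<in> S \<Longrightarrow> V \<le> card {x \<in> S. R x y}"
  shows "\<exists>C\<subseteq>S. card C \<le> t \<and>
    real (card {y \<in> S. \<forall>x\<in>C. \<not> R x y}) \<le> real (card S) * (1 - real V / real (card S)) ^ t"
proof (induction t)
  case 0
  have "{y \<in> S. \<forall>x\<in>{}. \<not> R x y} = S" by auto
  then show ?case by (intro exI[of _ "{}"]) auto
next
  case (Suc t)
  then obtain C where C: "C \<subseteq> S" "card C \<le> t"
    "real (card {y \<in> S. \<forall>x\<in>C. \<not> R x y}) \<le> real (card S) * (1 - real V / real (card S)) ^ t" by blast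
  define Unc where "Unc = {y \<in> S. \<forall>x\<in>C. \<not> R x y}"
  have N: "card S > 0" using assms by (simp add: card_gt_0_iff)
  have finUn: "finite Unc" unfolding Unc_def using assms by simp
  have "\<exists>x\<in>S. V * card Unc \<le> card S * card {y \<in> Unc. R x y}"
  proof (rule ccontr)
    assume "\<not> ?thesis"
    then have "\<And>x. x \<in> S \<Longrightarrow> card S * card {y \<in> Unc. R x y} < V * card Unc" by auto
    then have "(\<Sum>x\<in>S. card S * card {y \<in> Unc. R x y}) < (\<Sum>x\<in>S. V * card Unc)"
      using assms by (intro sum_strict_mono) auto
    then have "(\<Sum>x\<in>S. card {y \<in> Unc. R x y}) < V * card Unc" using N by (simp flip: sum_distrib_left)
    also have "\<dots> = (\<Sum>y\<in>Unc. V)" by simp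
    also have "\<dots> \<le> (\<Sum>y\<in>Unc. card {x \<in> S. R x y})" using V unfolding Unc_def by (intro sum_mono) auto
    also have "\<dots> = (\<Sum>x\<in>S. card {y \<in> Unc. R x y})"
      by (rule sum_card_swap[symmetric]) (use assms finUn in auto)
    finally show False by simp
  qed
  then obtain x where x: "x \<in> S" "V * card Unc \<le> card S * card {y \<in> Unc. R x y}" by blast
  have "real V * real (card Unc) \<le> real (card S) * real (card {y \<in> Unc. R x y})"
    using x(2) by (metis of_nat_le_iff of_nat_mult)
  then have 1: "real V / real (card S) * real (card Unc) \<le> real (card {y \<in> Unc. R x y})"
    using N by (simp add: field_simps)
  have "{y \<in> S. \<forall>x\<in>insert x C. \<not> R x y} = Unc - {y \<in> Unc. R x y}" unfolding Unc_def by auto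
  then have "real (card {y \<in> S. \<forall>x\<in>insert x C. \<not> R x y}) = real (card Unc) - real (card {y \<in> Unc. R x y})"
    using finUn by (simp add: card_Diff_subset of_nat_diff card_mono)
  also have "\<dots> \<le> (1 - real V / real (card S)) * real (card Unc)" using 1 by (simp add: algebra_simps)
  also have "\<dots> \<le> (1 - real V / real (card S)) * (real (card S) * (1 - real V / real (card S)) ^ t)"
  proof (rule mult_left_mono)
    show "real (card Unc) \<le> real (card S) * (1 - real V / real (card S)) ^ t" using C(3) unfolding Unc_def .
    obtain y where "y \<in> S" using assms by blast
    then have "V \<le> card S" using V[of y] card_mono[OF assms(1), of "{x \<in> S. R x y}"] by auto
    then show "0 \<le> 1 - real V / real (card S)" using N by (simp add: field_simps)
  qed
  finally have "real (card {y \<in> S. \<forall>x\<in>insert x C. \<not> R x y}) \<le> real (card S) * (1 - real V / real (card S)) ^ Suc t"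
    by (simp add: algebra_simps)
  moreover have "card (insert x C) \<le> Suc t" using C(2) by (metis card_insert_le_m1 diff_Suc_1 le_Suc_eq zero_less_Suc)
  ultimately show ?case using C(1) x(1) by (intro exI[of _ "insert x C"]) blast
qed

text \<open>After t \<ge> m 2^m / (m choose k) greedy steps fewer than 2^m e^(-m) < 1 points, hence
  none, are uncovered. Spheres are used in place of balls: rounding to the code then moves every
  word by exactly k, which bounds both the fibres and the distance from y.\<close>

lemma cover_exists:
  assumes "m > 0" "k \<le> m"
  shows "\<exists>C\<subseteq>bs m. C \<noteq> {} \<and> real (card C) \<le> 2 ^ m / real (m choose k) * real m + 1 \<and>
     (\<forall>y\<in>bs m. \<exists>x\<in>C. ham x y = k)"
proof -
  have ck: "(m choose k) > 0" using assms by simp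
  define t where "t = nat \<lceil>2 ^ m / real (m choose k) * real m\<rceil>"
  have t: "2 ^ m / real (m choose k) * real m \<le> real t" unfolding t_def by (rule real_nat_ceiling_ge)
  have hc: "ham x y = ham y x" if "x \<in> bs m" "y \<in> bs m" for x y
  proof -
    have "{i. i < length x \<and> x ! i \<noteq> y ! i} = {i. i < length y \<and> y ! i \<noteq> x ! i}" using that by auto
    then show ?thesis by (simp add: ham_def)
  qed
  have "(m choose k) \<le> card {x \<in> bs m. ham x y = k}" if "y \<in> bs m" for y
  proof -
    have "{x \<in> bs m. ham x y = k} = {z \<in> bs m. ham y z = k}" using hc[OF _ that] by auto
    then show ?thesis using card_sphere[of y m k] that by simp
  qed
  moreover have "bs m \<noteq> {}" by (metis (mono_tags) empty_iff length_replicate mem_Collect_eq)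
  ultimately obtain C where C: "C \<subseteq> bs m" "card C \<le> t"
    "real (card {y \<in> bs m. \<forall>x\<in>C. ham x y \<noteq> k}) \<le> 2 ^ m * (1 - real (m choose k) / 2 ^ m) ^ t"
    using greedy_cover[of "bs m" "m choose k" "\<lambda>x y. ham x y = k" t] by auto
  have "1 - real (m choose k) / 2 ^ m \<ge> 0"
    using choose_le_pow_real[of m k] by simp
  then have "(1 - real (m choose k) / 2 ^ m) ^ t \<le> exp (- (real (m choose k) / 2 ^ m)) ^ t"
    by (intro power_mono) (use exp_ge_add_one_self[of "- (real (m choose k) / 2 ^ m)"] in auto)
  also have "\<dots> = exp (- (real (m choose k) / 2 ^ m) * real t)" by (simp add: exp_of_nat_mult[symmetric] mult.commute)
  also have "\<dots> \<le> exp (- real m)"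
  proof -
    have "real m \<le> real (m choose k) / 2 ^ m * real t"
      using t ck by (simp add: field_simps)
    then show ?thesis by simp
  qed
  finally have "real (card {y \<in> bs m. \<forall>x\<in>C. ham x y \<noteq> k}) \<le> 2 ^ m * exp (- real m)"
    using C(3) by (smt (verit) mult_left_mono zero_le_power)
  also have "\<dots> = (2 / exp 1) ^ m" by (simp add: exp_minus field_simps power_divide exp_of_nat_mult[symmetric])
  also have "\<dots> < 1"
  proof -
    have "exp (ln 2) < exp (1::real)" using ln_2_less_1 by (simp only: exp_less_cancel_iff)
    then have "2 / exp 1 < (1::real)" by simp
    then show ?thesis using assms(1) by (simp add: power_less_one_iff)
  qed
  finally have "card {y \<in> bs m. \<forall>x\<in>C. ham x y \<noteq> k} = 0" by simp
  then have "{y \<in> bs m. \<forall>x\<in>C. ham x y \<noteq> k} = {}" by (subst (asm) card_0_eq) auto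
  then have cov: "\<forall>y\<in>bs m. \<exists>x\<in>C. ham x y = k" by blast
  then have "C \<noteq> {}" using \<open>bs m \<noteq> {}\<close> by blast
  moreover have "real (card C) \<le> 2 ^ m / real (m choose k) * real m + 1"
  proof -
    have "real (card C) \<le> real t" using C(2) by simp
    also have "\<dots> \<le> 2 ^ m / real (m choose k) * real m + 1"
      unfolding t_def by (rule nat_ceiling_le) simp
    finally show ?thesis .
  qed
  ultimately show ?thesis using C(1) cov by blast
qed

section \<open>Entropy and prefix codes\<close>

text \<open>This is log 2 (cosh (b ln 2 / 2)), an even function vanishing to second order at 0.
  Equivalently, \<open>phi b\<close> + 1 is the maximum over p of Hb p + b (p - 1/2), the least
  constant in an affine bound of slope -b for the entropy around 1/2.\<close>

definition phi :: "real \<Rightarrow> real" where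
  "phi b = log 2 (1 + 2 powr b) - b / 2 - 1"

lemma phi_nonneg: "0 \<le> phi b"
proof -
  have "0 \<le> (1 - 2 powr (b / 2))\<^sup>2" by simp
  also have "\<dots> = 1 + 2 powr b - 2 * 2 powr (b / 2)"
    by (simp add: power2_eq_square algebra_simps flip: powr_add)
  finally have "2 powr (1 + b / 2) \<le> 1 + 2 powr b" by (simp add: powr_add)
  then have "log 2 (2 powr (1 + b / 2)) \<le> log 2 (1 + 2 powr b)" by (subst log_le_cancel_iff) (auto simp: add_pos_pos)
  then show ?thesis by (simp add: phi_def)
qed

lemma phi_small: "((\<lambda>b. phi b / b) \<longlongrightarrow> 0) (at_right 0)"
  unfolding phi_def by real_asymp

lemma log_le_linear: "\<delta> > 0 \<Longrightarrow> \<exists>N. \<forall>m\<ge>N. C + 4 * log 2 (real m + 1) \<le> \<delta> * real m"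
proof -
  assume "\<delta> > 0"
  then have "eventually (\<lambda>m. C + 4 * log 2 (real m + 1) \<le> \<delta> * real m) sequentially" by real_asymp
  then show ?thesis by (simp add: eventually_sequentially)
qed

lemma Hb_deriv:
  assumes "0 < p" "p < 1"
  shows "DERIV Hb p :> log 2 ((1 - p) / p)"
proof -
  have "((\<lambda>p. - p * log 2 p - (1 - p) * log 2 (1 - p)) has_real_derivative
     (- log 2 p - p * (1 / (ln 2 * p)) - (- log 2 (1 - p) + (1 - p) * (- 1 / (ln 2 * (1 - p)))))) (at p)"
    using assms by (auto intro!: derivative_eq_intros simp: log_def divide_simps)
  moreover have "- log 2 p - p * (1 / (ln 2 * p)) - (- log 2 (1 - p) + (1 - p) * (- 1 / (ln 2 * (1 - p)))) =
      log 2 ((1 - p) / p)"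
    using assms by (simp add: log_divide)
  moreover have "Hb = (\<lambda>p. - p * log 2 p - (1 - p) * log 2 (1 - p))" by (simp add: Hb_def fun_eq_iff)
  ultimately show ?thesis by simp
qed

lemma Hb_0 [simp]: "Hb 0 = 0" by (simp add: Hb_def)

lemma Hb_half [simp]: "Hb (1 / 2) = 1" by (simp add: Hb_def log_divide)

lemma Hb_cont: "continuous_on {0..1/2} Hb"
  unfolding continuous_on_eq_continuous_within
proof
  fix x :: real assume x: "x \<in> {0..1/2}"
  show "continuous (at x within {0..1/2}) Hb"
  proof (cases "x = 0")
    case True
    have "(Hb \<longlongrightarrow> 0) (at_right 0)" unfolding Hb_def by real_asymp
    then show ?thesis using True by (simp add: continuous_within at_within_Icc_at_right)
  next
    case False
    then show ?thesis using x Hb_deriv[of x] by (auto intro!: continuous_at_imp_continuous_at_within DERIV_isCont)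
  qed
qed

lemma Hb_strict_mono:
  assumes "0 \<le> x" "x < y" "y \<le> 1/2" shows "Hb x < Hb y"
  using assms(2)
proof (rule DERIV_pos_imp_increasing_open)
  fix p assume "x < p" "p < y"
  then show "\<exists>D. DERIV Hb p :> D \<and> 0 < D"
    using Hb_deriv[of p] assms by (intro exI[of _ "log 2 ((1 - p) / p)"]) (simp add: field_simps)
next
  show "continuous_on {x..y} Hb" using assms by (intro continuous_on_subset[OF Hb_cont]) auto
qed

lemma Hinv_props:
  assumes "0 \<le> y" "y \<le> 1"
  shows "0 \<le> Hinv y" "Hinv y \<le> 1/2" "Hb (Hinv y) = y"
proof -
  have "\<exists>x\<ge>0. x \<le> 1/2 \<and> Hb x = y" using assms Hb_cont by (intro IVT') auto
  then obtain x where x: "0 \<le> x" "x \<le> 1/2" "Hb x = y" by blast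
  have uniq: "x' = x" if "0 \<le> x' \<and> x' \<le> 1/2 \<and> Hb x' = y" for x'
  proof (rule ccontr)
    assume "x' \<noteq> x"
    then consider "x' < x" | "x < x'" by linarith
    then show False
    proof cases
      case 1
      then have "Hb x' < Hb x" using that x(2) by (intro Hb_strict_mono) simp_all
      then show False using that x(3) by simp
    next
      case 2
      then have "Hb x < Hb x'" using that x(1) by (intro Hb_strict_mono) simp_all
      then show False using that x(3) by simp
    qed
  qed
  have "Hinv y = x" unfolding Hinv_def by (rule the_equality[OF _ uniq]) (use x in simp)
  then show "0 \<le> Hinv y" "Hinv y \<le> 1/2" "Hb (Hinv y) = y" using x by simp_all
qed

lemma binomial_term_le:
  assumes "0 \<le> (x::real)" "l \<le> m" shows "real (m choose l) * x ^ l \<le> (1 + x) ^ m"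
proof -
  have "(1 + x) ^ m = (\<Sum>k\<le>m. real (m choose k) * x ^ k)"
    using binomial_ring[of x 1 m] by (simp add: add.commute)
  then show ?thesis
    using member_le_sum[of l "{..m}" "\<lambda>k. real (m choose k) * x ^ k"] assms by simp
qed

lemma log_choose_le: assumes "l \<le> m" shows "log 2 (real (m choose l)) \<le> real m"
proof -
  have "log 2 (real (m choose l)) \<le> log 2 (2 ^ m)"
    using assms choose_le_pow_real by (subst log_le_cancel_iff) auto
  then show ?thesis by (simp add: log_nat_power)
qed

text \<open>A single term of the binomial expansion of (1 + 2^b)^m is at most the whole; the second
  bound is the first for m - l ones. For b > 0 they say that words with too many, or too few, ones
  compared with m/2 have short codes.\<close>

lemma log_choose_phi:
  assumes "l \<le> m"
  shows "log 2 (real (m choose l)) \<le> real m * (1 + phi b) - b * (real l - real m / 2)"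
    and "log 2 (real (m choose l)) \<le> real m * (1 + phi b) + b * (real l - real m / 2)"
proof -
  have *: "log 2 (real (m choose l)) \<le> real m * log 2 (1 + 2 powr b) - b * real l" if "l \<le> m" for l
  proof -
    have pos: "0 < real (m choose l) * (2 powr b) ^ l" using that by simp
    have "log 2 (real (m choose l) * (2 powr b) ^ l) \<le> log 2 ((1 + 2 powr b) ^ m)"
      using binomial_term_le[of "2 powr b" l m] that pos
      by (subst log_le_cancel_iff) (auto intro!: zero_less_power add_pos_pos)
    moreover have "log 2 (real (m choose l) * (2 powr b) ^ l) = log 2 (real (m choose l)) + real l * b"
      using that by (simp add: log_mult log_nat_power)
    moreover have "log 2 ((1 + 2 powr b) ^ m) = real m * log 2 (1 + 2 powr b)"
      by (rule log_nat_power) (simp add: add_pos_pos)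
    ultimately show ?thesis by (simp add: mult.commute)
  qed
  show "log 2 (real (m choose l)) \<le> real m * (1 + phi b) - b * (real l - real m / 2)"
    using *[OF assms] by (simp add: phi_def algebra_simps)
  show "log 2 (real (m choose l)) \<le> real m * (1 + phi b) + b * (real l - real m / 2)"
    using *[of "m - l"] assms by (simp add: phi_def algebra_simps of_nat_diff flip: binomial_symmetric)
qed

lemma log_0: "log b 0 = 0" by (simp add: log_def)

text \<open>The derivative of \<open>Hb\<close> at q for 0 < q < 1. At q = 0 the conventions for
  division and logarithm give the value 0, so that the estimates at the mode also make sense
  there.\<close>

definition slope :: "real \<Rightarrow> real" where "slope q = log 2 ((1 - q) / q)"

lemma slope_nonneg: "0 \<le> q \<Longrightarrow> q \<le> 1/2 \<Longrightarrow> 0 \<le> slope q"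
  by (cases "q = 0") (auto simp: slope_def log_0 field_simps)

lemma slope_pos: "0 < q \<Longrightarrow> q < 1/2 \<Longrightarrow> 0 < slope q"
  by (simp add: slope_def field_simps)

text \<open>The negative logarithm of the Bernoulli weight of a word is affine in its number l of
  ones; as a function of l it is the tangent to the entropy at l = m q.\<close>

lemma log_bernoulli:
  assumes "0 < q" "q < 1" "l \<le> m"
  shows "log 2 (q ^ l * (1 - q) ^ (m - l)) = - (real m * Hb q + (real l - real m * q) * slope q)"
proof -
  have "log 2 (q ^ l * (1 - q) ^ (m - l)) = real l * log 2 q + (real m - real l) * log 2 (1 - q)"
    using assms by (simp add: log_mult log_nat_power of_nat_diff)
  also have "\<dots> = - (real m * Hb q + (real l - real m * q) * slope q)"
    using assms by (simp add: Hb_def slope_def log_divide algebra_simps)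
  finally show ?thesis .
qed

text \<open>The words with l ones have total Bernoulli weight at most 1, so by
  \<open>log_bernoulli\<close> their number lies below the tangent of the entropy at q.\<close>

lemma log_choose_entropy:
  assumes "0 < q" "q < 1" "l \<le> m"
  shows "log 2 (real (m choose l)) \<le> real m * Hb q + (real l - real m * q) * slope q"
proof -
  have "(\<Sum>k\<le>m. real (m choose k) * q ^ k * (1 - q) ^ (m - k)) = 1"
    using binomial_ring[of q "1 - q" m] by simp
  then have le: "real (m choose l) * (q ^ l * (1 - q) ^ (m - l)) \<le> 1"
    using member_le_sum[of l "{..m}" "\<lambda>k. real (m choose k) * q ^ k * (1 - q) ^ (m - k)"] assms
    by (simp add: mult.assoc)
  have "log 2 (real (m choose l) * (q ^ l * (1 - q) ^ (m - l))) \<le> log 2 1"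
    by (subst log_le_cancel_iff) (use le assms in auto)
  moreover have "log 2 (real (m choose l) * (q ^ l * (1 - q) ^ (m - l))) =
      log 2 (real (m choose l)) + log 2 (q ^ l * (1 - q) ^ (m - l))"
    using assms by (subst log_mult) auto
  ultimately show ?thesis using log_bernoulli[OF assms] by simp
qed

definition mode :: "nat \<Rightarrow> real \<Rightarrow> nat" where "mode m q = nat \<lfloor>(real m + 1) * q\<rfloor>"

lemma mode_bounds:
  assumes "0 \<le> q" "q \<le> 1/2"
  shows "real (mode m q) \<le> (real m + 1) * q" "(real m + 1) * q < real (mode m q) + 1" "mode m q \<le> m"
    "real (mode m q) \<le> real m * q + 1" "real m * q - 1 \<le> real (mode m q)"
proof -
  have nn: "0 \<le> (real m + 1) * q" using assms by simp
  show 1: "real (mode m q) \<le> (real m + 1) * q" unfolding mode_def using nn by simp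
  show 2: "(real m + 1) * q < real (mode m q) + 1" unfolding mode_def using nn by linarith
  have "(real m + 1) * q \<le> (real m + 1) * (1/2)" using assms by (intro mult_left_mono) auto
  then have "(real m + 1) * q \<le> real m / 2 + 1 / 2" by (simp add: algebra_simps)
  then have "real (mode m q) < real m + 1" using 1 by linarith
  then show "mode m q \<le> m" by linarith
  show "real (mode m q) \<le> real m * q + 1" using 1 assms by (simp add: algebra_simps)
  show "real m * q - 1 \<le> real (mode m q)" using 2 assms by (simp add: algebra_simps)
qed

text \<open>The quotient of consecutive binomial probabilities, (m - l) q / ((l + 1) (1 - q)),
  passes 1 at l + 1 = (m + 1) q, so the term at \<open>mode m q\<close> is the largest. The m + 1
  terms add up to 1.\<close>

lemma binomial_mode:
  assumes "0 < q" "q \<le> 1/2"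
  shows "1 \<le> (real m + 1) * (real (m choose mode m q) * (q ^ mode m q * (1 - q) ^ (m - mode m q)))"
proof -
  define T where "T l = real (m choose l) * (q ^ l * (1 - q) ^ (m - l))" for l
  let ?k = "mode m q"
  note k = mode_bounds[of q m]
  have step: "T (Suc l) * ((real l + 1) * (1 - q)) = T l * ((real m - real l) * q)" if "l < m" for l
  proof -
    have "(m choose Suc l) * Suc l = (m choose l) * (m - l)" 
      using binomial_absorb_comp[of m l] binomial_absorption[of l "m - 1"] that
      by (metis Suc_diff_1 Suc_times_binomial_eq binomial_absorption gr_implies_not0 mult.commute not_gr_zero)
    then have "real (m choose Suc l) * (real l + 1) = real (m choose l) * (real m - real l)"
      using that by (metis Suc_eq_plus1 less_imp_le of_nat_1 of_nat_add of_nat_diff of_nat_mult)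
    moreover have "(1 - q) ^ (m - l) = (1 - q) ^ (m - Suc l) * (1 - q)"
      using that by (metis Suc_diff_Suc power_Suc2)
    moreover have "T (Suc l) * ((real l + 1) * (1 - q)) =
        (real (m choose Suc l) * (real l + 1)) * (q ^ Suc l * ((1 - q) ^ (m - Suc l) * (1 - q)))"
      unfolding T_def by (simp only: mult_ac)
    ultimately show ?thesis unfolding T_def by (simp add: mult_ac)
  qed
  have T0: "0 \<le> T l" for l unfolding T_def using assms by simp
  have fac: "0 < (real l + 1) * (1 - q)" for l using assms by simp
  have up: "T l \<le> T (Suc l)" if "Suc l \<le> ?k" for l
  proof -
    have "l < m" using that k(3) assms by simp
    have "real l + 1 \<le> (real m + 1) * q" using that k(1) assms by linarith
    then have "(real l + 1) * (1 - q) \<le> (real m - real l) * q" by (simp add: algebra_simps)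
    then have "T l * ((real l + 1) * (1 - q)) \<le> T l * ((real m - real l) * q)" using T0 by (intro mult_left_mono)
    also have "\<dots> = T (Suc l) * ((real l + 1) * (1 - q))" using step[OF \<open>l < m\<close>] by simp
    finally show ?thesis using fac[of l] by (rule mult_right_le_imp_le)
  qed
  have down: "T (Suc l) \<le> T l" if "?k \<le> l" "l < m" for l
  proof -
    have "(real m + 1) * q \<le> real l + 1" using that(1) k(2) assms by linarith
    then have "(real m - real l) * q \<le> (real l + 1) * (1 - q)" by (simp add: algebra_simps)
    then have "T l * ((real m - real l) * q) \<le> T l * ((real l + 1) * (1 - q))" using T0 by (intro mult_left_mono)
    then have "T (Suc l) * ((real l + 1) * (1 - q)) \<le> T l * ((real l + 1) * (1 - q))" using step[OF that(2)] by simp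
    then show ?thesis using fac[of l] by (rule mult_right_le_imp_le)
  qed
  have max: "T l \<le> T ?k" if "l \<le> m" for l
  proof (cases "l \<le> ?k")
    case True
    then show ?thesis
    proof (induction rule: inc_induct)
      case (step n)
      then show ?case using up[of n] by simp
    qed simp
  next
    case False
    then have "?k \<le> l" by simp
    then have "l \<le> m \<Longrightarrow> T l \<le> T ?k"
    proof (induction rule: dec_induct)
      case (step n)
      then show ?case using down[of n] by simp
    qed simp
    then show ?thesis using that by simp
  qed
  have "1 = (\<Sum>l\<le>m. T l)"
    using binomial_ring[of q "1 - q" m] unfolding T_def by (simp add: mult.assoc)
  also have "\<dots> \<le> (\<Sum>l\<le>m. T ?k)" using max by (intro sum_mono) auto
  also have "\<dots> = (real m + 1) * T ?k" by simp
  finally show ?thesis unfolding T_def .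
qed

text \<open>Keeping only the largest of m + 1 terms costs log 2 (m + 1), and \<open>slope q\<close>
  covers the rounding of m q, as the mode falls short of it by at most 1.\<close>

lemma log_choose_mode_ge:
  assumes "0 \<le> q" "q \<le> 1/2"
  shows "real m * Hb q - slope q - log 2 (real m + 1) \<le> log 2 (real (m choose mode m q))"
proof (cases "q = 0")
  case True
  then show ?thesis by (simp add: mode_def slope_def log_0)
next
  case False
  let ?k = "mode m q"
  note k = mode_bounds[OF assms, of m]
  have q: "0 < q" "q < 1" using False assms by auto
  define P where "P = q ^ ?k * (1 - q) ^ (m - ?k)"
  have P: "0 < P" unfolding P_def using q by simp
  have C: "0 < real (m choose ?k)" using k(3) by simp
  have "1 \<le> (real m + 1) * (real (m choose ?k) * P)"
    unfolding P_def using q assms(2) by (intro binomial_mode)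
  then have "log 2 1 \<le> log 2 ((real m + 1) * (real (m choose ?k) * P))"
    by (subst log_le_cancel_iff) auto
  also have "\<dots> = log 2 (real m + 1) + (log 2 (real (m choose ?k)) + log 2 P)"
    using P C by (simp add: log_mult)
  also have "log 2 P = - (real m * Hb q + (real ?k - real m * q) * slope q)"
    unfolding P_def by (rule log_bernoulli[OF q k(3)])
  finally have "real m * Hb q + (real ?k - real m * q) * slope q \<le> log 2 (real m + 1) + log 2 (real (m choose ?k))"
    by simp
  moreover have "(- 1) * slope q \<le> (real ?k - real m * q) * slope q"
    using k(5) slope_nonneg[OF assms] by (intro mult_right_mono) auto
  ultimately show ?thesis by simp
qed

lemma log_choose_below_mode:
  assumes "0 \<le> q" "q \<le> 1/2" "l \<le> mode m q"
  shows "log 2 (real (m choose l)) \<le> real m * Hb q + slope q"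
proof (cases "q = 0")
  case True
  then show ?thesis using assms(3) by (simp add: mode_def slope_def log_0)
next
  case False
  note k = mode_bounds[OF assms(1,2), of m]
  have "log 2 (real (m choose l)) \<le> real m * Hb q + (real l - real m * q) * slope q"
    using assms False k(3) by (intro log_choose_entropy) auto
  also have "(real l - real m * q) * slope q \<le> 1 * slope q"
    using k(4) assms(3) slope_nonneg[OF assms(1,2)] by (intro mult_right_mono) auto
  finally show ?thesis by simp
qed

section \<open>Codes for the fibres of a map and for classes of words\<close>

lemma fixed_code:
  assumes "finite S" "S \<noteq> {}"
  shows "\<exists>(c :: 'a \<Rightarrow> bool list) l. (\<forall>z\<in>S. length (c z) = l) \<and> inj_on c S \<and> real l \<le> log 2 (real (card S)) + 1"
proof -
  have N: "1 \<le> real (card S)" using assms by (simp add: Suc_le_eq card_gt_0_iff)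
  define l where "l = nat \<lceil>log 2 (real (card S))\<rceil>"
  have "log 2 (real (card S)) \<le> real l" unfolding l_def by (rule real_nat_ceiling_ge)
  then have "2 powr log 2 (real (card S)) \<le> 2 powr real l" by (subst powr_le_cancel_iff) auto
  then have "real (card S) \<le> real (2 ^ l)" using N by (simp add: powr_realpow)
  then have "card S \<le> card (bs l)" unfolding card_bs by (simp only: of_nat_le_iff)
  then obtain c where "c ` S \<subseteq> bs l" "inj_on c S" using card_le_inj[OF assms(1) finite_bs] by blast
  moreover have "real l \<le> log 2 (real (card S)) + 1"
    unfolding l_def by (rule nat_ceiling_le) (use N in simp)
  ultimately show ?thesis by (intro exI[of _ c] exI[of _ l]) auto
qed

text \<open>All code words of one fibre get the same length, so within a fibre comparable code words
  are equal. Nothing is claimed across fibres, because the value of f will be known to the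
  decoder.\<close>

lemma fibre_code:
  assumes "finite S"
  obtains c :: "'a \<Rightarrow> bool list" where
    "\<forall>z\<in>S. \<forall>z'\<in>S. f z = f z' \<longrightarrow> prefix (c z) (c z') \<longrightarrow> z = z'"
    "\<forall>z\<in>S. real (length (c z)) \<le> log 2 (real (card {z' \<in> S. f z' = f z})) + 1"
proof -
  have "\<forall>v\<in>f ` S. \<exists>(c :: 'a \<Rightarrow> bool list). \<exists>l. (\<forall>z\<in>{z \<in> S. f z = v}. length (c z) = l) \<and>
      inj_on c {z \<in> S. f z = v} \<and> real l \<le> log 2 (real (card {z \<in> S. f z = v})) + 1"
    using assms by (intro ballI fixed_code) auto
  from bchoice[OF this] obtain c where c: "\<And>v. v \<in> f ` S \<Longrightarrow> \<exists>l. (\<forall>z\<in>{z \<in> S. f z = v}. length (c v z :: bool list) = l) \<and>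
      inj_on (c v) {z \<in> S. f z = v} \<and> real l \<le> log 2 (real (card {z \<in> S. f z = v})) + 1"
    by blast
  show thesis
  proof (rule that[of "\<lambda>z. c (f z) z"]; intro ballI impI)
    fix z z' assume z: "z \<in> S" "z' \<in> S" "f z = f z'" "prefix (c (f z) z) (c (f z') z')"
    obtain l where l: "\<forall>x\<in>{x \<in> S. f x = f z}. length (c (f z) x) = l" "inj_on (c (f z)) {x \<in> S. f x = f z}"
      using c[OF imageI[OF z(1)]] by blast
    have "length (c (f z) z) = length (c (f z) z')" using l(1) z(1-3) by simp
    then have "c (f z) z = c (f z) z'" using z(3,4) by (auto simp: prefix_def)
    then show "z = z'" using l(2) z(1-3) by (auto dest: inj_onD)
  next
    fix z assume "z \<in> S"
    then show "real (length (c (f z) z)) \<le> log 2 (real (card {z' \<in> S. f z' = f z})) + 1"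
      using c[OF imageI[OF \<open>z \<in> S\<close>]] by auto
  qed
qed

text \<open>A two-part code: the index of the class, of fixed length, followed by the index within
  the class. The first part makes the code prefix-free on all of S, without side
  information.\<close>

lemma class_code:
  assumes "finite S" "\<And>z. z \<in> S \<Longrightarrow> g z < (M::nat)"
  obtains c :: "'a \<Rightarrow> bool list" where "\<forall>z\<in>S. \<forall>z'\<in>S. prefix (c z) (c z') \<longrightarrow> z = z'"
    "\<forall>z\<in>S. real (length (c z)) \<le> log 2 (real M) + log 2 (real (card {z' \<in> S. g z' = g z})) + 2"
proof (cases "M = 0")
  case True
  then have "S = {}" using assms(2) by auto
  then show thesis by (intro that) auto
next
  case False
  then obtain c0 :: "nat \<Rightarrow> bool list" and l where c0: "\<forall>v\<in>{..<M}. length (c0 v) = l" "inj_on c0 {..<M}"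
    "real l \<le> log 2 (real M) + 1"
    using fixed_code[of "{..<M}"] by auto
  obtain c :: "'a \<Rightarrow> bool list" where cc: "\<forall>z\<in>S. \<forall>z'\<in>S. g z = g z' \<longrightarrow> prefix (c z) (c z') \<longrightarrow> z = z'"
    "\<forall>z\<in>S. real (length (c z)) \<le> log 2 (real (card {z' \<in> S. g z' = g z})) + 1"
    by (rule fibre_code[OF assms(1)])
  note c = cc[rule_format]
  show thesis
  proof (rule that[of "\<lambda>z. c0 (g z) @ c z"]; intro ballI impI)
    fix z z' assume z: "z \<in> S" "z' \<in> S" "prefix (c0 (g z) @ c z) (c0 (g z') @ c z')"
    have "length (c0 (g z)) = length (c0 (g z'))" using c0(1) assms(2) z by auto
    then have "c0 (g z) = c0 (g z')" "prefix (c z) (c z')" using z(3) by (auto simp: prefix_def)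
    then show "z = z'" using c0(2) c(1) assms(2) z by (auto simp: inj_on_def)
  next
    fix z assume z: "z \<in> S"
    have "length (c0 (g z)) = l" using c0(1) assms(2) z by auto
    then show "real (length (c0 (g z) @ c z)) \<le> log 2 (real M) + log 2 (real (card {z' \<in> S. g z' = g z})) + 2"
      using c(2)[OF z] c0(3) by simp
  qed
qed

section \<open>Block maps\<close>

text \<open>Here \<open>x = f y\<close> is a block of \<open>X\<close> made from a block \<open>y\<close> of \<open>Y\<close>. The code \<open>c\<close> is used
  without side information: it is short on blocks of \<open>X\<close>, and for arbitrary \<open>z\<close> its length forces
  \<open>z\<close> to have Hamming distance at least about \<open>\<rho> m\<close> from \<open>x\<close> unless \<open>z\<close> is compressible. The code \<open>c'\<close>
  recovers \<open>y\<close> from \<open>x\<close>. The error \<open>phi \<beta>\<close> is \<open>o(\<beta>)\<close>.\<close>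

definition good_block ::
  "nat \<Rightarrow> real \<Rightarrow> real \<Rightarrow> real \<Rightarrow> real \<Rightarrow> (bool list \<Rightarrow> bool list) \<Rightarrow> (bool list \<Rightarrow> bool list) \<Rightarrow> (bool list \<Rightarrow> bool list) \<Rightarrow> bool" where
  "good_block m s \<rho> \<beta>0 \<delta> f c c' \<longleftrightarrow>
    (\<forall>y\<in>bs m. f y \<in> bs m) \<and>
    (\<forall>z\<in>bs m. \<forall>z'\<in>bs m. prefix (c z) (c z') \<longrightarrow> z = z') \<and>
    (\<forall>y\<in>bs m. \<forall>y'\<in>bs m. f y = f y' \<longrightarrow> prefix (c' y) (c' y') \<longrightarrow> y = y') \<and>
    (\<forall>y\<in>bs m. real (length (c (f y))) \<le> (s + \<delta>) * real m) \<and>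
    (\<forall>y\<in>bs m. real (length (c' y)) \<le> (1 - s + \<delta>) * real m) \<and>
    (\<forall>y\<in>bs m. \<forall>\<beta>. 0 < \<beta> \<longrightarrow> \<beta> \<le> \<beta>0 \<longrightarrow>
       real (length (c y)) \<le> real m * (1 + phi \<beta> + \<delta>) - \<beta> * (real (ham (f y) y) - \<rho> * real m)) \<and>
    (\<forall>y\<in>bs m. \<forall>z\<in>bs m. \<forall>\<beta>. 0 < \<beta> \<longrightarrow> \<beta> \<le> \<beta>0 \<longrightarrow>
       real (length (c z)) \<le> real m * (1 + phi \<beta> + \<delta>) + \<beta> * (real (ham (f y) z) - \<rho> * real m))"

lemma good_blockD:
  assumes "good_block m s \<rho> \<beta>0 \<delta> f c c'"
  shows "length y = m \<Longrightarrow> length (f y) = m"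
    and "length z = m \<Longrightarrow> length z' = m \<Longrightarrow> prefix (c z) (c z') \<Longrightarrow> z = z'"
    and "length y = m \<Longrightarrow> length y' = m \<Longrightarrow> f y = f y' \<Longrightarrow> prefix (c' y) (c' y') \<Longrightarrow> y = y'"
    and "length y = m \<Longrightarrow> real (length (c (f y))) \<le> (s + \<delta>) * real m"
    and "length y = m \<Longrightarrow> real (length (c' y)) \<le> (1 - s + \<delta>) * real m"
    and "length y = m \<Longrightarrow> 0 < \<beta> \<Longrightarrow> \<beta> \<le> \<beta>0 \<Longrightarrow>
       real (length (c y)) \<le> real m * (1 + phi \<beta> + \<delta>) - \<beta> * (real (ham (f y) y) - \<rho> * real m)"
    and "length y = m \<Longrightarrow> length z = m \<Longrightarrow> 0 < \<beta> \<Longrightarrow> \<beta> \<le> \<beta>0 \<Longrightarrow>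
       real (length (c z)) \<le> real m * (1 + phi \<beta> + \<delta>) + \<beta> * (real (ham (f y) z) - \<rho> * real m)"
  using assms unfolding good_block_def by simp_all

text \<open>All large block lengths are demanded, because mixing two strategies prescribes the
  lengths of both parts.\<close>

definition strategy :: "real \<Rightarrow> real \<Rightarrow> real \<Rightarrow> bool" where
  "strategy s \<rho> \<beta>0 \<longleftrightarrow> (\<forall>\<delta>>0. \<exists>N. \<forall>m\<ge>N. \<exists>f c c'. good_block m s \<rho> \<beta>0 \<delta> f c c')"

section \<open>The two extreme strategies: rounding to a covering code, and thinning\<close>

lemma log2_mono: "0 < x \<Longrightarrow> x \<le> y \<Longrightarrow> log 2 x \<le> log 2 y"
  by (subst log_le_cancel_iff) auto

lemma pow_div_choose_ge_1: "k \<le> m \<Longrightarrow> 1 \<le> 2 ^ m / real (m choose k)"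
  using choose_le_pow[of m k] by (simp add: le_divide_eq_1 zero_less_binomial flip: of_nat_le_iff)

lemma log_pow_div_choose: "k \<le> m \<Longrightarrow> log 2 (2 ^ m / real (m choose k)) = real m - log 2 (real (m choose k))"
  by (simp add: log_divide log_nat_power zero_less_binomial)

text \<open>Words are classed by their distance d from the code C. A class has at most card C * (m
  choose d) words, and log 2 (card C) is about (1 - Hb \<eta>) m, so the class code has length about
  m + (d - \<eta> m) \<open>slope \<eta>\<close> at most. Code words have d = 0 and get about (1 -
  Hb \<eta>) m bits. Since \<open>f y\<close> lies in C, the distance of z from \<open>f y\<close>
  is at least d.\<close>

lemma cover_strategy:
  assumes \<eta>: "0 < \<eta>" "\<eta> < 1/2"
  shows "strategy (1 - Hb \<eta>) \<eta> (min 1 (slope \<eta>))"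
  unfolding strategy_def
proof (intro allI impI)
  fix \<delta> :: real assume "\<delta> > 0"
  \<comment> \<open>A single budget for all lower-order losses: rounded code lengths, polynomial
    factors, and the difference between k and \<eta> m. The numbers are generous.\<close>
  from log_le_linear[OF this, of "6 + 2 * slope \<eta>"] obtain N where
    N: "\<And>m. m \<ge> N \<Longrightarrow> 6 + 2 * slope \<eta> + 4 * log 2 (real m + 1) \<le> \<delta> * real m" by blast
  show "\<exists>N. \<forall>m\<ge>N. \<exists>f c c'. good_block m (1 - Hb \<eta>) \<eta> (min 1 (slope \<eta>)) \<delta> f c c'"
  proof (intro exI[of _ "Suc N"] allI impI)
    fix m assume m: "Suc N \<le> m"
    define lm where "lm = log 2 (real m + 1)"
    have lm: "0 \<le> lm" unfolding lm_def by simp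
    have sl: "0 < slope \<eta>" using \<eta> by (rule slope_pos)
    have err: "6 + 2 * slope \<eta> + 4 * lm \<le> \<delta> * real m" using N m unfolding lm_def by simp
    define k where "k = mode m \<eta>"
    have k: "k \<le> m" "real k \<le> real m * \<eta> + 1" unfolding k_def using mode_bounds[of \<eta> m] \<eta> by auto
    have Ck: "real m * Hb \<eta> - slope \<eta> - lm \<le> log 2 (real (m choose k))"
      unfolding k_def lm_def using \<eta> by (intro log_choose_mode_ge) auto
    obtain C where C: "C \<subseteq> bs m" "C \<noteq> {}" "real (card C) \<le> 2 ^ m / real (m choose k) * real m + 1"
      "\<And>y. y \<in> bs m \<Longrightarrow> \<exists>x\<in>C. ham x y = k"
      using cover_exists[of m k] m k by auto
    have finC: "finite C" using C(1) finite_subset finite_bs by blast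
    have cardC: "1 \<le> real (card C)" using C(2) finC by (simp add: Suc_le_eq card_gt_0_iff)
    have logC: "log 2 (real (card C)) \<le> real m * (1 - Hb \<eta>) + slope \<eta> + 2 * lm"
    proof -
      have "real (card C) \<le> 2 ^ m / real (m choose k) * (real m + 1)"
        using C(3) pow_div_choose_ge_1[OF k(1)] by (simp only: distrib_left mult_1_right)
      then have "log 2 (real (card C)) \<le> log 2 (2 ^ m / real (m choose k) * (real m + 1))"
        using cardC by (intro log2_mono) auto
      also have "\<dots> = log 2 (2 ^ m / real (m choose k)) + lm"
        unfolding lm_def using k(1) by (subst log_mult) auto
      finally show ?thesis using Ck log_pow_div_choose[OF k(1)] by (simp add: algebra_simps)
    qed
    define f where "f y = (SOME x. x \<in> C \<and> ham x y = k)" for y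
    have f: "f y \<in> C" "ham (f y) y = k" if "y \<in> bs m" for y
      using someI_ex[of "\<lambda>x. x \<in> C \<and> ham x y = k"] C(4)[OF that] unfolding f_def by auto
    define g where "g z = Min ((\<lambda>x. ham x z) ` C)" for z
    have g_le: "g z \<le> ham x z" if "x \<in> C" for x z unfolding g_def using finC that by simp
    have g_att: "\<exists>x\<in>C. ham x z = g z" for z
    proof -
      have "g z \<in> (\<lambda>x. ham x z) ` C" unfolding g_def using finC C(2) by (intro Min_in) auto
      then show ?thesis by (metis imageE)
    qed
    have g_m: "g z \<le> m" for z
    proof -
      obtain x where "x \<in> C" "ham x z = g z" using g_att by blast
      then show ?thesis using ham_le[of x z] C(1) by auto
    qed
    have cls: "real (card {z' \<in> bs m. g z' = d}) \<le> real (card C) * real (m choose d)" for d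
    proof -
      have "{z' \<in> bs m. g z' = d} \<subseteq> (\<Union>x\<in>C. {z' \<in> bs m. ham x z' = d})"
        using g_att by blast
      then have "card {z' \<in> bs m. g z' = d} \<le> card (\<Union>x\<in>C. {z' \<in> bs m. ham x z' = d})"
        using finC by (intro card_mono) auto
      also have "\<dots> \<le> (\<Sum>x\<in>C. card {z' \<in> bs m. ham x z' = d})" by (rule card_UN_le[OF finC])
      also have "\<dots> = (\<Sum>x\<in>C. m choose d)" using C(1) by (intro sum.cong refl card_sphere) auto
      finally have "card {z' \<in> bs m. g z' = d} \<le> card C * (m choose d)" by simp
      then show ?thesis by (metis of_nat_le_iff of_nat_mult)
    qed
    have g_less: "g z < m + 1" if "z \<in> bs m" for z using g_m[of z] that by simp
    obtain c :: "bool list \<Rightarrow> bool list" where cc: "\<forall>z\<in>bs m. \<forall>z'\<in>bs m. prefix (c z) (c z') \<longrightarrow> z = z'"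
      "\<forall>z\<in>bs m. real (length (c z)) \<le> log 2 (real (m + 1)) + log 2 (real (card {z' \<in> bs m. g z' = g z})) + 2"
      by (rule class_code[of "bs m" g "m + 1", OF finite_bs g_less])
    note c = cc[rule_format]
    have cpos: "0 < real (card {z' \<in> bs m. g z' = g z})" if "z \<in> bs m" for z
      using that by (auto simp: card_gt_0_iff)
    have c1: "real (length (c z)) \<le> lm + real m + 2" if z: "z \<in> bs m" for z
    proof -
      have "card {z' \<in> bs m. g z' = g z} \<le> card (bs m)" by (rule card_mono) auto
      then have "real (card {z' \<in> bs m. g z' = g z}) \<le> 2 ^ m"
        unfolding card_bs by (metis of_nat_le_iff of_nat_numeral of_nat_power)
      then have "log 2 (real (card {z' \<in> bs m. g z' = g z})) \<le> log 2 (2 ^ m)" using cpos[OF z] by (rule log2_mono[rotated])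
      then show ?thesis using c(2)[OF z] unfolding lm_def by (simp add: log_nat_power add.commute)
    qed
    have c2: "real (length (c z)) \<le> lm + log 2 (real (card C)) + log 2 (real (m choose g z)) + 2" if z: "z \<in> bs m" for z
    proof -
      have "log 2 (real (card {z' \<in> bs m. g z' = g z})) \<le> log 2 (real (card C) * real (m choose g z))"
        using cpos[OF z] cls by (intro log2_mono)
      also have "\<dots> = log 2 (real (card C)) + log 2 (real (m choose g z))"
        using cardC g_m[of z] by (subst log_mult) (auto simp: zero_less_binomial)
      finally show ?thesis using c(2)[OF z] unfolding lm_def by (simp add: add.commute)
    qed
    obtain c' :: "bool list \<Rightarrow> bool list" where cc': "\<forall>y\<in>bs m. \<forall>y'\<in>bs m. f y = f y' \<longrightarrow> prefix (c' y) (c' y') \<longrightarrow> y = y'"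
      "\<forall>y\<in>bs m. real (length (c' y)) \<le> log 2 (real (card {y' \<in> bs m. f y' = f y})) + 1"
      by (rule fibre_code[of "bs m" f, OF finite_bs])
    note c' = cc'[rule_format]
    have main: "real (length (c z)) \<le> real m * (1 + phi \<beta> + \<delta>) + \<beta> * (real (ham (f y) z) - \<eta> * real m)"
      if yz: "y \<in> bs m" "z \<in> bs m" and b: "0 < \<beta>" "\<beta> \<le> min 1 (slope \<eta>)" for y z \<beta>
    proof -
      have gd: "real (g z) \<le> real (ham (f y) z)" using g_le f(1)[OF yz(1)] by simp
      have p0: "0 \<le> real m * phi \<beta>" using phi_nonneg by simp
      show ?thesis
      proof (cases "real (g z) \<le> real m * \<eta>")
        \<comment> \<open>Here d - \<eta> m is not positive, so lowering the slope from
          \<open>slope \<eta>\<close> to \<beta> only weakens the bound. In the other case the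
          affine term is nonnegative, and the trivial bound of about m bits is enough.\<close>
        case True
        have "log 2 (real (m choose g z)) \<le> real m * Hb \<eta> + (real (g z) - real m * \<eta>) * slope \<eta>"
          using \<eta> g_m by (intro log_choose_entropy) auto
        also have "(real (g z) - real m * \<eta>) * slope \<eta> \<le> (real (g z) - real m * \<eta>) * \<beta>"
          using True b by (intro mult_left_mono_neg) auto
        also have "\<dots> \<le> (real (ham (f y) z) - real m * \<eta>) * \<beta>"
          using gd b by (intro mult_right_mono) auto
        finally have "real (length (c z)) \<le> lm + (real m * (1 - Hb \<eta>) + slope \<eta> + 2 * lm) +
            (real m * Hb \<eta> + (real (ham (f y) z) - real m * \<eta>) * \<beta>) + 2"
          using c2[OF yz(2)] logC by linarith
        then show ?thesis using err p0 lm sl by (simp add: algebra_simps)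
      next
        case False
        then have "0 \<le> \<beta> * (real (ham (f y) z) - \<eta> * real m)"
          using gd b by (intro mult_nonneg_nonneg) (auto simp: mult.commute)
        then show ?thesis using c1[OF yz(2)] err p0 lm sl by (simp add: algebra_simps)
      qed
    qed
    have "good_block m (1 - Hb \<eta>) \<eta> (min 1 (slope \<eta>)) \<delta> f c c'"
      unfolding good_block_def
    proof (intro conjI ballI allI impI)
      show "f y \<in> bs m" if "y \<in> bs m" for y using f(1)[OF that] C(1) by blast
      show "real (length (c (f y))) \<le> (1 - Hb \<eta> + \<delta>) * real m" if "y \<in> bs m" for y
      proof -
        have fy: "f y \<in> C" "f y \<in> bs m" using f(1)[OF that] C(1) by auto
        have "g (f y) = 0" using g_le[OF fy(1), of "f y"] by simp
        then show ?thesis using c2[OF fy(2)] logC err lm sl by (simp add: algebra_simps)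
      qed
      show "real (length (c' y)) \<le> (1 - (1 - Hb \<eta>) + \<delta>) * real m" if y: "y \<in> bs m" for y
      proof -
        have fy: "f y \<in> bs m" using f(1)[OF y] C(1) by auto
        have "{y' \<in> bs m. f y' = f y} \<subseteq> {z \<in> bs m. ham (f y) z = k}"
        proof
          fix x assume "x \<in> {y' \<in> bs m. f y' = f y}"
          then show "x \<in> {z \<in> bs m. ham (f y) z = k}" using f(2)[of x] by simp
        qed
        then have "card {y' \<in> bs m. f y' = f y} \<le> card {z \<in> bs m. ham (f y) z = k}"
          by (intro card_mono) auto
        also have "\<dots> = m choose k" using fy by (intro card_sphere) simp
        finally have "real (card {y' \<in> bs m. f y' = f y}) \<le> real (m choose k)" by simp
        moreover have "0 < real (card {y' \<in> bs m. f y' = f y})" using y by (auto simp: card_gt_0_iff)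
        ultimately have "log 2 (real (card {y' \<in> bs m. f y' = f y})) \<le> log 2 (real (m choose k))"
          by (intro log2_mono)
        also have "\<dots> \<le> real m * Hb \<eta> + slope \<eta>"
          using \<eta> by (intro log_choose_below_mode) (auto simp: k_def)
        finally show ?thesis using c'(2)[OF y] err lm sl by (simp add: algebra_simps)
      qed
      show "real (length (c y)) \<le> real m * (1 + phi \<beta> + \<delta>) - \<beta> * (real (ham (f y) y) - \<eta> * real m)"
        if y: "y \<in> bs m" and b: "0 < \<beta>" "\<beta> \<le> min 1 (slope \<eta>)" for y \<beta>
      proof -
        have "\<beta> * (real (ham (f y) y) - \<eta> * real m) \<le> \<beta> * 1"
          using f(2)[OF y] k(2) b by (intro mult_left_mono) (auto simp: mult.commute)
        also have "\<beta> * 1 \<le> 1" using b by simp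
        finally have "\<beta> * (real (ham (f y) y) - \<eta> * real m) \<le> 1" .
        moreover have "0 \<le> real m * phi \<beta>" using phi_nonneg by simp
        ultimately show ?thesis using c1[OF y] err lm sl by (simp add: algebra_simps)
      qed
    qed (use c(1) c'(1) main in auto)
    then show "\<exists>f c c'. good_block m (1 - Hb \<eta>) \<eta> (min 1 (slope \<eta>)) \<delta> f c c'" by blast
  qed
qed

text \<open>Sets of at most k elements stay as they are, larger ones are cut down to exactly k
  elements level by level. A fibre thus consists of at most one set that stayed and of the
  contributions of at most m levels.\<close>

lemma thin_sets:
  assumes "k \<le> m"
  shows "\<exists>F. (\<forall>B. B \<subseteq> {..<m} \<longrightarrow> F B \<subseteq> B \<and> card (F B) = min (card B) k) \<and>
    (\<forall>A. real (card {B. B \<subseteq> {..<m} \<and> F B = A}) \<le> 1 + (real m + 1) * thin_load m k)"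
proof -
  let ?b = "thin_load m k"
  define Q where "Q l f \<longleftrightarrow> (\<forall>B. B \<subseteq> {..<m} \<and> card B = l \<longrightarrow> f B \<subseteq> B \<and> card (f B) = k) \<and>
    (\<forall>A. real (card {B. B \<subseteq> {..<m} \<and> card B = l \<and> f B = A}) \<le> ?b)" for l f
  have "\<forall>l\<in>{k..m}. \<exists>f. Q l f" unfolding Q_def by (intro ballI thin_level) auto
  from bchoice[OF this] obtain f where Q: "\<forall>l\<in>{k..m}. Q l (f l)" ..
  have f: "f l B \<subseteq> B \<and> card (f l B) = k" if "l \<in> {k..m}" "B \<subseteq> {..<m}" "card B = l" for l B
    using Q[rule_format, OF that(1)] that(2,3) unfolding Q_def by simp
  have fib: "real (card {B. B \<subseteq> {..<m} \<and> card B = l \<and> f l B = A}) \<le> ?b" if "l \<in> {k..m}" for l A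
    using Q[rule_format, OF that] unfolding Q_def by simp
  define F where "F B = (if card B \<le> k then B else f (card B) B)" for B
  have cB: "card B \<le> m" if "B \<subseteq> {..<m}" for B using card_mono[OF _ that] by simp
  have b: "0 \<le> ?b" by simp
  show ?thesis
  proof (intro exI[of _ F] conjI allI impI)
    fix B assume B: "B \<subseteq> {..<m}"
    show "F B \<subseteq> B" "card (F B) = min (card B) k"
      using f[of "card B" B] B cB[OF B] unfolding F_def by auto
  next
    fix A
    have "{B. B \<subseteq> {..<m} \<and> F B = A} \<subseteq> {A} \<union> (\<Union>l\<in>{Suc k..m}. {B. B \<subseteq> {..<m} \<and> card B = l \<and> f l B = A})"
      unfolding F_def using cB by (auto split: if_splits)
    then have "card {B. B \<subseteq> {..<m} \<and> F B = A} \<le> card ({A} \<union> (\<Union>l\<in>{Suc k..m}. {B. B \<subseteq> {..<m} \<and> card B = l \<and> f l B = A}))"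
      by (intro card_mono) auto
    also have "\<dots> \<le> 1 + (\<Sum>l\<in>{Suc k..m}. card {B. B \<subseteq> {..<m} \<and> card B = l \<and> f l B = A})"
      by (rule order.trans[OF card_Un_le]) (auto intro!: card_UN_le)
    finally have "real (card {B. B \<subseteq> {..<m} \<and> F B = A}) \<le>
        1 + (\<Sum>l\<in>{Suc k..m}. real (card {B. B \<subseteq> {..<m} \<and> card B = l \<and> f l B = A}))"
      by (simp flip: of_nat_sum of_nat_Suc)
    also have "\<dots> \<le> 1 + (\<Sum>l\<in>{Suc k..m}. ?b)" using fib by (intro add_left_mono sum_mono) simp
    also have "\<dots> = 1 + real (m - k) * ?b" by simp
    also have "\<dots> \<le> 1 + (real m + 1) * ?b" using b by (intro add_left_mono mult_right_mono) auto
    finally show "real (card {B. B \<subseteq> {..<m} \<and> F B = A}) \<le> 1 + (real m + 1) * ?b" .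
  qed
qed

lemma thin_lists:
  assumes "k \<le> m"
  obtains f where "\<forall>y\<in>bs m. f y \<in> bs m \<and> supp (f y) \<subseteq> supp y \<and> card (supp (f y)) = min (card (supp y)) k"
    "\<forall>x\<in>bs m. real (card {y \<in> bs m. f y = x}) \<le> 1 + (real m + 1) * thin_load m k"
proof -
  obtain F where F: "\<And>B. B \<subseteq> {..<m} \<Longrightarrow> F B \<subseteq> B \<and> card (F B) = min (card B) k"
    "\<And>A. real (card {B. B \<subseteq> {..<m} \<and> F B = A}) \<le> 1 + (real m + 1) * thin_load m k"
    using thin_sets[OF assms] by blast
  define f where "f y = inv_into (bs m) supp (F (supp y))" for y
  have sup: "supp ` bs m = Pow {..<m}" "inj_on supp (bs m)" using bij_supp[of m] by (auto simp: bij_betw_def)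
  have f: "f y \<in> bs m" "supp (f y) = F (supp y)" if y: "y \<in> bs m" for y
  proof -
    have "supp y \<subseteq> {..<m}" using y by (auto simp: supp_def)
    then have "F (supp y) \<in> supp ` bs m" using F(1)[of "supp y"] sup(1) by auto
    then show "f y \<in> bs m" "supp (f y) = F (supp y)"
      unfolding f_def by (rule inv_into_into, rule f_inv_into_f)
  qed
  show thesis
  proof (rule that[of f]; intro ballI conjI)
    fix y assume y: "y \<in> bs m"
    have "supp y \<subseteq> {..<m}" using y by (auto simp: supp_def)
    then show "f y \<in> bs m" "supp (f y) \<subseteq> supp y" "card (supp (f y)) = min (card (supp y)) k"
      using f[OF y] F(1)[of "supp y"] by auto
  next
    fix x assume x: "x \<in> bs m"
    have "card {y \<in> bs m. f y = x} = card (supp ` {y \<in> bs m. f y = x})"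
      by (rule card_image[symmetric], rule inj_on_subset[OF sup(2)]) auto
    also have "\<dots> \<le> card {B. B \<subseteq> {..<m} \<and> F B = supp x}"
    proof (rule card_mono)
      show "supp ` {y \<in> bs m. f y = x} \<subseteq> {B. B \<subseteq> {..<m} \<and> F B = supp x}"
      proof
        fix B assume "B \<in> supp ` {y \<in> bs m. f y = x}"
        then obtain y where y: "y \<in> bs m" "f y = x" "B = supp y" by auto
        then show "B \<in> {B. B \<subseteq> {..<m} \<and> F B = supp x}" using f(2)[OF y(1)] by (auto simp: supp_def)
      qed
    qed auto
    finally have "real (card {y \<in> bs m. f y = x}) \<le> real (card {B. B \<subseteq> {..<m} \<and> F B = supp x})"
      by (simp only: of_nat_le_iff)
    then show "real (card {y \<in> bs m. f y = x}) \<le> 1 + (real m + 1) * thin_load m k"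
      using F(2)[of "supp x"] by linarith
  qed
qed

text \<open>Words are classed by their number of ones. An output \<open>f y\<close> has at most k
  \<approx> q m ones and so about Hb q * m bits, and thinning moves y by its number of ones in
  excess of k. If y is moved by more than (1/2 - q) m, it has more than about m/2 ones; if z is
  nearer than this to \<open>f y\<close>, it has fewer than about m/2 ones. Either way
  \<open>log_choose_phi\<close> shortens the code word.\<close>

lemma thin_strategy:
  assumes q: "0 \<le> q" "q \<le> 1/2"
  shows "strategy (Hb q) (1/2 - q) 1"
  unfolding strategy_def
proof (intro allI impI)
  fix \<delta> :: real assume "\<delta> > 0"
  from log_le_linear[OF this, of "6 + 2 * slope q"] obtain N where
    N: "\<And>m. m \<ge> N \<Longrightarrow> 6 + 2 * slope q + 4 * log 2 (real m + 1) \<le> \<delta> * real m" by blast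
  show "\<exists>N. \<forall>m\<ge>N. \<exists>f c c'. good_block m (Hb q) (1/2 - q) 1 \<delta> f c c'"
  proof (intro exI[of _ "Suc N"] allI impI)
    fix m assume m: "Suc N \<le> m"
    define lm where "lm = log 2 (real m + 1)"
    have lm: "0 \<le> lm" unfolding lm_def by simp
    have sl: "0 \<le> slope q" using q by (rule slope_nonneg)
    have err: "6 + 2 * slope q + 4 * lm \<le> \<delta> * real m" using N m unfolding lm_def by simp
    define k where "k = mode m q"
    have k: "k \<le> m" "real k \<le> real m * q + 1" "real m * q - 1 \<le> real k"
      unfolding k_def using mode_bounds[OF q, of m] by auto
    have Ck: "real m * Hb q - slope q - lm \<le> log 2 (real (m choose k))"
      unfolding k_def lm_def using q by (intro log_choose_mode_ge) auto
    obtain f where ff: "\<forall>y\<in>bs m. f y \<in> bs m \<and> supp (f y) \<subseteq> supp y \<and> card (supp (f y)) = min (card (supp y)) k"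
      "\<forall>x\<in>bs m. real (card {y \<in> bs m. f y = x}) \<le> 1 + (real m + 1) * thin_load m k"
      by (rule thin_lists[OF k(1)])
    note f = ff[rule_format]
    have ham_f: "ham (f y) y = card (supp y) - k" if "y \<in> bs m" for y
      using ham_supp_subset[of "f y" y] f(1)[OF that] that by auto
    define g where "g z = card (supp z)" for z
    have g_m: "g z \<le> m" if "z \<in> bs m" for z using card_supp_le[of z] that unfolding g_def by simp
    have g_less: "g z < m + 1" if "z \<in> bs m" for z using g_m[of z] that by simp
    obtain c :: "bool list \<Rightarrow> bool list" where cc: "\<forall>z\<in>bs m. \<forall>z'\<in>bs m. prefix (c z) (c z') \<longrightarrow> z = z'"
      "\<forall>z\<in>bs m. real (length (c z)) \<le> log 2 (real (m + 1)) + log 2 (real (card {z' \<in> bs m. g z' = g z})) + 2"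
      by (rule class_code[of "bs m" g "m + 1", OF finite_bs g_less])
    note c = cc[rule_format]
    have c1: "real (length (c z)) \<le> lm + log 2 (real (m choose g z)) + 2" if z: "z \<in> bs m" for z
      using c(2)[OF z] card_supp[of m "g z"] unfolding lm_def g_def by (simp add: add.commute)
    obtain c' :: "bool list \<Rightarrow> bool list" where cc': "\<forall>y\<in>bs m. \<forall>y'\<in>bs m. f y = f y' \<longrightarrow> prefix (c' y) (c' y') \<longrightarrow> y = y'"
      "\<forall>y\<in>bs m. real (length (c' y)) \<le> log 2 (real (card {y' \<in> bs m. f y' = f y})) + 1"
      by (rule fibre_code[of "bs m" f, OF finite_bs])
    note c' = cc'[rule_format]
    have "good_block m (Hb q) (1/2 - q) 1 \<delta> f c c'"
      unfolding good_block_def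
    proof (intro conjI ballI allI impI)
      show "real (length (c (f y))) \<le> (Hb q + \<delta>) * real m" if "y \<in> bs m" for y
      proof -
        have "g (f y) \<le> k" using f(1)[OF that] unfolding g_def by simp
        then have "log 2 (real (m choose g (f y))) \<le> real m * Hb q + slope q"
          using q by (intro log_choose_below_mode) (auto simp: k_def)
        then show ?thesis using c1[of "f y"] f(1)[OF that] err lm sl by (simp add: algebra_simps)
      qed
      show "real (length (c' y)) \<le> (1 - Hb q + \<delta>) * real m" if y: "y \<in> bs m" for y
      proof -
        define P where "P = 2 ^ m / real (m choose k)"
        have P: "1 \<le> P" unfolding P_def by (rule pow_div_choose_ge_1[OF k(1)])
        have "real (card {y' \<in> bs m. f y' = f y}) \<le> 1 + (real m + 1) * ((real m + 1) * (2 * P))"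
          using f(2)[of "f y"] f(1)[OF y] unfolding P_def by simp
        also have "\<dots> \<le> (real m + 1) * ((real m + 1) * (4 * P))"
        proof -
          have "1 * (1 * 1) \<le> (real m + 1) * ((real m + 1) * (2 * P))"
            using P by (intro mult_mono) auto
          then show ?thesis by (simp add: algebra_simps)
        qed
        finally have le: "real (card {y' \<in> bs m. f y' = f y}) \<le> (real m + 1) * ((real m + 1) * (4 * P))" .
        have "0 < real (card {y' \<in> bs m. f y' = f y})" using y by (auto simp: card_gt_0_iff)
        then have "log 2 (real (card {y' \<in> bs m. f y' = f y})) \<le> log 2 ((real m + 1) * ((real m + 1) * (4 * P)))"
          using le by (intro log2_mono)
        also have "\<dots> = lm + (lm + (log 2 4 + log 2 P))"
          unfolding lm_def using P by (simp add: log_mult)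
        also have "log 2 (4::real) = 2" using log_nat_power[of 2 2 2] by simp
        also have "log 2 P = real m - log 2 (real (m choose k))"
          unfolding P_def by (rule log_pow_div_choose[OF k(1)])
        finally show ?thesis using c'(2)[OF y] Ck err lm sl by (simp add: algebra_simps)
      qed
      show "real (length (c y)) \<le> real m * (1 + phi \<beta> + \<delta>) - \<beta> * (real (ham (f y) y) - (1/2 - q) * real m)"
        if y: "y \<in> bs m" and b: "0 < \<beta>" "\<beta> \<le> 1" for y \<beta>
      proof (cases "k \<le> g y")
        case True
        have "real (ham (f y) y) - (1/2 - q) * real m \<le> (real (g y) - real m / 2) + 1"
          using ham_f[OF y] True k(3) unfolding g_def by (simp add: of_nat_diff algebra_simps)
        then have "\<beta> * (real (ham (f y) y) - (1/2 - q) * real m) \<le> \<beta> * ((real (g y) - real m / 2) + 1)"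
          using b by (intro mult_left_mono) auto
        moreover have "log 2 (real (m choose g y)) \<le> real m * (1 + phi \<beta>) - \<beta> * (real (g y) - real m / 2)"
          by (rule log_choose_phi(1)[OF g_m[OF y]])
        ultimately show ?thesis using c1[OF y] err lm sl b by (simp add: algebra_simps)
      next
        case False
        \<comment> \<open>With fewer than k ones, y is not moved at all. The affine term then helps,
          and the trivial bound of m bits suffices.\<close>
        then have "ham (f y) y = 0" using ham_f[OF y] unfolding g_def by simp
        moreover have "0 \<le> \<beta> * ((1/2 - q) * real m)" using b q by simp
        moreover have "0 \<le> real m * phi \<beta>" using phi_nonneg by simp
        moreover have "log 2 (real (m choose g y)) \<le> real m" by (rule log_choose_le[OF g_m[OF y]])
        ultimately show ?thesis using c1[OF y] err lm sl by (simp add: algebra_simps)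
      qed
      show "real (length (c z)) \<le> real m * (1 + phi \<beta> + \<delta>) + \<beta> * (real (ham (f y) z) - (1/2 - q) * real m)"
        if yz: "y \<in> bs m" "z \<in> bs m" and b: "0 < \<beta>" "\<beta> \<le> 1" for y z \<beta>
      proof -
        have "g z \<le> card (supp (f y)) + ham (f y) z"
          unfolding g_def using yz f(1)[OF yz(1)] by (intro card_supp_ham_le) auto
        also have "card (supp (f y)) \<le> k" using f(1)[OF yz(1)] by simp
        finally have "real (g z) - real m / 2 \<le> (real (ham (f y) z) - (1/2 - q) * real m) + 1"
          using k(2) by (simp add: algebra_simps)
        then have "\<beta> * (real (g z) - real m / 2) \<le> \<beta> * ((real (ham (f y) z) - (1/2 - q) * real m) + 1)"
          using b by (intro mult_left_mono) auto
        moreover have "log 2 (real (m choose g z)) \<le> real m * (1 + phi \<beta>) + \<beta> * (real (g z) - real m / 2)"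
          by (rule log_choose_phi(2)[OF g_m[OF yz(2)]])
        ultimately show ?thesis using c1[OF yz(2)] err lm sl b by (simp add: algebra_simps)
      qed
    qed (use f(1) c(1) c'(1) in auto)
    then show "\<exists>f c c'. good_block m (Hb q) (1/2 - q) 1 \<delta> f c c'" by blast
  qed
qed

text \<open>Both parts must have the same rate s and obey their bounds for the same \<beta>; then
  lengths and Hamming distances add, and so do the affine bounds. The hypothesis
  \<open>1 \<le> \<delta> * real (a + b)\<close> lets a second \<delta> absorb the rounding of the
  mean of \<open>\<rho>1\<close> and \<open>\<rho>2\<close>.\<close>

lemma good_block_append:
  assumes A: "good_block a s \<rho>1 \<beta>0 \<delta> f1 c1 d1" and B: "good_block b s \<rho>2 \<beta>0 \<delta> f2 c2 d2"
    and \<rho>: "\<bar>\<rho>1 * real a + \<rho>2 * real b - \<rho> * real (a + b)\<bar> \<le> 1" "1 \<le> \<delta> * real (a + b)" "\<beta>0 \<le> 1"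
  shows "\<exists>f c d. good_block (a + b) s \<rho> \<beta>0 (2 * \<delta>) f c d"
proof -
  define lift where "lift g1 g2 y = g1 (take a y) @ g2 (drop a y)" for g1 g2 :: "bool list \<Rightarrow> bool list" and y
  note A' = good_blockD[OF A] and B' = good_blockD[OF B]
  have td: "length (take a y) = a" "length (drop a y) = b" if "y \<in> bs (a + b)" for y using that by auto
  have pre: "prefix (u @ u') (w @ w') \<Longrightarrow> prefix u w \<or> prefix w u" for u u' w w' :: "bool list"
    by (metis append_prefixD prefixI prefix_same_cases)
  have ham2: "ham (lift f1 f2 y) z = ham (f1 (take a y)) (take a z) + ham (f2 (drop a y)) (drop a z)"
    if "y \<in> bs (a + b)" "z \<in> bs (a + b)" for y z
  proof -
    have "length (f1 (take a y)) = length (take a z)" using A'(1) td that by simp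
    from ham_append[OF this] show ?thesis unfolding lift_def by (metis append_take_drop_id)
  qed
  have adj: "\<bar>\<beta> * (\<rho>1 * real a + \<rho>2 * real b - \<rho> * real (a + b))\<bar> \<le> \<delta> * real (a + b)" if "0 < \<beta>" "\<beta> \<le> \<beta>0" for \<beta>
  proof -
    have "\<bar>\<beta> * (\<rho>1 * real a + \<rho>2 * real b - \<rho> * real (a + b))\<bar> \<le> 1 * 1"
      unfolding abs_mult using \<rho> that by (intro mult_mono) auto
    then show ?thesis using \<rho>(2) by simp
  qed
  have "good_block (a + b) s \<rho> \<beta>0 (2 * \<delta>) (lift f1 f2) (lift c1 c2) (lift d1 d2)"
    unfolding good_block_def
  proof (intro conjI ballI allI impI)
    show "lift f1 f2 y \<in> bs (a + b)" if "y \<in> bs (a + b)" for y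
      using A'(1) B'(1) td[OF that] unfolding lift_def by simp
    show "z = z'" if z: "z \<in> bs (a + b)" "z' \<in> bs (a + b)" "prefix (lift c1 c2 z) (lift c1 c2 z')" for z z'
    proof -
      have 1: "take a z = take a z'"
        using pre[OF z(3)[unfolded lift_def]] A'(2)[OF td(1)[OF z(1)] td(1)[OF z(2)]]
          A'(2)[OF td(1)[OF z(2)] td(1)[OF z(1)]] by auto
      then have "prefix (c2 (drop a z)) (c2 (drop a z'))" using z(3) unfolding lift_def by simp
      then have "drop a z = drop a z'" by (rule B'(2)[OF td(2)[OF z(1)] td(2)[OF z(2)]])
      then show ?thesis using 1 by (metis append_take_drop_id)
    qed
    show "y = y'" if y: "y \<in> bs (a + b)" "y' \<in> bs (a + b)" "lift f1 f2 y = lift f1 f2 y'"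
      "prefix (lift d1 d2 y) (lift d1 d2 y')" for y y'
    proof -
      have "length (f1 (take a y)) = length (f1 (take a y'))" using A'(1) td[OF y(1)] td[OF y(2)] by simp
      then have feq: "f1 (take a y) = f1 (take a y')" "f2 (drop a y) = f2 (drop a y')"
        using y(3) unfolding lift_def by auto
      have 1: "take a y = take a y'"
        using pre[OF y(4)[unfolded lift_def]] A'(3)[OF td(1)[OF y(1)] td(1)[OF y(2)] feq(1)]
          A'(3)[OF td(1)[OF y(2)] td(1)[OF y(1)] feq(1)[symmetric]] by auto
      then have "prefix (d2 (drop a y)) (d2 (drop a y'))" using y(4) unfolding lift_def by simp
      then have "drop a y = drop a y'" by (rule B'(3)[OF td(2)[OF y(1)] td(2)[OF y(2)] feq(2)])
      then show ?thesis using 1 by (metis append_take_drop_id)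
    qed
    have \<delta>: "0 \<le> \<delta> * real (a + b)" using \<rho>(2) by simp
    show "real (length (lift c1 c2 (lift f1 f2 y))) \<le> (s + 2 * \<delta>) * real (a + b)" if y: "y \<in> bs (a + b)" for y
    proof -
      have "length (f1 (take a y)) = a" by (rule A'(1)[OF td(1)[OF y]])
      then have "lift c1 c2 (lift f1 f2 y) = c1 (f1 (take a y)) @ c2 (f2 (drop a y))" unfolding lift_def by simp
      moreover have "real (length (c1 (f1 (take a y)))) \<le> (s + \<delta>) * real a" by (rule A'(4)[OF td(1)[OF y]])
      moreover have "real (length (c2 (f2 (drop a y)))) \<le> (s + \<delta>) * real b" by (rule B'(4)[OF td(2)[OF y]])
      ultimately show ?thesis using \<delta> by (simp add: algebra_simps)
    qed
    show "real (length (lift d1 d2 y)) \<le> (1 - s + 2 * \<delta>) * real (a + b)" if y: "y \<in> bs (a + b)" for y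
    proof -
      have "real (length (d1 (take a y))) \<le> (1 - s + \<delta>) * real a" by (rule A'(5)[OF td(1)[OF y]])
      moreover have "real (length (d2 (drop a y))) \<le> (1 - s + \<delta>) * real b" by (rule B'(5)[OF td(2)[OF y]])
      ultimately show ?thesis unfolding lift_def using \<delta> by (simp add: algebra_simps)
    qed
    show "real (length (lift c1 c2 y)) \<le> real (a + b) * (1 + phi \<beta> + 2 * \<delta>) -
        \<beta> * (real (ham (lift f1 f2 y) y) - \<rho> * real (a + b))"
      if y: "y \<in> bs (a + b)" and b: "0 < \<beta>" "\<beta> \<le> \<beta>0" for y \<beta>
    proof -
      have "real (length (c1 (take a y))) \<le> real a * (1 + phi \<beta> + \<delta>) -
          \<beta> * (real (ham (f1 (take a y)) (take a y)) - \<rho>1 * real a)" by (rule A'(6)[OF td(1)[OF y] b])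
      moreover have "real (length (c2 (drop a y))) \<le> real b * (1 + phi \<beta> + \<delta>) -
          \<beta> * (real (ham (f2 (drop a y)) (drop a y)) - \<rho>2 * real b)" by (rule B'(6)[OF td(2)[OF y] b])
      ultimately show ?thesis
        using adj[OF b] ham2[OF y y] unfolding lift_def by (simp add: algebra_simps abs_le_iff)
    qed
    show "real (length (lift c1 c2 z)) \<le> real (a + b) * (1 + phi \<beta> + 2 * \<delta>) +
        \<beta> * (real (ham (lift f1 f2 y) z) - \<rho> * real (a + b))"
      if y: "y \<in> bs (a + b)" and z: "z \<in> bs (a + b)" and b: "0 < \<beta>" "\<beta> \<le> \<beta>0" for y z \<beta>
    proof -
      have "real (length (c1 (take a z))) \<le> real a * (1 + phi \<beta> + \<delta>) +
          \<beta> * (real (ham (f1 (take a y)) (take a z)) - \<rho>1 * real a)" by (rule A'(7)[OF td(1)[OF y] td(1)[OF z] b])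
      moreover have "real (length (c2 (drop a z))) \<le> real b * (1 + phi \<beta> + \<delta>) +
          \<beta> * (real (ham (f2 (drop a y)) (drop a z)) - \<rho>2 * real b)" by (rule B'(7)[OF td(2)[OF y] td(2)[OF z] b])
      ultimately show ?thesis
        using adj[OF b] ham2[OF y z] unfolding lift_def by (simp add: algebra_simps abs_le_iff)
    qed
  qed
  then show ?thesis by blast
qed

lemma good_block_mono: "good_block m s \<rho> \<beta>0 \<delta> f c d \<Longrightarrow> \<beta>1 \<le> \<beta>0 \<Longrightarrow> good_block m s \<rho> \<beta>1 \<delta> f c d"
  unfolding good_block_def by (auto intro: order.trans)

lemma strategy_mono: "strategy s \<rho> \<beta>0 \<Longrightarrow> \<beta>1 \<le> \<beta>0 \<Longrightarrow> strategy s \<rho> \<beta>1"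
  unfolding strategy_def using good_block_mono by meson

lemma strategy_mix:
  assumes S: "strategy s \<rho>1 \<beta>0" "strategy s \<rho>2 \<beta>0" and l: "0 < l" "l < 1"
    and \<rho>: "\<bar>\<rho>1 - \<rho>2\<bar> \<le> 1" "\<beta>0 \<le> 1"
  shows "strategy s (l * \<rho>1 + (1 - l) * \<rho>2) \<beta>0"
  unfolding strategy_def
proof (intro allI impI)
  fix \<delta> :: real assume \<delta>: "\<delta> > 0"
  then have "\<delta> / 2 > 0" by simp
  then obtain N1 N2 where
    N1: "\<And>m. m \<ge> N1 \<Longrightarrow> \<exists>f c d. good_block m s \<rho>1 \<beta>0 (\<delta> / 2) f c d" and
    N2: "\<And>m. m \<ge> N2 \<Longrightarrow> \<exists>f c d. good_block m s \<rho>2 \<beta>0 (\<delta> / 2) f c d"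
    using S unfolding strategy_def by meson
  \<comment> \<open>The extra 1 compensates for rounding m l down to an integer length.\<close>
  have "eventually (\<lambda>m. real m * l \<ge> real N1 + 1 \<and> real m * (1 - l) \<ge> real N2 \<and> \<delta> / 2 * real m \<ge> 1) sequentially"
    using l \<delta> by (intro eventually_conj; real_asymp)
  then obtain N where N: "\<And>m. m \<ge> N \<Longrightarrow> real m * l \<ge> real N1 + 1 \<and> real m * (1 - l) \<ge> real N2 \<and> \<delta> / 2 * real m \<ge> 1"
    unfolding eventually_sequentially by blast
  show "\<exists>N. \<forall>m\<ge>N. \<exists>f c c'. good_block m s (l * \<rho>1 + (1 - l) * \<rho>2) \<beta>0 \<delta> f c c'"
  proof (intro exI[of _ N] allI impI)
    fix m assume "N \<le> m"
    note Nm = N[OF this]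
    define a where "a = nat \<lfloor>real m * l\<rfloor>"
    have nn: "0 \<le> real m * l" using l by simp
    have a: "real a \<le> real m * l" "real m * l < real a + 1" unfolding a_def using nn by linarith+
    have "real m * l \<le> real m" using l by (simp add: mult_left_le)
    then have am: "a \<le> m" using a(1) by linarith
    define b where "b = m - a"
    have b: "real b = real m - real a" "m = a + b" unfolding b_def using am by auto
    have "N1 \<le> a" using Nm a by linarith
    then obtain f1 c1 d1 where g1: "good_block a s \<rho>1 \<beta>0 (\<delta> / 2) f1 c1 d1" using N1 by blast
    have "real m * (1 - l) \<le> real b" using b a by (simp add: algebra_simps)
    then have "N2 \<le> b" using Nm by linarith
    then obtain f2 c2 d2 where g2: "good_block b s \<rho>2 \<beta>0 (\<delta> / 2) f2 c2 d2" using N2 by blast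
    have "\<rho>1 * real a + \<rho>2 * real b - (l * \<rho>1 + (1 - l) * \<rho>2) * real m = (\<rho>1 - \<rho>2) * (real a - real m * l)"
      using b by (simp add: algebra_simps)
    moreover have "\<bar>(\<rho>1 - \<rho>2) * (real a - real m * l)\<bar> \<le> 1 * 1"
      unfolding abs_mult using \<rho> a by (intro mult_mono) auto
    ultimately have "\<bar>\<rho>1 * real a + \<rho>2 * real b - (l * \<rho>1 + (1 - l) * \<rho>2) * real (a + b)\<bar> \<le> 1"
      using b(2) by simp
    from good_block_append[OF g1 g2 this _ \<rho>(2)]
    show "\<exists>f c c'. good_block m s (l * \<rho>1 + (1 - l) * \<rho>2) \<beta>0 \<delta> f c c'"
      using Nm b(2) by simp
  qed
qed

text \<open>The covering strategy is available only for 0 < \<eta> < 1/2, where its slope is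
  positive. The degenerate values need no covering: for s = 1 one has \<eta> = 0 and q = 1/2, for s
  = 0 one has \<eta> = 1/2 and q = 0, and in both cases the interval shrinks to r = 1/2 - q, which
  thinning alone attains.\<close>

lemma strategy_exists:
  assumes s: "0 \<le> s" "s \<le> 1" and r: "Hinv (1 - s) \<le> r" "r \<le> 1/2 - Hinv s"
  shows "\<exists>\<beta>0. 0 < \<beta>0 \<and> \<beta>0 \<le> 1 \<and> strategy s r \<beta>0"
proof -
  define \<eta> q where "\<eta> = Hinv (1 - s)" and "q = Hinv s"
  have \<eta>: "0 \<le> \<eta>" "\<eta> \<le> 1/2" "Hb \<eta> = 1 - s" unfolding \<eta>_def using s Hinv_props[of "1 - s"] by auto
  have q: "0 \<le> q" "q \<le> 1/2" "Hb q = s" unfolding q_def using s Hinv_props[of s] by auto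
  have thin: "strategy s (1/2 - q) 1" using thin_strategy[OF q(1,2)] q(3) by simp
  show ?thesis
  proof (cases "r = 1/2 - q")
    case True
    then show ?thesis using thin by (intro exI[of _ 1]) simp
  next
    case False
    then have less: "\<eta> \<le> r" "r < 1/2 - q" using r unfolding \<eta>_def q_def by auto
    have "\<eta> \<noteq> 0"
    proof
      assume "\<eta> = 0"
      then have "s = 1" using \<eta>(3) by simp
      have "q = 1/2"
      proof (rule ccontr)
        assume "q \<noteq> 1/2"
        then have "Hb q < Hb (1/2)" using q by (intro Hb_strict_mono) auto
        then show False using q(3) \<open>s = 1\<close> by simp
      qed
      then show False using less \<eta>(1) by simp
    qed
    then have \<eta>0: "0 < \<eta>" "\<eta> < 1/2" using \<eta> less q by auto
    have cov: "strategy s \<eta> (min 1 (slope \<eta>))" using cover_strategy[OF \<eta>0] \<eta>(3) by simp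
    have b: "0 < min 1 (slope \<eta>)" using slope_pos[OF \<eta>0] by simp
    show ?thesis
    proof (cases "r = \<eta>")
      case True
      then show ?thesis using cov b by (intro exI[of _ "min 1 (slope \<eta>)"]) simp
    next
      case False
      \<comment> \<open>The weight for which the mean of the two end points, \<eta> with weight l
        and 1/2 - q with weight 1 - l, equals r.\<close>
      define l where "l = (1/2 - q - r) / (1/2 - q - \<eta>)"
      have d: "0 < 1/2 - q - \<eta>" using less by simp
      have l: "0 < l" "l < 1" unfolding l_def using d less False by (auto simp: field_simps)
      have "l * (1/2 - q - \<eta>) = 1/2 - q - r" unfolding l_def using d by simp
      moreover have "l * \<eta> + (1 - l) * (1/2 - q) = (1/2 - q) - l * (1/2 - q - \<eta>)"
        by (simp add: left_diff_distrib right_diff_distrib)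
      ultimately have "l * \<eta> + (1 - l) * (1/2 - q) = r" by simp
      moreover have "strategy s (l * \<eta> + (1 - l) * (1/2 - q)) (min 1 (slope \<eta>))"
        by (rule strategy_mix[OF cov strategy_mono[OF thin] l]) (use \<eta>0 q d in auto)
      ultimately show ?thesis using b by (intro exI[of _ "min 1 (slope \<eta>)"]) simp
    qed
  qed
qed

section \<open>The sequence\<close>

text \<open>The level at B is the largest j \<le> B whose requirements i * g i \<le> B hold up to j.
  As the level tends to infinity, the last conclusion makes the cost g of the current level o(B),
  whatever the growth of g.\<close>

lemma slow_schedule:
  fixes g :: "nat \<Rightarrow> nat"
  shows "\<exists>L. mono L \<and> (\<forall>j. \<exists>B0. \<forall>B\<ge>B0. j \<le> L B) \<and> (\<forall>B. L B * g (L B) \<le> B)"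
proof -
  define A where "A B = {j. j \<le> B \<and> (\<forall>i\<le>j. i * g i \<le> B)}" for B
  define L where "L B = Max (A B)" for B
  have fin: "finite (A B)" for B by (rule finite_subset[of _ "{..B}"]) (auto simp: A_def)
  have ne: "0 \<in> A B" for B by (simp add: A_def)
  have L: "L B \<in> A B" for B unfolding L_def using fin ne by (intro Max_in) auto
  have "mono L"
  proof (rule monoI)
    fix B B' :: nat assume "B \<le> B'"
    then have "A B \<subseteq> A B'" by (auto simp: A_def)
    then show "L B \<le> L B'" unfolding L_def using fin ne by (intro Max_mono) auto
  qed
  moreover have "\<exists>B0. \<forall>B\<ge>B0. j \<le> L B" for j
  proof (intro exI[of _ "j + (\<Sum>i\<le>j. i * g i)"] allI impI)
    fix B assume B: "j + (\<Sum>i\<le>j. i * g i) \<le> B"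
    have "i * g i \<le> (\<Sum>i\<le>j. i * g i)" if "i \<le> j" for i using that by (intro member_le_sum) auto
    then have "i * g i \<le> B" if "i \<le> j" for i using that B by (meson add_leE order.trans)
    then have "j \<in> A B" using B unfolding A_def by simp
    then show "j \<le> L B" unfolding L_def using fin by simp
  qed
  moreover have "L B * g (L B) \<le> B" for B using L[of B] unfolding A_def by auto
  ultimately show ?thesis by blast
qed

lemma pos_mono: "i \<le> j \<Longrightarrow> pos M i \<le> pos M j"
  unfolding pos_def by (rule sum_mono2) auto

lemma pos_ge: assumes "\<And>i. M i > 0" shows "i \<le> pos M i"
proof (induction i)
  case (Suc i)
  then show ?case using assms[of i] by simp
qed simp

definition block :: "(nat \<Rightarrow> nat) \<Rightarrow> nat \<Rightarrow> nat" where
  "block M n = (LEAST i. n < pos M (Suc i))"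

lemma block_bounds:
  assumes "\<And>i. M i > 0"
  shows "pos M (block M n) \<le> n" "n < pos M (Suc (block M n))"
proof -
  have ex: "n < pos M (Suc n)" using pos_ge[of M "Suc n"] assms by simp
  show "n < pos M (Suc (block M n))" unfolding block_def by (rule LeastI[of "\<lambda>i. n < pos M (Suc i)", OF ex])
  show "pos M (block M n) \<le> n"
  proof (cases "block M n")
    case 0
    then show ?thesis by (simp add: pos_def)
  next
    case (Suc i)
    then have "\<not> n < pos M (Suc i)" unfolding block_def using not_less_Least[of i "\<lambda>i. n < pos M (Suc i)"] by simp
    then show ?thesis using Suc by simp
  qed
qed

lemma block_eq:
  assumes "t < M i" shows "block M (pos M i + t) = i"
  unfolding block_def
proof (rule Least_equality)
  show "pos M i + t < pos M (Suc i)" using assms by simp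
  fix k assume "pos M i + t < pos M (Suc k)"
  then show "i \<le> k" using pos_mono[of "Suc k" i M] by (cases "i \<le> k") auto
qed

lemma blockwise_seq:
  assumes "\<And>i. length (F i) = M i"
  shows "\<exists>X. \<forall>i. seg X (pos M i) (M i) = F i"
proof (intro exI allI)
  fix i
  show "seg (\<lambda>n. F (block M n) ! (n - pos M (block M n))) (pos M i) (M i) = F i"
    by (rule nth_equalityI) (simp_all add: assms seg_def block_eq)
qed

section \<open>Summation over the blocks\<close>

definition hdiff :: "seq \<Rightarrow> seq \<Rightarrow> nat \<Rightarrow> nat" where
  "hdiff X Z n = card {m. m < n \<and> X m \<noteq> Z m}"

lemma hdiff_ham: "hdiff X Z n = ham (restr X n) (restr Z n)"
proof -
  have "{i. i < length (restr X n) \<and> restr X n ! i \<noteq> restr Z n ! i} = {m. m < n \<and> X m \<noteq> Z m}"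
    by (auto simp: restr_def)
  then show ?thesis unfolding hdiff_def ham_def by simp
qed

lemma hdiff_add: "hdiff X Z (a + n) = hdiff X Z a + ham (seg X a n) (seg Z a n)"
  unfolding hdiff_ham restr_add by (rule ham_append) (simp add: restr_def)

lemma hdiff_pos: "hdiff X Z (pos M B) = (\<Sum>i<B. ham (seg X (pos M i) (M i)) (seg Z (pos M i) (M i)))"
  by (induction B) (simp_all add: hdiff_add, simp add: pos_def hdiff_def)

lemma tab_ok_plain:
  assumes "\<forall>z\<in>bs m. \<forall>z'\<in>bs m. prefix (c z) (c z') \<longrightarrow> z = z'"
  shows "tab_ok m ((\<lambda>z. (replicate m False, c z, z)) ` bs m)"
  unfolding tab_ok_def using assms by auto

lemma tab_ok_fibre:
  assumes "\<forall>y\<in>bs m. f y \<in> bs m" "\<forall>y\<in>bs m. \<forall>y'\<in>bs m. f y = f y' \<longrightarrow> prefix (d y) (d y') \<longrightarrow> y = y'"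
  shows "tab_ok m ((\<lambda>y. (f y, d y, y)) ` bs m)"
  unfolding tab_ok_def using assms by auto

text \<open>The last condition bounds the flag of level j, which has j + 2 bits, by a fraction 1/(j
  + 1) of the block, the same fraction as the error of the block code.\<close>

lemma choose_blocks:
  assumes "strategy s r \<beta>0"
  obtains m f c d where "\<forall>j. good_block (m j) s r \<beta>0 (1 / (real j + 1)) (f j) (c j) (d j)"
    "\<forall>j. 0 < m j" "\<forall>j. real j + 2 \<le> 1 / (real j + 1) * real (m j)"
proof -
  define Q where "Q j m \<longleftrightarrow> (\<exists>f c d. good_block m s r \<beta>0 (1 / (real j + 1)) f c d) \<and> 0 < m \<and>
    real j + 2 \<le> 1 / (real j + 1) * real m" for j m
  have "\<exists>m. Q j m" for j
  proof -
    have "1 / (real j + 1) > 0" by simp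
    then obtain N where N: "\<And>m. N \<le> m \<Longrightarrow> \<exists>f c d. good_block m s r \<beta>0 (1 / (real j + 1)) f c d"
      using assms unfolding strategy_def by meson
    let ?m = "N + (j + 1) * (j + 2)"
    have "real j + 2 = 1 / (real j + 1) * real ((j + 1) * (j + 2))" by (simp add: field_simps)
    also have "\<dots> \<le> 1 / (real j + 1) * real ?m" by (intro mult_left_mono) auto
    finally have "Q j ?m" unfolding Q_def using N[of ?m] by simp
    then show ?thesis ..
  qed
  then obtain m where m: "\<And>j. Q j (m j)" by metis
  have "\<exists>f c d. good_block (m j) s r \<beta>0 (1 / (real j + 1)) f c d" for j using m[of j] unfolding Q_def by blast
  then obtain f c d where "\<forall>j. good_block (m j) s r \<beta>0 (1 / (real j + 1)) (f j) (c j) (d j)" by metis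
  moreover have "\<forall>j. 0 < m j" "\<forall>j. real j + 2 \<le> 1 / (real j + 1) * real (m j)"
    using m unfolding Q_def by simp_all
  ultimately show thesis by (rule that)
qed

text \<open>The blocks before \<open>B0\<close>, where the level may be low, are charged in full;
  all others at the rate 1/(j + 1). The former sum is fixed as B grows, so the mean error tends to
  0.\<close>

lemma sum_block_errors:
  fixes M L :: "nat \<Rightarrow> nat"
  assumes "\<forall>i\<ge>B0. j \<le> L i"
  shows "(\<Sum>i<B. real (M i) * (1 / (real (L i) + 1))) \<le> real (pos M B0) + 1 / (real j + 1) * real (pos M B)"
proof -
  have "(\<Sum>i<B. real (M i) * (1 / (real (L i) + 1))) \<le>
      (\<Sum>i<B. (if i < B0 then real (M i) else 0) + 1 / (real j + 1) * real (M i))"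
  proof (rule sum_mono)
    fix i
    show "real (M i) * (1 / (real (L i) + 1)) \<le> (if i < B0 then real (M i) else 0) + 1 / (real j + 1) * real (M i)"
    proof (cases "i < B0")
      case True
      have "real (M i) * (1 / (real (L i) + 1)) \<le> real (M i) * 1" by (intro mult_left_mono) auto
      moreover have "0 \<le> 1 / (real j + 1) * real (M i)" by simp
      ultimately show ?thesis by (simp only: True if_True)
    next
      case False
      then have "real (M i) * (1 / (real (L i) + 1)) \<le> real (M i) * (1 / (real j + 1))"
        using assms by (intro mult_left_mono divide_left_mono) auto
      then show ?thesis using False by simp
    qed
  qed
  also have "\<dots> = (\<Sum>i\<in>{..<B} \<inter> {..<B0}. real (M i)) + 1 / (real j + 1) * real (pos M B)"
  proof -
    have "(\<Sum>i<B. if i < B0 then real (M i) else 0) = (\<Sum>i\<in>{..<B} \<inter> {..<B0}. real (M i))"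
      by (subst sum.If_cases) (simp_all add: lessThan_def)
    then show ?thesis by (simp add: sum.distrib sum_distrib_left pos_def)
  qed
  also have "(\<Sum>i\<in>{..<B} \<inter> {..<B0}. real (M i)) \<le> real (pos M B0)"
    unfolding pos_def of_nat_sum by (rule sum_mono2) auto
  finally show ?thesis by simp
qed

lemma main_construction:
  fixes Y :: seq
  assumes S: "strategy s r \<beta>0" and s: "0 \<le> s" "s \<le> 1" and r: "0 \<le> r" "r \<le> 1" and b0: "\<beta>0 \<le> 1"
  obtains X and err :: "nat \<Rightarrow> real" where
    "\<forall>\<epsilon>>0. \<forall>\<^sub>F n in sequentially. err n \<le> \<epsilon> * real n"
    "\<forall>n. real (K (restr X n)) \<le> s * real n + err n"
    "\<forall>n. real (K (restr Y n)) \<le> real (K (restr X n)) + (1 - s) * real n + err n"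
    "\<forall>n \<beta>. 0 < \<beta> \<longrightarrow> \<beta> \<le> \<beta>0 \<longrightarrow>
      real (K (restr Y n)) \<le> real n * (1 + phi \<beta>) - \<beta> * (real (hdiff X Y n) - r * real n) + err n"
    "\<forall>Z n \<beta>. 0 < \<beta> \<longrightarrow> \<beta> \<le> \<beta>0 \<longrightarrow>
      real (K (restr Z n)) \<le> real n * (1 + phi \<beta>) + \<beta> * (real (hdiff X Z n) - r * real n) + err n"
proof -
  obtain m f c d where blocks: "\<forall>j. good_block (m j) s r \<beta>0 (1 / (real j + 1)) (f j) (c j) (d j)"
    "\<forall>j. 0 < m j" "\<forall>j. real j + 2 \<le> 1 / (real j + 1) * real (m j)"
    by (rule choose_blocks[OF S])
  note good = blocks(1)[rule_format] and m = blocks(2)[rule_format] and mj = blocks(3)[rule_format]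
  note gD = good_blockD[OF good]
  \<comment> \<open>Decoding with \<open>T0\<close> takes zeros as side information, so only the
    length is known; decoding with \<open>T1\<close> takes X as side information and restores
    Y.\<close>
  define T0 where "T0 j = (\<lambda>z. (replicate (m j) False, c j z, z)) ` bs (m j)" for j
  define T1 where "T1 j = (\<lambda>y. (f j y, d j y, y)) ` bs (m j)" for j
  have T0: "tab_ok (m j) (T0 j)" for j
    unfolding T0_def using good[of j] unfolding good_block_def by (intro tab_ok_plain) blast
  have T1: "tab_ok (m j) (T1 j)" for j
    unfolding T1_def using good[of j] unfolding good_block_def by (intro tab_ok_fibre) blast+
  define KL where "KL T j k \<longleftrightarrow> (\<forall>L B t X Y cs. (\<forall>i<B. L i \<le> j \<and>
       (seg X (pos (\<lambda>i. m (L i)) i) (m (L i)), cs i, seg Y (pos (\<lambda>i. m (L i)) i) (m (L i))) \<in> T (L i)) \<longrightarrow>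
     K (restr Y (pos (\<lambda>i. m (L i)) B + t)) \<le> K (restr X (pos (\<lambda>i. m (L i)) B + t)) +
       (\<Sum>i<B. length (cs i) + L i + 2) + 2 * t + k)" for T :: "nat \<Rightarrow> entry set" and j k :: nat
  have "\<forall>j. \<exists>k. KL T0 j k" unfolding KL_def using K_levels[of m T0, OF T0 m] ..
  then obtain k0 where k0: "\<And>j. KL T0 j (k0 j)" by metis
  have "\<forall>j. \<exists>k. KL T1 j k" unfolding KL_def using K_levels[of m T1, OF T1 m] ..
  then obtain k1 where k1: "\<And>j. KL T1 j (k1 j)" by metis
  \<comment> \<open>\<open>3 * m j\<close> covers an incomplete last block of t < m j bits: its raw
    bits cost 2 t, and cutting the distance terms at the block boundary costs at most one further
    t.\<close>
  define g where "g j = k0 j + k1 j + 3 * m j" for j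
  obtain L where L: "mono L" "\<And>j. \<exists>B0. \<forall>B\<ge>B0. j \<le> L B" "\<And>B. L B * g (L B) \<le> B"
    using slow_schedule[of g] by blast
  define M where "M i = m (L i)" for i
  have M: "0 < M i" for i unfolding M_def by (rule m)
  define P where "P = pos M"
  have "\<exists>X. \<forall>i. seg X (P i) (M i) = f (L i) (seg Y (P i) (M i))"
    unfolding P_def by (rule blockwise_seq) (simp add: M_def gD(1))
  then obtain X where X: "\<And>i. seg X (P i) (M i) = f (L i) (seg Y (P i) (M i))" by blast
  define K0 where "K0 n = K (replicate n False)" for n
  define E where "E B = (\<Sum>i<B. real (M i) * (1 / (real (L i) + 1)))" for B
  \<comment> \<open>\<open>K0 n\<close> pays for the length. Of the two copies of \<open>E\<close>,
    one pays for the errors of the block codes, the other for the flags of the levels.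
    \<open>g\<close> pays for the constants and the incomplete block.\<close>
  define err where "err n = real (K0 n) + 2 * E (block M n) + real (g (L (block M n)))" for n
  have E0: "0 \<le> E B" for B unfolding E_def by (intro sum_nonneg) auto
  have sumM: "(\<Sum>i<B. real (M i)) = real (P B)" for B unfolding P_def pos_def by simp
  have ex: "\<exists>B t. n = P B + t \<and> t < M B \<and> B = block M n" for n
    using block_bounds[of M n] M unfolding P_def by (intro exI[of _ "block M n"] exI[of _ "n - pos M (block M n)"]) auto
  have split: "\<exists>B t. n = P B + t \<and> 3 * t + k0 (L B) + k1 (L B) \<le> g (L B) \<and>
      err n = real (K0 n) + 2 * E B + real (g (L B))" for n
  proof -
    obtain B t where B: "n = P B + t" "t < M B" "B = block M n" using ex[of n] by blast
    have "3 * t + k0 (L B) + k1 (L B) \<le> g (L B)" using B(2) unfolding g_def M_def by simp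
    moreover have "err n = real (K0 n) + 2 * E B + real (g (L B))" unfolding err_def B(3) ..
    ultimately show ?thesis using B(1) by blast
  qed
  have len: "length (seg Z (P i) (M i)) = m (L i)" for Z i by (simp add: M_def)
  have lvl: "i < B \<Longrightarrow> L i \<le> L B" for i B using monoD[OF L(1), of i B] by simp
  have plain: "K (restr Z (P B + t)) \<le> K0 (P B + t) + (\<Sum>i<B. length (c (L i) (seg Z (P i) (M i))) + L i + 2) + 2 * t + k0 (L B)"
    for Z B t
  proof -
    have "\<forall>i<B. L i \<le> L B \<and> (seg (\<lambda>_. False) (P i) (M i), c (L i) (seg Z (P i) (M i)), seg Z (P i) (M i)) \<in> T0 (L i)"
      using lvl unfolding T0_def seg_def by (auto simp: M_def map_replicate_const)
    then have "K (restr Z (P B + t)) \<le> K (restr (\<lambda>_. False) (P B + t)) +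
        (\<Sum>i<B. length (c (L i) (seg Z (P i) (M i))) + L i + 2) + 2 * t + k0 (L B)"
      using k0[of "L B", unfolded KL_def, rule_format, of B L "\<lambda>_. False" "\<lambda>i. c (L i) (seg Z (P i) (M i))" Z t]
      unfolding P_def M_def by blast
    then show ?thesis unfolding K0_def restr_def by (simp add: map_replicate_const)
  qed
  have cond: "K (restr Y (P B + t)) \<le> K (restr X (P B + t)) + (\<Sum>i<B. length (d (L i) (seg Y (P i) (M i))) + L i + 2) + 2 * t + k1 (L B)"
    for B t
  proof -
    have "\<forall>i<B. L i \<le> L B \<and> (seg X (P i) (M i), d (L i) (seg Y (P i) (M i)), seg Y (P i) (M i)) \<in> T1 (L i)"
      using lvl unfolding T1_def X by (auto simp: M_def)
    then show ?thesis
      using k1[of "L B", unfolded KL_def, rule_format, of B L X "\<lambda>i. d (L i) (seg Y (P i) (M i))" Y t]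
      unfolding P_def M_def by blast
  qed
  \<comment> \<open>All four bounds have this form: a is the rate in bits, h the Hamming distances
    with their slope \<beta>, and e the slope times r. The two bounds on dimension take the last two
    terms to be 0.\<close>
  have costs: "real (\<Sum>i<B. l i + L i + 2) \<le> a * real (P B) + 2 * E B + \<beta> * (\<Sum>i<B. h i) - e * real (P B)"
    if "\<And>i. real (l i) \<le> real (M i) * (a + 1 / (real (L i) + 1)) + \<beta> * h i - e * real (M i)"
    for B l and a \<beta> e :: real and h
  proof -
    have "real (\<Sum>i<B. l i + L i + 2) = (\<Sum>i<B. real (l i) + (real (L i) + 2))"
      unfolding of_nat_sum by (intro sum.cong refl) simp
    also have "\<dots> \<le> (\<Sum>i<B. (real (M i) * (a + 1 / (real (L i) + 1)) + \<beta> * h i - e * real (M i)) + 1 / (real (L i) + 1) * real (M i))"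
      using that mj unfolding M_def by (intro sum_mono add_mono) auto
    also have "\<dots> = (\<Sum>i<B. a * real (M i) + 2 * (real (M i) * (1 / (real (L i) + 1))) + \<beta> * h i - e * real (M i))"
      by (intro sum.cong refl) (simp add: algebra_simps)
    also have "\<dots> = a * (\<Sum>i<B. real (M i)) + 2 * E B + \<beta> * (\<Sum>i<B. h i) - e * (\<Sum>i<B. real (M i))"
      unfolding E_def by (simp only: sum.distrib sum_subtractf sum_distrib_left)
    finally show ?thesis unfolding sumM .
  qed
  have dl: "hdiff X Z (P B + t) \<le> hdiff X Z (P B) + t" "hdiff X Z (P B) \<le> hdiff X Z (P B + t)" for Z B t
    using ham_le[of "seg X (P B) t" "seg Z (P B) t"] unfolding hdiff_add by auto
  have dP: "real (hdiff X Z (P B)) = (\<Sum>i<B. real (ham (seg X (P i) (M i)) (seg Z (P i) (M i))))" for Z B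
    unfolding P_def hdiff_pos by simp
  show thesis
  proof (rule that[of err X]; intro allI impI)
    fix n
    obtain B t where n: "n = P B + t" "3 * t + k0 (L B) + k1 (L B) \<le> g (L B)"
      "err n = real (K0 n) + 2 * E B + real (g (L B))" using split by blast
    have g3: "3 * real t + real (k0 (L B)) + real (k1 (L B)) \<le> real (g (L B))" using n(2) by linarith
    have sn: "s * real (P B) \<le> s * real n" "(1 - s) * real (P B) \<le> (1 - s) * real n"
      using s n(1) by (auto intro!: mult_left_mono)
    show "real (K (restr X n)) \<le> s * real n + err n"
    proof -
      have "real (length (c (L i) (seg X (P i) (M i)))) \<le> real (M i) * (s + 1 / (real (L i) + 1)) + 0 * 0 - 0 * real (M i)" for i
        using gD(4)[OF len, of i Y] unfolding X by (simp add: M_def mult.commute)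
      from costs[OF this, of B] have "real (\<Sum>i<B. length (c (L i) (seg X (P i) (M i))) + L i + 2) \<le> s * real (P B) + 2 * E B"
        by simp
      moreover have "real (K (restr X n)) \<le> real (K0 n) + real (\<Sum>i<B. length (c (L i) (seg X (P i) (M i))) + L i + 2) + 2 * real t + real (k0 (L B))"
        using plain[of X B t] unfolding n(1) by linarith
      ultimately show ?thesis using n(3) g3 sn by linarith
    qed
    show "real (K (restr Y n)) \<le> real (K (restr X n)) + (1 - s) * real n + err n"
    proof -
      have "real (length (d (L i) (seg Y (P i) (M i)))) \<le> real (M i) * ((1 - s) + 1 / (real (L i) + 1)) + 0 * 0 - 0 * real (M i)" for i
        using gD(5)[OF len, of i Y] by (simp add: M_def mult.commute)
      from costs[OF this, of B] have "real (\<Sum>i<B. length (d (L i) (seg Y (P i) (M i))) + L i + 2) \<le> (1 - s) * real (P B) + 2 * E B"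
        by simp
      moreover have "real (K (restr Y n)) \<le> real (K (restr X n)) + real (\<Sum>i<B. length (d (L i) (seg Y (P i) (M i))) + L i + 2) + 2 * real t + real (k1 (L B))"
        using cond[of B t] unfolding n(1) by linarith
      ultimately show ?thesis using n(3) g3 sn by linarith
    qed
    fix \<beta> assume \<beta>: "0 < \<beta>" "\<beta> \<le> \<beta>0"
    then have \<beta>1: "\<beta> \<le> 1" using b0 by simp
    have phin: "(1 + phi \<beta>) * real (P B) \<le> (1 + phi \<beta>) * real n"
      using phi_nonneg[of \<beta>] n(1) by (intro mult_left_mono) auto
    have brP: "\<beta> * r * real (P B) = \<beta> * r * real n - \<beta> * r * real t" using n(1) by (simp add: algebra_simps)
    have br: "0 \<le> \<beta> * r" "\<beta> * r \<le> 1" using \<beta> \<beta>1 r by (simp_all add: mult_le_one)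
    have brt: "0 \<le> \<beta> * r * real t" using br(1) by (rule mult_nonneg_nonneg) simp
    have brt': "\<beta> * r * real t \<le> 1 * real t" using br(2) by (rule mult_right_mono) simp
    have bt: "\<beta> * real t \<le> 1 * real t" using \<beta>1 by (intro mult_right_mono) auto
    show "real (K (restr Y n)) \<le> real n * (1 + phi \<beta>) - \<beta> * (real (hdiff X Y n) - r * real n) + err n"
    proof -
      have "real (length (c (L i) (seg Y (P i) (M i)))) \<le> real (M i) * ((1 + phi \<beta>) + 1 / (real (L i) + 1)) +
          (- \<beta>) * real (ham (seg X (P i) (M i)) (seg Y (P i) (M i))) - (- (\<beta> * r)) * real (M i)" for i
        using gD(6)[OF len \<beta>, of i Y] unfolding X by (simp add: M_def algebra_simps)
      from costs[OF this, of B] have "real (\<Sum>i<B. length (c (L i) (seg Y (P i) (M i))) + L i + 2) \<le>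
          (1 + phi \<beta>) * real (P B) + 2 * E B - \<beta> * real (hdiff X Y (P B)) + \<beta> * r * real (P B)"
        unfolding dP by simp
      moreover have "real (K (restr Y n)) \<le> real (K0 n) + real (\<Sum>i<B. length (c (L i) (seg Y (P i) (M i))) + L i + 2) + 2 * real t + real (k0 (L B))"
        using plain[of Y B t] unfolding n(1) by linarith
      moreover have "\<beta> * real (hdiff X Y n) \<le> \<beta> * (real (hdiff X Y (P B)) + real t)"
        using dl(1)[of Y B t] \<beta> unfolding n(1) by (intro mult_left_mono) auto
      moreover have "real n * (1 + phi \<beta>) - \<beta> * (real (hdiff X Y n) - r * real n) =
          (1 + phi \<beta>) * real n - \<beta> * real (hdiff X Y n) + \<beta> * r * real n" by (simp add: algebra_simps)
      moreover have "\<beta> * (real (hdiff X Y (P B)) + real t) = \<beta> * real (hdiff X Y (P B)) + \<beta> * real t"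
        by (simp add: algebra_simps)
      ultimately show ?thesis using n(3) g3 phin brP brt brt' bt by linarith
    qed
    fix Z
    show "real (K (restr Z n)) \<le> real n * (1 + phi \<beta>) + \<beta> * (real (hdiff X Z n) - r * real n) + err n"
    proof -
      have "real (length (c (L i) (seg Z (P i) (M i)))) \<le> real (M i) * ((1 + phi \<beta>) + 1 / (real (L i) + 1)) +
          \<beta> * real (ham (seg X (P i) (M i)) (seg Z (P i) (M i))) - \<beta> * r * real (M i)" for i
        using gD(7)[OF len len \<beta>, of i Z Y] unfolding X by (simp add: M_def algebra_simps)
      from costs[OF this, of B] have "real (\<Sum>i<B. length (c (L i) (seg Z (P i) (M i))) + L i + 2) \<le>
          (1 + phi \<beta>) * real (P B) + 2 * E B + \<beta> * real (hdiff X Z (P B)) - \<beta> * r * real (P B)"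
        unfolding dP by simp
      moreover have "real (K (restr Z n)) \<le> real (K0 n) + real (\<Sum>i<B. length (c (L i) (seg Z (P i) (M i))) + L i + 2) + 2 * real t + real (k0 (L B))"
        using plain[of Z B t] unfolding n(1) by linarith
      moreover have "\<beta> * real (hdiff X Z (P B)) \<le> \<beta> * real (hdiff X Z n)"
        using dl(2)[of Z B t] \<beta> unfolding n(1) by (intro mult_left_mono) auto
      moreover have "real n * (1 + phi \<beta>) + \<beta> * (real (hdiff X Z n) - r * real n) =
          (1 + phi \<beta>) * real n + \<beta> * real (hdiff X Z n) - \<beta> * r * real n" by (simp add: algebra_simps)
      ultimately show ?thesis using n(3) g3 phin brP brt brt' by linarith
    qed
  next
    fix \<epsilon> :: real assume \<epsilon>: "\<epsilon> > 0"
    \<comment> \<open>From level j on, both 1/(j + 1) and g / n are at most \<epsilon>/6. Four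
      shares of this size arise: the logarithm together with all constants, two copies of the mean
      block error, and g.\<close>
    obtain j :: nat where j: "6 / \<epsilon> \<le> real j" using real_arch_simple by blast
    then have j1: "1 / (real j + 1) \<le> \<epsilon> / 6" "0 < real j"
      using \<epsilon> by (simp add: field_simps, smt (verit) divide_pos_pos)
    obtain B0 where B0: "\<forall>B\<ge>B0. j \<le> L B" using L(2) by blast
    obtain k where k: "\<And>n. real (K0 n) \<le> 2 * log 2 (real n + 1) + real k"
      using K_zeros unfolding K0_def by blast
    have "\<forall>\<^sub>F n in sequentially. 2 * log 2 (real n + 1) + real k + 2 * real (P B0) \<le> \<epsilon> / 6 * real n"
      using \<epsilon> by real_asymp
    moreover have "\<forall>\<^sub>F n in sequentially. P B0 \<le> n" by (rule eventually_ge_at_top)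
    ultimately show "\<forall>\<^sub>F n in sequentially. err n \<le> \<epsilon> * real n"
    proof eventually_elim
      case (elim n)
      let ?B = "block M n"
      have bb: "P ?B \<le> n" "n < P (Suc ?B)" unfolding P_def using block_bounds[of M n] M by auto
      have "B0 \<le> ?B"
      proof (rule ccontr)
        assume "\<not> B0 \<le> ?B"
        then have "P (Suc ?B) \<le> P B0" unfolding P_def by (intro pos_mono) simp
        then show False using bb elim(2) by simp
      qed
      then have "j \<le> L ?B" using B0 by blast
      then have "j * g (L ?B) \<le> L ?B * g (L ?B)" by simp
      also have "\<dots> \<le> ?B" by (rule L(3))
      also have "\<dots> \<le> P ?B" unfolding P_def using M by (intro pos_ge) 
      finally have "j * g (L ?B) \<le> n" using bb by simp
      then have "real j * real (g (L ?B)) \<le> real n" by (metis of_nat_le_iff of_nat_mult)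
      moreover have "6 / \<epsilon> * real (g (L ?B)) \<le> real j * real (g (L ?B))" using j by (intro mult_right_mono) auto
      ultimately have "6 / \<epsilon> * real (g (L ?B)) \<le> real n" by simp
      then have 1: "real (g (L ?B)) \<le> \<epsilon> / 6 * real n" using \<epsilon> by (simp add: field_simps)
      have "E ?B \<le> real (P B0) + 1 / (real j + 1) * real (P ?B)"
        unfolding E_def P_def by (rule sum_block_errors[OF B0])
      also have "1 / (real j + 1) * real (P ?B) \<le> \<epsilon> / 6 * real n"
        using j1 bb \<epsilon> by (intro mult_mono) auto
      finally have "E ?B \<le> real (P B0) + \<epsilon> / 6 * real n" by simp
      then have "err n \<le> 4 * (\<epsilon> / 6 * real n)"
        unfolding err_def using 1 k[of n] elim(1) by linarith
      also have "\<dots> \<le> \<epsilon> * real n" using \<epsilon> by simp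
      finally show ?case .
    qed
  qed
qed

section \<open>Passage to the limits\<close>

lemma Limsup_le_epsilon:
  assumes "\<And>\<epsilon>. \<epsilon> > 0 \<Longrightarrow> \<forall>\<^sub>F n in sequentially. u n \<le> a + \<epsilon>"
  shows "limsup (\<lambda>n. ereal (u n)) \<le> ereal a"
proof (rule ereal_le_epsilon2)
  fix \<epsilon> :: real assume "0 < \<epsilon>"
  from assms[OF this] have "\<forall>\<^sub>F n in sequentially. ereal (u n) \<le> ereal (a + \<epsilon>)" by simp
  then have "limsup (\<lambda>n. ereal (u n)) \<le> ereal (a + \<epsilon>)" by (rule Limsup_bounded)
  then show "limsup (\<lambda>n. ereal (u n)) \<le> ereal a + ereal \<epsilon>" by simp
qed

lemma Liminf_ge_epsilon:
  assumes "\<And>\<epsilon>. \<epsilon> > 0 \<Longrightarrow> \<forall>\<^sub>F n in sequentially. a - \<epsilon> \<le> u n"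
  shows "ereal a \<le> liminf (\<lambda>n. ereal (u n))"
proof (rule ereal_le_epsilon2)
  fix \<epsilon> :: real assume "0 < \<epsilon>"
  from assms[OF this] have "\<forall>\<^sub>F n in sequentially. ereal (a - \<epsilon>) \<le> ereal (u n)" by simp
  then have "ereal (a - \<epsilon>) \<le> liminf (\<lambda>n. ereal (u n))" by (rule Liminf_bounded)
  then have "ereal (a - \<epsilon>) + ereal \<epsilon> \<le> liminf (\<lambda>n. ereal (u n)) + ereal \<epsilon>" by (rule add_right_mono)
  then show "ereal a \<le> liminf (\<lambda>n. ereal (u n)) + ereal \<epsilon>" by simp
qed

lemma cdim_one_lower:
  assumes "cdim Z = 1" "\<epsilon> > 0"
  shows "\<forall>\<^sub>F n in sequentially. (1 - \<epsilon>) * real n \<le> real (K (restr Z n))"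
proof -
  have "ereal (1 - \<epsilon>) < liminf (\<lambda>n. ereal (real (K (restr Z n)) / real n))"
    using assms unfolding cdim_def by (simp add: one_ereal_def)
  then have "\<forall>\<^sub>F n in sequentially. ereal (1 - \<epsilon>) < ereal (real (K (restr Z n)) / real n)"
    by (rule less_LiminfD)
  then show ?thesis
    using eventually_gt_at_top[of 0]
    by eventually_elim (simp add: field_simps)
qed

lemma phi_over_small:
  assumes "\<epsilon> > 0" "\<beta>0 > 0"
  obtains \<beta> where "0 < \<beta>" "\<beta> \<le> \<beta>0" "phi \<beta> \<le> \<epsilon> * \<beta>"
proof -
  have "\<forall>\<^sub>F b in at_right 0. phi b / b < \<epsilon>" using phi_small assms(1) by (rule order_tendstoD(2))
  moreover have "\<forall>\<^sub>F b in at_right 0. b \<in> {0<..<\<beta>0}" using assms(2) by (rule eventually_at_right_real)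
  ultimately have "\<forall>\<^sub>F b in at_right 0. 0 < b \<and> b \<le> \<beta>0 \<and> phi b \<le> \<epsilon> * b"
    by eventually_elim (auto simp: field_simps)
  then have "\<exists>b. 0 < b \<and> b \<le> \<beta>0 \<and> phi b \<le> \<epsilon> * b"
    by (rule eventually_happens'[OF trivial_limit_at_right_real])
  then show thesis using that by blast
qed

theorem theorem1p5:
  fixes s r :: real and Y :: seq
  assumes "0 \<le> s" "s \<le> 1"
    and "Hinv (1 - s) \<le> r" "r \<le> 1/2 - Hinv s"
    and "cdim Y = 1"
  shows "\<exists>X :: seq. cdim X = ereal s \<and> pdim X = ereal s \<and> dst1 X = ereal r \<and> dst X Y = ereal r"
proof -
  obtain \<beta>0 where b0: "0 < \<beta>0" "\<beta>0 \<le> 1" "strategy s r \<beta>0"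
    using strategy_exists[OF assms(1-4)] by blast
  have r: "0 \<le> r" "r \<le> 1"
    using assms Hinv_props[of "1 - s"] Hinv_props[of s] by auto
  obtain X and err :: "nat \<Rightarrow> real" where
    main: "\<forall>\<epsilon>>0. \<forall>\<^sub>F n in sequentially. err n \<le> \<epsilon> * real n"
    "\<forall>n. real (K (restr X n)) \<le> s * real n + err n"
    "\<forall>n. real (K (restr Y n)) \<le> real (K (restr X n)) + (1 - s) * real n + err n"
    "\<forall>n \<beta>. 0 < \<beta> \<longrightarrow> \<beta> \<le> \<beta>0 \<longrightarrow>
      real (K (restr Y n)) \<le> real n * (1 + phi \<beta>) - \<beta> * (real (hdiff X Y n) - r * real n) + err n"
    "\<forall>Z n \<beta>. 0 < \<beta> \<longrightarrow> \<beta> \<le> \<beta>0 \<longrightarrow>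
      real (K (restr Z n)) \<le> real n * (1 + phi \<beta>) + \<beta> * (real (hdiff X Z n) - r * real n) + err n"
    by (rule main_construction[OF b0(3) assms(1,2) r b0(2), of Y])
  note err = main(1)[rule_format] and U = main(2)[rule_format] and Lo = main(3)[rule_format]
    and dY = main(4)[rule_format] and dZ = main(5)[rule_format]
  have pos: "\<forall>\<^sub>F n :: nat in sequentially. 0 < n" by (rule eventually_gt_at_top)
  have "pdim X \<le> ereal s"
    unfolding pdim_def
  proof (rule Limsup_le_epsilon)
    fix \<epsilon> :: real assume "\<epsilon> > 0"
    from err[OF this] pos show "\<forall>\<^sub>F n in sequentially. real (K (restr X n)) / real n \<le> s + \<epsilon>"
    proof eventually_elim
      case (elim n)
      then show ?case using U[of n] by (simp add: field_simps)
    qed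
  qed
  moreover have "ereal s \<le> cdim X"
    unfolding cdim_def
  proof (rule Liminf_ge_epsilon)
    fix \<epsilon> :: real assume "\<epsilon> > 0"
    then have e: "\<epsilon> / 2 > 0" by simp
    from err[OF e] pos cdim_one_lower[OF assms(5) e]
    show "\<forall>\<^sub>F n in sequentially. s - \<epsilon> \<le> real (K (restr X n)) / real n"
    proof eventually_elim
      case (elim n)
      \<comment> \<open>One \<epsilon>/2 is the deficiency of Y, the other is the error: recovering
        Y from X costs only (1 - s) n bits, so X must supply the remaining s n.\<close>
      then have "(s - \<epsilon>) * real n \<le> real (K (restr X n))" using Lo[of n] by (simp add: algebra_simps)
      then show ?case using elim(2) by (simp add: field_simps)
    qed
  qed
  moreover have "cdim X \<le> pdim X" unfolding cdim_def pdim_def by (intro Liminf_le_Limsup) simp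
  ultimately have dim: "cdim X = ereal s" "pdim X = ereal s" by (meson order.antisym order.trans)+
  have lower: "ereal r \<le> dst X Z" if Z: "cdim Z = 1" for Z
  proof -
    \<comment> \<open>Already the lower limit of the relative distance is at least r, and so is the
      upper limit in \<open>dst\<close>.\<close>
    have "ereal r \<le> liminf (\<lambda>n. ereal (real (hdiff X Z n) / real n))"
    proof (rule Liminf_ge_epsilon)
      fix \<epsilon> :: real assume "\<epsilon> > 0"
      then have e3: "\<epsilon> / 3 > 0" by simp
      \<comment> \<open>The slope is chosen only now, in terms of \<epsilon>. Three errors of size
        \<epsilon>/3 * \<beta> per bit add up, namely \<open>phi \<beta>\<close>, the term
        \<open>err\<close>, and the deficiency of Z; division by \<beta> leaves \<epsilon>.\<close>
      obtain \<beta> where \<beta>: "0 < \<beta>" "\<beta> \<le> \<beta>0" "phi \<beta> \<le> \<epsilon> / 3 * \<beta>" using phi_over_small[OF e3 b0(1)] .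
      have e: "\<epsilon> / 3 * \<beta> > 0" using e3 \<beta>(1) by (rule mult_pos_pos)
      from err[OF e] pos cdim_one_lower[OF Z e]
      show "\<forall>\<^sub>F n in sequentially. r - \<epsilon> \<le> real (hdiff X Z n) / real n"
      proof eventually_elim
        case (elim n)
        have "real n * phi \<beta> \<le> real n * (\<epsilon> / 3 * \<beta>)" using \<beta>(3) by (intro mult_left_mono) auto
        then have "0 \<le> \<beta> * (real (hdiff X Z n) - r * real n) + 3 * (\<epsilon> / 3 * \<beta> * real n)"
          using dZ[OF \<beta>(1,2), of Z n] elim(1,3) by (simp add: algebra_simps)
        then have "0 \<le> \<beta> * (real (hdiff X Z n) - r * real n + \<epsilon> * real n)" by (simp add: algebra_simps)
        then have "0 \<le> real (hdiff X Z n) - r * real n + \<epsilon> * real n" using \<beta>(1) by (simp add: zero_le_mult_iff)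
        then show ?case using elim(2) by (simp add: field_simps)
      qed
    qed
    also have "\<dots> \<le> dst X Z" unfolding dst_def hdiff_def by (intro Liminf_le_Limsup) simp
    finally show ?thesis .
  qed
  have "dst X Y \<le> ereal r"
    unfolding dst_def hdiff_def[symmetric]
  proof (rule Limsup_le_epsilon)
    fix \<epsilon> :: real assume "\<epsilon> > 0"
    then have e3: "\<epsilon> / 3 > 0" by simp
    obtain \<beta> where \<beta>: "0 < \<beta>" "\<beta> \<le> \<beta>0" "phi \<beta> \<le> \<epsilon> / 3 * \<beta>" using phi_over_small[OF e3 b0(1)] .
    have e: "\<epsilon> / 3 * \<beta> > 0" using e3 \<beta>(1) by (rule mult_pos_pos)
    from err[OF e] pos cdim_one_lower[OF assms(5) e]
    show "\<forall>\<^sub>F n in sequentially. real (hdiff X Y n) / real n \<le> r + \<epsilon>"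
    proof eventually_elim
      case (elim n)
      have "real n * phi \<beta> \<le> real n * (\<epsilon> / 3 * \<beta>)" using \<beta>(3) by (intro mult_left_mono) auto
      then have "\<beta> * (real (hdiff X Y n) - r * real n) \<le> 3 * (\<epsilon> / 3 * \<beta> * real n)"
        using dY[OF \<beta>(1,2), of n] elim(1,3) by (simp add: algebra_simps)
      then have "\<beta> * (real (hdiff X Y n) - r * real n) \<le> \<beta> * (\<epsilon> * real n)" by (simp add: algebra_simps)
      then have "real (hdiff X Y n) - r * real n \<le> \<epsilon> * real n" using \<beta>(1) by simp
      then show ?case using elim(2) by (simp add: field_simps)
    qed
  qed
  then have dXY: "dst X Y = ereal r" using lower[OF assms(5)] by (rule order.antisym)
  have "dst1 X = ereal r"
    unfolding dst1_def
  proof (rule order.antisym)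
    \<comment> \<open>The infimum is attained at Y itself, which is one of the sequences of
      dimension 1.\<close>
    have "dst X Y \<in> {dst X Z |Z. cdim Z = 1}" using assms(5) by blast
    then have "Inf {dst X Z |Z. cdim Z = 1} \<le> dst X Y" by (rule Inf_lower)
    then show "Inf {dst X Z |Z. cdim Z = 1} \<le> ereal r" unfolding dXY .
    show "ereal r \<le> Inf {dst X Z |Z. cdim Z = 1}" using lower by (intro Inf_greatest) auto
  qed
  then show ?thesis using dim dXY by blast
qed

end
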